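(* $(\mathrm{3XCE}_{2},m_{set})\equiv^{\mathrm{sL}}_{m}(\mathrm{2SAT}_{3},m_{vbl})$; that is, each of these two parameterized decision problems is short $\mathrm{L}$-m-reducible to the other.
   Context: $(P_1,m_1)\leq^{\mathrm{sL}}_{m}(P_2,m_2)$ means there exist a function $f$ computable deterministically in polynomial time using logarithmic work space and constants $k_1,k_2>0$ such that for every input $x$: $x\in P_1$ iff $f(x)\in P_2$, and $m_2(f(x))\leq k_1m_1(x)+k_2$; $\equiv^{\mathrm{sL}}_{m}$ means both directions hold. For a finite universe $X$, a collection $C$ of subsets of $X$ and $R\subseteq X$: $C$ is an exact cover for $X$ exempt from $R$ if every element of $X-R$ belongs to exactly one member of $C$ and every element of $R$ belongs to at most one member of $C$. The overlapping cost of $u\in X$ w.r.t. $C$ is $|\{A\in C: u\in A\}|$; $C$ is 2-overlapping if every element has overlapping cost at most $2$. $\mathrm{3XCE}_2$: given a finite set $X$, a subset $R\subseteq X$, and a 2-overlapping collection $C$ of subsets of $X$ each having at most $3$ elements (elements of $X$ encoded with $O(\log|X|)$ bits), does $C$ contain a subcollection that is an exact cover for $X$ exempt from $R$? Size parameter $m_{set}(\langle X,R,C\rangle)=|C|$. $\mathrm{2SAT}_3$: given a 2CNF formula in which each variable occurs at most $3$ times in total as a literal, is it satisfiable? $m_{vbl}(\phi)$ = number of distinct variables of $\phi$. *)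

theory Defs
  imports Complex_Main "HOL-Library.Log_Nat"
begin

section \<open>Logarithmic-space polynomial-time transducers\<close>

text \<open>
  Deterministic Turing machines with a read-only two-way input tape delimited by endmarkers,
  a fixed number of rewritable semi-infinite work tapes, and a write-only one-way output tape.
  States and work symbols are initial segments of the natural numbers; state 0 is initial,
  work symbol 0 is the blank. The machine halts when the transition function yields None.
\<close>

datatype direction = GoLeft | Stay | GoRight

datatype 'a input_cell = LeftEnd | Letter 'a | RightEnd

record ('a, 'b) transducer =
  num_tapes :: nat
  num_states :: nat
  num_symbols :: nat
  trans :: "nat \<Rightarrow> 'a input_cell \<Rightarrow> nat list \<Rightarrow>
    (nat \<times> direction \<times> (nat \<times> direction) list \<times> 'b option) option"

text \<open>
  Under this condition a run only consults the transition function on a finite set of arguments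
  (the input alphabet being finite), so every machine is a finite object.
\<close>

definition wf_transducer :: "('a::finite, 'b::finite) transducer \<Rightarrow> bool" where
  "wf_transducer M \<longleftrightarrow> 0 < num_states M \<and> 0 < num_symbols M \<and>
    (\<forall>q a ss q' d acts out.
      q < num_states M \<longrightarrow> length ss = num_tapes M \<longrightarrow> (\<forall>s\<in>set ss. s < num_symbols M) \<longrightarrow>
      trans M q a ss = Some (q', d, acts, out) \<longrightarrow>
      q' < num_states M \<and> length acts = num_tapes M \<and>
      (\<forall>(s, e)\<in>set acts. s < num_symbols M))"

text \<open>A work tape is its contents together with the position of its head.\<close>

record 'b config =
  cstate :: nat
  cinput :: nat
  cworks :: "((nat \<Rightarrow> nat) \<times> nat) list"
  coutput :: "'b list"

definition init_config :: "('a, 'b) transducer \<Rightarrow> 'b config" where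
  "init_config M =
    \<lparr> cstate = 0, cinput = 0, cworks = replicate (num_tapes M) (\<lambda>_. 0, 0), coutput = [] \<rparr>"

definition input_at :: "'a list \<Rightarrow> nat \<Rightarrow> 'a input_cell" where
  "input_at x p =
    (if p = 0 then LeftEnd else if p \<le> length x then Letter (x ! (p - 1)) else RightEnd)"

fun move :: "direction \<Rightarrow> nat \<Rightarrow> nat" where
  "move GoLeft p = p - 1"
| "move Stay p = p"
| "move GoRight p = Suc p"

fun update_tape :: "(nat \<Rightarrow> nat) \<times> nat \<Rightarrow> nat \<times> direction \<Rightarrow> (nat \<Rightarrow> nat) \<times> nat" where
  "update_tape (tape, h) (s, d) = (tape(h := s), move d h)"

definition action ::
  "('a, 'b) transducer \<Rightarrow> 'a list \<Rightarrow> 'b config \<Rightarrow>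
    (nat \<times> direction \<times> (nat \<times> direction) list \<times> 'b option) option" where
  "action M x cf =
    trans M (cstate cf) (input_at x (cinput cf)) (map (\<lambda>(tape, h). tape h) (cworks cf))"

definition step :: "('a, 'b) transducer \<Rightarrow> 'a list \<Rightarrow> 'b config \<Rightarrow> 'b config" where
  "step M x cf =
    (case action M x cf of
      None \<Rightarrow> cf
    | Some (q, d, acts, out) \<Rightarrow>
        \<lparr> cstate = q,
          cinput = min (move d (cinput cf)) (Suc (length x)),
          cworks = map2 update_tape (cworks cf) acts,
          coutput = coutput cf @ (case out of None \<Rightarrow> [] | Some b \<Rightarrow> [b]) \<rparr>)"

definition run :: "('a, 'b) transducer \<Rightarrow> 'a list \<Rightarrow> nat \<Rightarrow> 'b config" where
  "run M x n = (step M x ^^ n) (init_config M)"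

definition outputs_in_time ::
  "('a, 'b) transducer \<Rightarrow> 'a list \<Rightarrow> 'b list \<Rightarrow> nat \<Rightarrow> bool" where
  "outputs_in_time M x y t \<longleftrightarrow>
    (\<exists>n\<le>t. action M x (run M x n) = None \<and> coutput (run M x n) = y)"

text \<open>
  Only work tapes are charged for space. As the number of tapes is constant, it suffices to
  bound the part of each single work tape that is visited.
\<close>

definition runs_in_space :: "('a, 'b) transducer \<Rightarrow> 'a list \<Rightarrow> nat \<Rightarrow> bool" where
  "runs_in_space M x s \<longleftrightarrow> (\<forall>n. \<forall>(tape, h)\<in>set (cworks (run M x n)). h < s)"

text \<open>Here and below, \<^term>\<open>floorlog 2 n\<close> is the length of the binary representation of n.\<close>

definition poly_time_log_space_computable ::
  "('a::finite list \<Rightarrow> 'b::finite list) \<Rightarrow> bool" where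
  "poly_time_log_space_computable f \<longleftrightarrow>
    (\<exists>(M :: ('a, 'b) transducer) c d e. wf_transducer M \<and>
      (\<forall>x. outputs_in_time M x (f x) (c * length x ^ d + c) \<and>
           runs_in_space M x (e * floorlog 2 (length x) + e)))"


section \<open>Parameterized problems and short reductions\<close>

type_synonym 'a param_problem = "'a list set \<times> ('a list \<Rightarrow> nat)"

definition sL_m_reducible ::
  "'a::finite param_problem \<Rightarrow> 'b::finite param_problem \<Rightarrow> bool" (infix "\<le>sL'_m" 50) where
  "A \<le>sL_m B \<longleftrightarrow>
    (\<exists>f (k1::real) (k2::real).
      poly_time_log_space_computable f \<and> k1 > 0 \<and> k2 > 0 \<and>
      (\<forall>x. (x \<in> fst A \<longleftrightarrow> f x \<in> fst B) \<and>
           real (snd B (f x)) \<le> k1 * real (snd A x) + k2))"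

definition sL_m_equivalent ::
  "'a::finite param_problem \<Rightarrow> 'b::finite param_problem \<Rightarrow> bool" (infix "\<equiv>sL'_m" 50) where
  "A \<equiv>sL_m B \<longleftrightarrow> A \<le>sL_m B \<and> B \<le>sL_m A"


section \<open>Strings encoding instances\<close>

text \<open>
  Variables and elements of the universe are named by bit strings. Each occurrence of a name is
  preceded by an item mark, followed by a negation mark if it is a negative literal.
\<close>

datatype sym = SBit bool | SItem | SNeg | SEnd

instance sym :: finite
proof
  have "(UNIV :: sym set) \<subseteq> {SBit True, SBit False, SItem, SNeg, SEnd}"
  proof
    fix s :: sym
    show "s \<in> {SBit True, SBit False, SItem, SNeg, SEnd}" by (cases s) auto
  qed
  then show "finite (UNIV :: sym set)" by (rule finite_subset) simp
qed

type_synonym name = "bool list"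


section \<open>Satisfiability of 2CNF formulas\<close>

datatype literal = Pos name | Neg name

type_synonym cnf = "literal list list"

fun var :: "literal \<Rightarrow> name" where
  "var (Pos v) = v"
| "var (Neg v) = v"

fun lit_true :: "(name \<Rightarrow> bool) \<Rightarrow> literal \<Rightarrow> bool" where
  "lit_true \<alpha> (Pos v) = \<alpha> v"
| "lit_true \<alpha> (Neg v) = (\<not> \<alpha> v)"

definition satisfiable :: "cnf \<Rightarrow> bool" where
  "satisfiable \<phi> \<longleftrightarrow> (\<exists>\<alpha>. \<forall>cl\<in>set \<phi>. \<exists>l\<in>set cl. lit_true \<alpha> l)"

definition is_2cnf :: "cnf \<Rightarrow> bool" where
  "is_2cnf \<phi> \<longleftrightarrow> (\<forall>cl\<in>set \<phi>. length cl \<le> 2)"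

definition vars :: "cnf \<Rightarrow> name set" where
  "vars \<phi> = var ` set (concat \<phi>)"

definition occurrences :: "cnf \<Rightarrow> name \<Rightarrow> nat" where
  "occurrences \<phi> v = count_list (map var (concat \<phi>)) v"

fun enc_literal :: "literal \<Rightarrow> sym list" where
  "enc_literal (Pos v) = SItem # map SBit v"
| "enc_literal (Neg v) = SItem # SNeg # map SBit v"

definition enc_cnf :: "cnf \<Rightarrow> sym list" where
  "enc_cnf \<phi> = concat (map (\<lambda>cl. concat (map enc_literal cl) @ [SEnd]) \<phi>)"

definition SAT2_3 :: "sym list set" where
  "SAT2_3 = {enc_cnf \<phi> | \<phi>. is_2cnf \<phi> \<and> (\<forall>v\<in>vars \<phi>. occurrences \<phi> v \<le> 3) \<and> satisfiable \<phi>}"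

text \<open>Strings that do not encode a formula get size 0; the encoding is injective, see below.\<close>

definition m_vbl :: "sym list \<Rightarrow> nat" where
  "m_vbl w = (if w \<in> range enc_cnf then card (vars (inv enc_cnf w)) else 0)"


section \<open>Exact covers with exemption\<close>

definition exact_cover_exempt :: "'e set \<Rightarrow> 'e set \<Rightarrow> 'e set set \<Rightarrow> bool" where
  "exact_cover_exempt X R C \<longleftrightarrow>
    (\<forall>u\<in>X - R. card {A \<in> C. u \<in> A} = 1) \<and> (\<forall>u\<in>R. card {A \<in> C. u \<in> A} \<le> 1)"

definition overlapping_cost :: "'e set set \<Rightarrow> 'e \<Rightarrow> nat" where
  "overlapping_cost C u = card {A \<in> C. u \<in> A}"

text \<open>
  A finite set is encoded by listing its members without repetition, in any order.
  An instance is encoded by its universe, its exempt set and the members of its collection.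
\<close>

definition enc_names :: "name list \<Rightarrow> sym list" where
  "enc_names us = concat (map (\<lambda>u. SItem # map SBit u) us) @ [SEnd]"

definition encodes_instance ::
  "sym list \<Rightarrow> name set \<Rightarrow> name set \<Rightarrow> name set set \<Rightarrow> bool" where
  "encodes_instance w X R C \<longleftrightarrow>
    (\<exists>xs rs cs. distinct xs \<and> distinct rs \<and> (\<forall>as\<in>set cs. distinct as) \<and> distinct (map set cs) \<and>
      X = set xs \<and> R = set rs \<and> C = set ` set cs \<and>
      w = enc_names xs @ enc_names rs @ concat (map enc_names cs))"

text \<open>
  The parameter c is the constant hidden in the requirement that elements of the universe are
  encoded with \<open>O(log |X|)\<close> bits. For every positive c, enough names are available.
\<close>

definition XCE3_2 :: "nat \<Rightarrow> sym list set" where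
  "XCE3_2 c = {w. \<exists>X R C. encodes_instance w X R C \<and>
      (\<forall>u\<in>X. length u \<le> c * floorlog 2 (card X)) \<and>
      R \<subseteq> X \<and> (\<forall>A\<in>C. A \<subseteq> X \<and> card A \<le> 3) \<and> (\<forall>u\<in>X. overlapping_cost C u \<le> 2) \<and>
      (\<exists>D\<subseteq>C. exact_cover_exempt X R D)}"

text \<open>Strings that do not encode an instance get size 0; the instance is unique, see below.\<close>

definition m_set :: "sym list \<Rightarrow> nat" where
  "m_set w = (if \<exists>X R C. encodes_instance w X R C
     then card (THE C. \<exists>X R. encodes_instance w X R C) else 0)"


section \<open>Unique readability\<close>

lemma map_SBit_append_eq:
  assumes "map SBit u @ r = map SBit v @ s"
    and "\<And>b t. r \<noteq> SBit b # t" and "\<And>b t. s \<noteq> SBit b # t"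
  shows "u = v \<and> r = s"
  using assms(1)
proof (induction u arbitrary: v)
  case Nil
  then show ?case using assms(2) by (cases v) auto
next
  case (Cons b u)
  then show ?case using assms(3) by (cases v) auto
qed

lemma enc_literal_append_eq:
  assumes "enc_literal l @ r = enc_literal m @ s"
    and "\<And>b t. r \<noteq> SBit b # t" and "\<And>b t. s \<noteq> SBit b # t"
    and "\<And>t. r \<noteq> SNeg # t" and "\<And>t. s \<noteq> SNeg # t"
  shows "l = m \<and> r = s"
proof (cases l; cases m)
  fix u v assume [simp]: "l = Pos u" "m = Pos v"
  show ?thesis using assms map_SBit_append_eq[of u r v s] by auto
next
  fix u v assume [simp]: "l = Neg u" "m = Neg v"
  show ?thesis using assms map_SBit_append_eq[of u r v s] by auto
next
  fix u v assume [simp]: "l = Pos u" "m = Neg v"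
  show ?thesis using assms by (cases u) auto
next
  fix u v assume [simp]: "l = Neg u" "m = Pos v"
  have "s \<noteq> SNeg # map SBit u @ r" by (rule assms(5))
  then show ?thesis using assms(1) by (cases v) auto
qed

lemma enc_literals_not_bit: "concat (map enc_literal ls) @ SEnd # r \<noteq> SBit b # t"
proof (cases ls)
  case (Cons l ls')
  then show ?thesis by (cases l) auto
qed simp

lemma enc_literals_not_neg: "concat (map enc_literal ls) @ SEnd # r \<noteq> SNeg # t"
proof (cases ls)
  case (Cons l ls')
  then show ?thesis by (cases l) auto
qed simp

lemma enc_clause_append_eq:
  assumes "concat (map enc_literal ls) @ SEnd # r = concat (map enc_literal ms) @ SEnd # s"
  shows "ls = ms \<and> r = s"
  using assms
proof (induction ls arbitrary: ms)
  case Nil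
  show ?case
  proof (cases ms)
    case Nil
    then show ?thesis using Nil.prems \<open>ms = []\<close> by simp
  next
    case (Cons m ms')
    then show ?thesis using Nil.prems by (cases m) auto
  qed
next
  case (Cons l ls)
  show ?case
  proof (cases ms)
    case Nil
    then show ?thesis using Cons.prems by (cases l) auto
  next
    case (Cons m ms')
    have "enc_literal l @ (concat (map enc_literal ls) @ SEnd # r) =
        enc_literal m @ (concat (map enc_literal ms') @ SEnd # s)"
      using Cons.prems Cons by simp
    then have "l = m \<and> concat (map enc_literal ls) @ SEnd # r =
        concat (map enc_literal ms') @ SEnd # s"
      by (rule enc_literal_append_eq) (rule enc_literals_not_bit enc_literals_not_neg)+
    then show ?thesis using Cons.IH Cons by simp
  qed
qed

lemma enc_cnf_inject: "enc_cnf \<phi> = enc_cnf \<psi> \<longleftrightarrow> \<phi> = \<psi>"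
proof
  show "enc_cnf \<phi> = enc_cnf \<psi> \<Longrightarrow> \<phi> = \<psi>"
  proof (induction \<phi> arbitrary: \<psi>)
    case Nil
    then show ?case by (cases \<psi>) (auto simp: enc_cnf_def)
  next
    case (Cons cl \<phi>)
    then obtain dl \<psi>' where psi: "\<psi> = dl # \<psi>'"
      by (cases \<psi>) (auto simp: enc_cnf_def)
    have "concat (map enc_literal cl) @ SEnd # enc_cnf \<phi> =
        concat (map enc_literal dl) @ SEnd # enc_cnf \<psi>'"
      using Cons.prems psi by (simp add: enc_cnf_def)
    from enc_clause_append_eq[OF this] show ?case using Cons.IH psi by blast
  qed
qed simp

lemma m_vbl_enc_cnf [simp]: "m_vbl (enc_cnf \<phi>) = card (vars \<phi>)"
proof -
  have "inj enc_cnf" by (rule injI) (simp add: enc_cnf_inject)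
  then show ?thesis by (simp add: m_vbl_def)
qed

lemma enc_names_eq_enc_clause: "enc_names us = concat (map enc_literal (map Pos us)) @ [SEnd]"
  unfolding enc_names_def by (induction us) auto

lemma concat_enc_names: "concat (map enc_names uss) = enc_cnf (map (map Pos) uss)"
  by (induction uss) (simp_all add: enc_cnf_def enc_names_eq_enc_clause)

lemma encodes_instance_unique:
  assumes "encodes_instance w X R C" and "encodes_instance w X' R' C'"
  shows "X = X' \<and> R = R' \<and> C = C'"
proof -
  obtain xs rs cs where 1: "X = set xs" "R = set rs" "C = set ` set cs"
      "w = concat (map enc_names (xs # rs # cs))"
    using assms(1) by (auto simp: encodes_instance_def)
  obtain xs' rs' cs' where 2: "X' = set xs'" "R' = set rs'" "C' = set ` set cs'"
      "w = concat (map enc_names (xs' # rs' # cs'))"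
    using assms(2) by (auto simp: encodes_instance_def)
  have "inj (map (map Pos))"
    by (intro inj_mapI injI) simp
  moreover have "map (map Pos) (xs # rs # cs) = map (map Pos) (xs' # rs' # cs')"
    using 1(4) 2(4) unfolding concat_enc_names enc_cnf_inject[symmetric] by simp
  ultimately have "xs # rs # cs = xs' # rs' # cs'" by (rule injD)
  then show ?thesis using 1 2 by simp
qed

lemma m_set_eq:
  assumes "encodes_instance w X R C"
  shows "m_set w = card C"
proof -
  have "(THE C. \<exists>X R. encodes_instance w X R C) = C"
    using assms encodes_instance_unique[OF assms] by (intro the_equality) blast+
  then show ?thesis using assms by (auto simp: m_set_def)
qed

end

theory Submission
  imports Defs
begin

text \<open>
  Reductions are written as programs over registers holding numbers of polynomial size. A machine
  keeps the registers in binary on a tape of logarithmic length, and it takes polynomial time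
  because it cannot repeat one of its polynomially many configurations before it halts. Such
  programs evaluate arithmetic with bounded sums and quantifiers over the positions of the input,
  and in this language validity of an instance and the reductions are expressed.

  An instance of exact cover becomes a formula with a few variables per member of a set of the
  collection, all saying that this set is chosen: for an element u in the sets A and B, at most
  one of A and B is chosen, and at least one of them unless u is exempt. Implications between
  the variables of a set keep them consistent.

  Conversely, each occurrence p of a variable x yields two sets, for the two values of x. They
  share a compulsory element, which forces a choice. A compulsory element shared by the set of
  \<open>x = False\<close> at one occurrence and that of \<open>x = True\<close> at the next one makes the choices agree. A
  clause with two literals is an exempt element of the two sets which falsify them; a clause with
  a single literal is a compulsory element of the set that satisfies it.
\<close>

section \<open>Programs over bounded registers\<close>

text \<open>On paper both reductions are short; the weight lies in exhibiting machines for them.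
  Hence machines are built once, by a compiler, and programs are written by hand only for a handful
  of basic constructs. No running time is ever counted. The limits in the two problems shape the
  gadgets. With one variable per occurrence of an element in a set, the exclusion and the covering
  of the element already use two of the three permitted occurrences, and linking it to both
  neighbours needs two more. With separate copies for positive and negative use, each copy takes
  part in only one of the two constraints and has two occurrences left for its links. In the other
  direction a set has room for three elements, and these are exactly its choice, a link and its
  clause, while each element is shared by at most two sets. One compulsory link element forces
  agreement in both directions, so the occurrences of a variable form a chain and need not be closed
  to a cycle. Invalid inputs are sent to fixed no-instances of size 0.\<close>

datatype 'a test = Less nat nat | Sym "'a input_cell \<Rightarrow> bool"

datatype ('a, 'b) com =
    Clr nat
  | Inc nat
  | Emit 'b
  | Head direction
  | Seq "('a, 'b) com" "('a, 'b) com"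
  | If "'a test" "('a, 'b) com" "('a, 'b) com"
  | While "'a test" "('a, 'b) com"

type_synonym 'b store = "(nat \<Rightarrow> nat) \<times> nat \<times> 'b list"

fun holds :: "'a list \<Rightarrow> 'a test \<Rightarrow> 'b store \<Rightarrow> bool" where
  "holds w (Less r s) (\<rho>, h, out) \<longleftrightarrow> \<rho> r < \<rho> s"
| "holds w (Sym P) (\<rho>, h, out) \<longleftrightarrow> P (input_at w h)"

text \<open>The parameter W bounds the number of bits of the registers throughout the run.\<close>

inductive exec :: "'a list \<Rightarrow> nat \<Rightarrow> ('a, 'b) com \<Rightarrow> 'b store \<Rightarrow> 'b store \<Rightarrow> bool" for w W where
  Clr: "exec w W (Clr r) (\<rho>, h, out) (\<rho>(r := 0), h, out)"
| Inc: "Suc (\<rho> r) < 2 ^ W \<Longrightarrow> exec w W (Inc r) (\<rho>, h, out) (\<rho>(r := Suc (\<rho> r)), h, out)"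
| Emit: "exec w W (Emit b) (\<rho>, h, out) (\<rho>, h, out @ [b])"
| Head: "exec w W (Head d) (\<rho>, h, out) (\<rho>, min (move d h) (Suc (length w)), out)"
| Seq: "exec w W c s s' \<Longrightarrow> exec w W d s' s'' \<Longrightarrow> exec w W (Seq c d) s s''"
| If: "exec w W (if holds w t s then c else d) s s' \<Longrightarrow> exec w W (If t c d) s s'"
| WhileF: "\<not> holds w t s \<Longrightarrow> exec w W (While t c) s s"
| WhileT: "holds w t s \<Longrightarrow> exec w W c s s' \<Longrightarrow> exec w W (While t c) s' s'' \<Longrightarrow>
    exec w W (While t c) s s''"

fun below_test :: "nat \<Rightarrow> 'a test \<Rightarrow> bool" where
  "below_test N (Less r s) \<longleftrightarrow> r < N \<and> s < N"
| "below_test N (Sym P) \<longleftrightarrow> True"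

fun below :: "nat \<Rightarrow> ('a, 'b) com \<Rightarrow> bool" where
  "below N (Clr r) \<longleftrightarrow> r < N"
| "below N (Inc r) \<longleftrightarrow> r < N"
| "below N (Emit b) \<longleftrightarrow> True"
| "below N (Head d) \<longleftrightarrow> True"
| "below N (Seq c d) \<longleftrightarrow> below N c \<and> below N d"
| "below N (If t c d) \<longleftrightarrow> below_test N t \<and> below N c \<and> below N d"
| "below N (While t c) \<longleftrightarrow> below_test N t \<and> below N c"

lemma below_test_mono: "below_test N t \<Longrightarrow> N \<le> N' \<Longrightarrow> below_test N' t"
  by (cases t) auto

lemma below_mono: "below N c \<Longrightarrow> N \<le> N' \<Longrightarrow> below N' c"
  by (induction c) (auto intro: below_test_mono)

lemma ex_below_test: "\<exists>N. below_test N t"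
proof (cases t)
  case (Less r s)
  then show ?thesis by (auto intro: exI[of _ "Suc (max r s)"])
qed simp

lemma ex_below: "\<exists>N. below N c"
proof (induction c)
  case (Seq c d)
  then obtain N N' where "below N c" "below N' d" by blast
  then show ?case by (auto intro!: exI[of _ "max N N'"] intro: below_mono)
next
  case (If t c d)
  then obtain N N' where "below N c" "below N' d" by blast
  moreover obtain N'' where "below_test N'' t" using ex_below_test by blast
  ultimately show ?case
    by (auto intro!: exI[of _ "max N (max N' N'')"] intro: below_mono below_test_mono)
next
  case (While t c)
  then obtain N where "below N c" by blast
  moreover obtain N'' where "below_test N'' t" using ex_below_test by blast
  ultimately show ?case
    by (auto intro!: exI[of _ "max N N''"] intro: below_mono below_test_mono)
qed auto


section \<open>The machine running a program\<close>

text \<open>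
  The control holds the list of programs still to be executed. A program replaces itself by the
  list \<open>after c b\<close>, where b is the result of the test, if there is one.
\<close>

fun after :: "('a, 'b) com \<Rightarrow> bool \<Rightarrow> ('a, 'b) com list" where
  "after (Seq c d) b = [c, d]"
| "after (If t c d) b = [if b then c else d]"
| "after (While t c) b = (if b then [c, While t c] else [])"
| "after _ b = []"

text \<open>The stacks that can arise from \<open>c # K\<close> before K is uncovered. The recursion
  follows \<open>c\<close> alone, so the set is finite although a loop puts itself back on the
  stack.\<close>

primrec conts :: "('a, 'b) com \<Rightarrow> ('a, 'b) com list \<Rightarrow> ('a, 'b) com list set" where
  "conts (Clr r) K = {Clr r # K}"
| "conts (Inc r) K = {Inc r # K}"
| "conts (Emit b) K = {Emit b # K}"
| "conts (Head d) K = {Head d # K}"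
| "conts (Seq c d) K = insert (Seq c d # K) (conts c (d # K) \<union> conts d K)"
| "conts (If t c d) K = insert (If t c d # K) (conts c K \<union> conts d K)"
| "conts (While t c) K = insert (While t c # K) (conts c (While t c # K))"

lemma finite_conts: "finite (conts c K)"
  by (induction c arbitrary: K) auto

lemma self_conts: "c # K \<in> conts c K"
  by (cases c) auto

text \<open>A move of the control replaces the head of the stack by \<open>after\<close>, which
  stays in the set or reaches K. K is arbitrary in the induction because the parts of a program run
  on larger stacks.\<close>

lemma conts_after:
  assumes "L \<in> conts c K"
  obtains d L' where "L = d # L'" and "L' \<in> insert K (conts c K)"
    and "\<And>b. after d b @ L' \<in> insert K (conts c K)"
proof -
  have "\<exists>d L'. L = d # L' \<and> (\<forall>L''\<in>{L', after d True @ L', after d False @ L'}.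
      L'' \<in> insert K (conts c K))"
    using assms
  proof (induction c arbitrary: K L)
    case (Seq c d)
    from Seq.prems consider "L = Seq c d # K" | "L \<in> conts c (d # K)" | "L \<in> conts d K" by auto
    then show ?case
    proof cases
      case 1
      then show ?thesis using self_conts[of c "d # K"] by simp
    next
      case 2
      from Seq.IH(1)[OF this] obtain e L' where
        "L = e # L'" "\<forall>L''\<in>{L', after e True @ L', after e False @ L'}. L'' \<in> insert (d # K) (conts c (d # K))"
        by blast
      moreover have "insert (d # K) (conts c (d # K)) \<subseteq> insert K (conts (Seq c d) K)"
        using self_conts[of d K] by auto
      ultimately show ?thesis by (intro exI[of _ e] exI[of _ L']) blast
    next
      case 3
      from Seq.IH(2)[OF this] obtain e L' where
        "L = e # L'" "\<forall>L''\<in>{L', after e True @ L', after e False @ L'}. L'' \<in> insert K (conts d K)"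
        by blast
      moreover have "insert K (conts d K) \<subseteq> insert K (conts (Seq c d) K)" by auto
      ultimately show ?thesis by (intro exI[of _ e] exI[of _ L']) blast
    qed
  next
    case (If t c d)
    from If.prems consider "L = If t c d # K" | e where "e \<in> {c, d}" "L \<in> conts e K" by auto
    then show ?case
    proof cases
      case 1
      then show ?thesis using self_conts[of c K] self_conts[of d K] by simp
    next
      case 2
      then obtain f L' where
        "L = f # L'" "\<forall>L''\<in>{L', after f True @ L', after f False @ L'}. L'' \<in> insert K (conts e K)"
        using If.IH by blast
      moreover have "insert K (conts e K) \<subseteq> insert K (conts (If t c d) K)" using 2(1) by auto
      ultimately show ?thesis by (intro exI[of _ f] exI[of _ L']) blast
    qed
  next
    case (While t c)
    from While.prems consider "L = While t c # K" | "L \<in> conts c (While t c # K)" by auto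
    then show ?case
    proof cases
      case 1
      then show ?thesis using self_conts[of c "While t c # K"] by simp
    next
      case 2
      from While.IH[OF this] obtain d L' where
        "L = d # L'" "\<forall>L''\<in>{L', after d True @ L', after d False @ L'}.
          L'' \<in> insert (While t c # K) (conts c (While t c # K))" by blast
      moreover have "insert (While t c # K) (conts c (While t c # K)) \<subseteq> insert K (conts (While t c) K)"
        by auto
      ultimately show ?thesis by (intro exI[of _ d] exI[of _ L']) blast
    qed
  qed auto
  then obtain d L' where *: "L = d # L'" "L' \<in> insert K (conts c K)"
    "after d True @ L' \<in> insert K (conts c K)" "after d False @ L' \<in> insert K (conts c K)" by blast
  have "after d b @ L' \<in> insert K (conts c K)" for b using * by (cases b) auto
  then show thesis using * that by blast
qed

text \<open>Nothing is said about the tail, which may contain programs of the arbitrary K; a move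
  inspects only the head.\<close>

lemma conts_below: "L \<in> conts c K \<Longrightarrow> below N c \<Longrightarrow> below N (hd L)"
  by (induction c arbitrary: K L) auto

text \<open>
  A single work tape holds all registers. Bit 0 of a cell marks the left end of the tape,
  bit 1 marks the cells in use, and bit \<open>r + 2\<close> of the cell j is bit j of register r.
  A register operation scans the cells from left to right, least significant bits first,
  and then returns to the left end, carrying the result of a comparison in the phase.
\<close>

datatype phase = Init | Scan bool | Ret bool

text \<open>An increment propagates a carry: ones become zeros until the first zero becomes a one,
  and setting bit 1 there extends the zone in use if the carry leaves it. In a comparison the flag
  holds the verdict on the digits read so far; a later digit is more significant, so a difference
  there overrides it.\<close>

fun scan :: "('a, 'b) com \<Rightarrow> bool \<Rightarrow> nat \<Rightarrow> phase \<times> nat \<times> direction" where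
  "scan (Clr r) b s =
    (if bit s (Suc 0) then (Scan b, unset_bit (Suc (Suc r)) s, GoRight) else (Ret b, s, Stay))"
| "scan (Inc r) b s =
    (if bit s (Suc (Suc r)) then (Scan b, unset_bit (Suc (Suc r)) s, GoRight)
     else (Ret b, set_bit (Suc 0) (set_bit (Suc (Suc r)) s), Stay))"
| "scan (If (Less r r') c d) b s =
    (if bit s (Suc 0) then (Scan (if bit s (Suc (Suc r)) = bit s (Suc (Suc r')) then b else bit s (Suc (Suc r'))), s, GoRight)
     else (Ret b, s, Stay))"
| "scan (While (Less r r') c) b s =
    (if bit s (Suc 0) then (Scan (if bit s (Suc (Suc r)) = bit s (Suc (Suc r')) then b else bit s (Suc (Suc r'))), s, GoRight)
     else (Ret b, s, Stay))"
| "scan c b s = (Ret b, s, Stay)"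

fun immediate :: "('a, 'b) com \<Rightarrow> 'a input_cell \<Rightarrow> (bool \<times> direction \<times> 'b option) option" where
  "immediate (Emit x) a = Some (False, Stay, Some x)"
| "immediate (Head d) a = Some (False, d, None)"
| "immediate (Seq c d) a = Some (False, Stay, None)"
| "immediate (If (Sym P) c d) a = Some (P a, Stay, None)"
| "immediate (While (Sym P) c) a = Some (P a, Stay, None)"
| "immediate c a = None"

text \<open>The initial move marks cell 0 both as the left end and as in use, so every register has
  at least one cell. Afterwards the machine halts exactly when the stack is empty.\<close>

fun next_move :: "('a, 'b) com list \<Rightarrow> phase \<Rightarrow> 'a input_cell \<Rightarrow> nat \<Rightarrow>
    ((('a, 'b) com list \<times> phase) \<times> direction \<times> (nat \<times> direction) \<times> 'b option) option" where
  "next_move K Init a s = Some ((K, Scan False), Stay, (set_bit 0 (set_bit (Suc 0) s), Stay), None)"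
| "next_move [] p a s = None"
| "next_move (c # K) (Ret b) a s =
    (if bit s 0 then Some ((after c b @ K, Scan False), Stay, (s, Stay), None)
     else Some ((c # K, Ret b), Stay, (s, GoLeft), None))"
| "next_move (c # K) (Scan b) a s =
    (case immediate c a of
      Some (b', d, out) \<Rightarrow> Some ((after c b' @ K, Scan False), d, (s, Stay), out)
    | None \<Rightarrow> (let (p, e) = scan c b s in Some ((c # K, p), Stay, e, None)))"

text \<open>May contain unreachable control states; only finiteness and closure under moves
  matter.\<close>

definition states :: "('a, 'b) com \<Rightarrow> (('a, 'b) com list \<times> phase) set" where
  "states c = insert [] (conts c []) \<times> {Init, Scan False, Scan True, Ret False, Ret True}"

lemma finite_states: "finite (states c)"
  by (simp add: states_def finite_conts)

lemma after_states:
  assumes "(d # L, p) \<in> states c"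
  shows "(after d b @ L, Scan b') \<in> states c" and "(L, Scan b') \<in> states c"
proof -
  have "d # L \<in> conts c []" using assms by (auto simp: states_def)
  then have "after d b @ L \<in> insert [] (conts c [])" and "L \<in> insert [] (conts c [])"
    by (auto elim: conts_after)
  then show "(after d b @ L, Scan b') \<in> states c" and "(L, Scan b') \<in> states c"
    by (cases b'; simp add: states_def)+
qed

lemma nat_less_power_iff_bit: "(n::nat) < 2 ^ N \<longleftrightarrow> (\<forall>j\<ge>N. \<not> bit n j)"
proof -
  have "n < 2 ^ N \<longleftrightarrow> take_bit N n = n" by (simp add: take_bit_nat_eq_self_iff)
  also have "\<dots> \<longleftrightarrow> (\<forall>j\<ge>N. \<not> bit n j)"
    unfolding bit_eq_iff by (simp add: bit_take_bit_iff) (meson not_less)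
  finally show ?thesis .
qed

definition alphabet :: "nat \<Rightarrow> nat" where
  "alphabet N = 2 ^ (N + 2)"

lemma less_alphabet_iff: "s < alphabet N \<longleftrightarrow> (\<forall>j\<ge>N + 2. \<not> bit s j)"
  unfolding alphabet_def by (rule nat_less_power_iff_bit)

lemma set_bit_alphabet: "s < alphabet N \<Longrightarrow> r < Suc (Suc N) \<Longrightarrow> set_bit r s < alphabet N"
  by (auto simp: less_alphabet_iff bit_set_bit_iff)

lemma unset_bit_alphabet: "s < alphabet N \<Longrightarrow> unset_bit r s < alphabet N"
  by (auto simp: less_alphabet_iff bit_unset_bit_iff)

lemma scan_less:
  assumes "scan c b s = (p, s', e)" and "below N c" and "s < alphabet N"
  shows "s' < alphabet N"
proof -
  have "s' = s \<or> (\<exists>r<N. s' = unset_bit (Suc (Suc r)) s \<or>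
      s' = set_bit (Suc 0) (set_bit (Suc (Suc r)) s))"
    using assms(1,2)
  proof (cases c)
    case (If t d e)
    then show ?thesis using assms(1,2) by (cases t) (simp_all split: if_splits)
  next
    case (While t d)
    then show ?thesis using assms(1,2) by (cases t) (simp_all split: if_splits)
  qed (auto split: if_splits)
  then show ?thesis using assms(3) by (auto intro!: set_bit_alphabet unset_bit_alphabet)
qed

lemma phase_states: "(K, p) \<in> states c \<Longrightarrow> (K, p') \<in> states c"
  by (cases p') (auto simp: states_def)

lemma next_move_states:
  assumes "(K, p) \<in> states c" and "below N c" and "s < alphabet N"
    and "next_move K p a s = Some (S, d, (s', e), out)"
  shows "S \<in> states c \<and> s' < alphabet N"
proof (cases "p = Init")
  case True
  then have "S = (K, Scan False)" "s' = set_bit 0 (set_bit (Suc 0) s)" using assms(4) by auto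
  then show ?thesis using assms phase_states by (auto intro!: set_bit_alphabet)
next
  case False
  then obtain f L where K: "K = f # L" using assms(4) by (cases K; cases p) auto
  then have f: "below N f" using assms(1,2) conts_below[of K c "[]" N] by (auto simp: states_def)
  show ?thesis
  proof (cases p)
    case (Ret b)
    then show ?thesis using assms K after_states[of f L p c] by (auto split: if_splits)
  next
    case (Scan b)
    show ?thesis
    proof (cases "immediate f a")
      case None
      then show ?thesis
        using assms(1,3,4) K Scan scan_less[OF _ f] phase_states by (auto split: prod.splits)
    next
      case (Some x)
      then show ?thesis
        using assms K Scan after_states[of f L p c] by (auto split: prod.splits)
    qed
  qed (use False in simp)
qed

definition machine :: "nat \<Rightarrow> ('a, 'b) com \<Rightarrow> (('a, 'b) com list \<times> phase \<Rightarrow> nat) \<Rightarrow> ('a, 'b) transducer" where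
  "machine N c idx =
    \<lparr> num_tapes = 1, num_states = card (states c), num_symbols = alphabet N,
      trans = (\<lambda>q a ss. case inv_into (states c) idx q of (K, p) \<Rightarrow>
        map_option (\<lambda>(S, d, act, out). (idx S, d, [act], out)) (next_move K p a (hd ss))) \<rparr>"

text \<open>States of a transducer are numbers below \<open>num_states\<close> and 0 is initial, so
  the control states are numbered by a bijection that sends the starting stack to 0.\<close>

locale compiled =
  fixes N :: nat and c :: "('a::finite, 'b::finite) com"
    and idx :: "('a, 'b) com list \<times> phase \<Rightarrow> nat" and M :: "('a, 'b) transducer"
  assumes below: "below N c"
    and inj: "inj_on idx (states c)"
    and idx_range: "idx ` states c = {..<card (states c)}"
    and idx_init: "idx ([c], Init) = 0"
  defines "M \<equiv> machine N c idx"
begin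

lemma inv_idx [simp]: "S \<in> states c \<Longrightarrow> inv_into (states c) idx (idx S) = S"
  by (rule inv_into_f_f[OF inj])

lemma idx_less: "S \<in> states c \<Longrightarrow> idx S < card (states c)"
  using idx_range by blast

lemma init_in_states: "([c], Init) \<in> states c"
  by (simp add: states_def self_conts)

lemma wf: "wf_transducer M"
  unfolding wf_transducer_def
proof (intro conjI allI impI)
  show "0 < num_states M" using finite_states init_in_states
    by (auto simp: M_def machine_def card_gt_0_iff)
  show "0 < num_symbols M" by (simp add: M_def machine_def alphabet_def)
  fix q a ss q' d acts out
  assume q: "q < num_states M" and ss: "length ss = num_tapes M" "\<forall>s\<in>set ss. s < num_symbols M"
    and tr: "trans M q a ss = Some (q', d, acts, out)"
  from q have q: "q \<in> idx ` states c" by (simp add: M_def machine_def idx_range)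
  obtain K p where S: "inv_into (states c) idx q = (K, p)" by fastforce
  then have "(K, p) \<in> states c" using inv_into_into[OF q] by simp
  moreover have "hd ss < alphabet N" using ss by (cases ss) (auto simp: M_def machine_def)
  moreover obtain S' s' e where S': "next_move K p a (hd ss) = Some (S', d, (s', e), out)"
    "q' = idx S'" "acts = [(s', e)]"
    using tr S by (auto simp: M_def machine_def)
  ultimately have *: "S' \<in> states c" "s' < alphabet N" using next_move_states[OF _ below] by blast+
  show "q' < num_states M" using S' * idx_less by (simp add: M_def machine_def)
  show "length acts = num_tapes M" using S' by (simp add: M_def machine_def)
  show "\<forall>(s, e)\<in>set acts. s < num_symbols M" using S' * by (simp add: M_def machine_def)
qed

definition cfg :: "('a, 'b) com list \<Rightarrow> phase \<Rightarrow> nat \<Rightarrow> (nat \<Rightarrow> nat) \<Rightarrow> nat \<Rightarrow> 'b list \<Rightarrow> 'b config" where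
  "cfg K p i t h out = \<lparr> cstate = idx (K, p), cinput = i, cworks = [(t, h)], coutput = out \<rparr>"

lemma action_cfg:
  assumes "(K, p) \<in> states c"
  shows "action M x (cfg K p i t h out) =
    map_option (\<lambda>(S, d, act, out). (idx S, d, [act], out)) (next_move K p (input_at x i) (t h))"
  using assms by (simp add: action_def M_def machine_def cfg_def)

lemma step_cfg:
  assumes "(K, p) \<in> states c"
    and "next_move K p (input_at x i) (t h) = Some ((K', p'), d, (s, e), b)"
  shows "step M x (cfg K p i t h out) =
    cfg K' p' (min (move d i) (Suc (length x))) (t(h := s)) (move e h)
      (out @ (case b of None \<Rightarrow> [] | Some b \<Rightarrow> [b]))"
  unfolding step_def action_cfg[OF assms(1)] using assms(2) by (simp add: cfg_def)

lemma init_cfg: "init_config M = cfg [c] Init 0 (\<lambda>_. 0) 0 []"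
  by (simp add: init_config_def cfg_def idx_init M_def machine_def)

end

lemma ex_index:
  assumes "finite S" and "s \<in> S"
  shows "\<exists>idx :: 'a \<Rightarrow> nat. inj_on idx S \<and> idx ` S = {..<card S} \<and> idx s = 0"
proof -
  obtain f where f: "bij_betw f S {0..<card S}" using ex_bij_betw_finite_nat[OF assms(1)] by blast
  \<comment> \<open>\<open>?g\<close> exchanges the numbers 0 and \<open>f s\<close> and is its own
    inverse.\<close>
  let ?g = "\<lambda>n. if n = f s then 0 else if n = 0 then f s else n"
  have "f s < card S" "0 < card S" using f assms by (auto simp: bij_betw_def)
  then have "bij_betw ?g {0..<card S} {..<card S}"
    by (intro bij_betw_byWitness[where f' = ?g]) auto
  with f have "bij_betw (?g \<circ> f) S {..<card S}" by (rule bij_betw_trans)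
  then show ?thesis by (intro exI[of _ "?g \<circ> f"]) (auto simp: bij_betw_def)
qed


text \<open>Reachability that records the space bound for every configuration on the way except the
  last, which is treated separately once it is known to be halted.\<close>

inductive leads :: "('a, 'b) transducer \<Rightarrow> 'a list \<Rightarrow> nat \<Rightarrow> 'b config \<Rightarrow> 'b config \<Rightarrow> bool"
  for M x s where
  leads_refl: "leads M x s cf cf"
| leads_step: "(\<forall>(t, h)\<in>set (cworks cf). h < s) \<Longrightarrow> leads M x s (step M x cf) cf' \<Longrightarrow>
    leads M x s cf cf'"

lemma leads_trans: "leads M x s cf cf' \<Longrightarrow> leads M x s cf' cf'' \<Longrightarrow> leads M x s cf cf''"
  by (induction rule: leads.induct) (auto intro: leads_step)

lemma leads_funpow:
  assumes "leads M x s cf cf'"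
  shows "\<exists>n. (step M x ^^ n) cf = cf' \<and>
    (\<forall>i<n. \<forall>(t, h)\<in>set (cworks ((step M x ^^ i) cf)). h < s)"
  using assms
proof (induction rule: leads.induct)
  case (leads_refl cf)
  then show ?case by (intro exI[of _ 0]) simp
next
  case (leads_step cf cf')
  then obtain n where n: "(step M x ^^ n) (step M x cf) = cf'"
    "\<forall>i<n. \<forall>(t, h)\<in>set (cworks ((step M x ^^ i) (step M x cf))). h < s" by blast
  have "\<forall>(t, h)\<in>set (cworks ((step M x ^^ i) cf)). h < s" if "i < Suc n" for i
    using that n(2) leads_step(1) by (cases i) (auto simp: funpow_swap1)
  then show ?case using n(1) by (intro exI[of _ "Suc n"]) (simp add: funpow_swap1)
qed

section \<open>Binary registers on a tape and the simulation of programs\<close>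

lemma bit_Suc_nat_iff:
  fixes v :: nat
  assumes "\<forall>i<j. bit v i" and "\<not> bit v j"
  shows "bit (Suc v) i \<longleftrightarrow> (if i < j then False else if i = j then True else bit v i)"
  using assms
proof (induction j arbitrary: v i)
  case 0
  then show ?case by (cases i) (auto simp: bit_0 bit_Suc)
next
  case (Suc j)
  have "odd v" using Suc.prems(1) by (auto simp: bit_0)
  then have v: "Suc v div 2 = Suc (v div 2)" "even (Suc v)" by presburger+
  have "\<forall>i<j. bit (v div 2) i" "\<not> bit (v div 2) j"
    using Suc.prems by (auto simp: bit_Suc[symmetric])
  from Suc.IH[OF this] v show ?case by (cases i) (auto simp: bit_0 bit_Suc)
qed

text \<open>The recursion behind a comparison that starts with the least significant digits: the
  newest digit decides unless it agrees in both numbers.\<close>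

lemma take_bit_less_step:
  fixes a b :: nat
  shows "take_bit (Suc j) a < take_bit (Suc j) b \<longleftrightarrow>
    (if bit a j = bit b j then take_bit j a < take_bit j b else bit b j)"
  by (cases "bit a j"; cases "bit b j")
    (auto simp: take_bit_Suc_from_most not_less
      intro: order.trans[OF less_imp_le[OF take_bit_nat_less_exp] le_add1]
        less_le_trans[OF take_bit_nat_less_exp le_add1])

text \<open>The zone in use has u cells. It never shrinks, as clearing a register keeps the marks,
  and an increment extends it by at most one cell; hence u varies during a run while W caps
  it.\<close>

definition tape_rep :: "nat \<Rightarrow> nat \<Rightarrow> (nat \<Rightarrow> nat) \<Rightarrow> (nat \<Rightarrow> nat) \<Rightarrow> bool" where
  "tape_rep W u t \<rho> \<longleftrightarrow> 1 \<le> u \<and> u \<le> W \<and> (\<forall>j. bit (t j) 0 \<longleftrightarrow> j = 0) \<and>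
    (\<forall>j. bit (t j) (Suc 0) \<longleftrightarrow> j < u) \<and>
    (\<forall>r j. bit (t j) (Suc (Suc r)) \<longleftrightarrow> bit (\<rho> r) j) \<and> (\<forall>r. \<rho> r < 2 ^ u)"

context compiled
begin

lemma leads_cfg:
  assumes "(K, p) \<in> states c" and "h < s"
    and "next_move K p (input_at x i) (t h) = Some ((K', p'), d, (a, e), b)"
    and "leads M x s (cfg K' p' (min (move d i) (Suc (length x))) (t(h := a)) (move e h)
      (out @ (case b of None \<Rightarrow> [] | Some b \<Rightarrow> [b]))) cf"
  shows "leads M x s (cfg K p i t h out) cf"
proof (rule leads_step)
  show "\<forall>(t, h)\<in>set (cworks (cfg K p i t h out)). h < s" using assms(2) by (simp add: cfg_def)
  have "step M x (cfg K p i t h out) =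
    cfg K' p' (min (move d i) (Suc (length x))) (t(h := a)) (move e h)
      (out @ (case b of None \<Rightarrow> [] | Some b \<Rightarrow> [b]))"
    by (rule step_cfg) (fact assms)+
  then show "leads M x s (step M x (cfg K p i t h out)) cf" using assms(4) by simp
qed

lemma leads_cfg_silent:
  assumes "(K, p) \<in> states c" and "h < s" and "i \<le> Suc (length x)"
    and "next_move K p (input_at x i) (t h) = Some ((K', p'), Stay, (a, e), None)"
    and "leads M x s (cfg K' p' i (t(h := a)) (move e h) out) cf"
  shows "leads M x s (cfg K p i t h out) cf"
  by (rule leads_cfg, fact, fact, rule assms(4)) (use assms(3,5) in \<open>simp add: min_absorb1\<close>)

lemma leads_return:
  assumes "(d # K, p) \<in> states c" and mark: "\<And>j. bit (t j) 0 \<longleftrightarrow> j = 0" and "h < s"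
    and i: "i \<le> Suc (length x)"
  shows "leads M x s (cfg (d # K) (Ret b) i t h out) (cfg (after d b @ K) (Scan False) i t 0 out)"
  using assms(3)
proof (induction h)
  case 0
  have nm: "next_move (d # K) (Ret b) a (t 0) = Some ((after d b @ K, Scan False), Stay, (t 0, Stay), None)" for a
    using mark by simp
  show ?case
    by (rule leads_cfg_silent, rule phase_states[OF assms(1)], rule 0, rule i, rule nm)
      (simp add: leads_refl)
next
  case (Suc h)
  have nm: "next_move (d # K) (Ret b) a (t (Suc h)) = Some ((d # K, Ret b), Stay, (t (Suc h), GoLeft), None)" for a
    using mark by simp
  show ?case
    by (rule leads_cfg_silent, rule phase_states[OF assms(1)], rule Suc.prems, rule i, rule nm)
      (use Suc in simp)
qed

lemma leads_test:
  assumes "(d # K, p) \<in> states c" and d: "d = If (Less r r') e e' \<or> d = While (Less r r') e"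
    and rep: "tape_rep W u t \<rho>" and i: "i \<le> Suc (length x)"
  shows "leads M x (Suc W) (cfg (d # K) (Scan False) i t 0 out)
    (cfg (after d (\<rho> r < \<rho> r') @ K) (Scan False) i t 0 out)"
proof -
  have u: "u \<le> W" using rep by (simp add: tape_rep_def)
  have bits: "bit (t j) (Suc 0) \<longleftrightarrow> j < u" "bit (t j) (Suc (Suc r)) \<longleftrightarrow> bit (\<rho> r) j" for j r
    using rep by (simp_all add: tape_rep_def)
  \<comment> \<open>The value of the flag after j cells compares the numbers formed by the j lowest
    digits.\<close>
  define less where "less = (\<lambda>j. take_bit j (\<rho> r) < take_bit j (\<rho> r'))"
  have "leads M x (Suc W) (cfg (d # K) (Scan (less j)) i t j out)
    (cfg (d # K) (Ret (less u)) i t u out)" if "j \<le> u" for j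
    using that
  proof (induction j rule: inc_induct)
    case base
    have nm: "next_move (d # K) (Scan (less u)) a (t u) = Some ((d # K, Ret (less u)), Stay, (t u, Stay), None)" for a
      using d bits by auto
    show ?case
      by (rule leads_cfg_silent, rule phase_states[OF assms(1)], use u in simp, rule i, rule nm)
        (simp add: leads_refl)
  next
    case (step j)
    have nm: "next_move (d # K) (Scan (less j)) a (t j) = Some ((d # K, Scan (less (Suc j))), Stay, (t j, GoRight), None)" for a
      using d bits step(2) by (auto simp: less_def take_bit_less_step)
    show ?case
      by (rule leads_cfg_silent, rule phase_states[OF assms(1)], use u step in simp, rule i, rule nm)
        (use step in simp)
  qed
  from this[of 0] have "leads M x (Suc W) (cfg (d # K) (Scan False) i t 0 out)
    (cfg (d # K) (Ret (less u)) i t u out)" by (simp add: less_def)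
  moreover have "take_bit u (\<rho> r) = \<rho> r" for r
    using rep by (simp add: tape_rep_def take_bit_nat_eq_self_iff)
  then have "less u \<longleftrightarrow> \<rho> r < \<rho> r'" by (simp add: less_def)
  moreover have "leads M x (Suc W) (cfg (d # K) (Ret (\<rho> r < \<rho> r')) i t u out)
    (cfg (after d (\<rho> r < \<rho> r') @ K) (Scan False) i t 0 out)"
    using rep i by (intro leads_return[OF assms(1)]) (auto simp: tape_rep_def)
  ultimately show ?thesis using leads_trans by fastforce
qed

abbreviation cleared :: "nat \<Rightarrow> nat \<Rightarrow> (nat \<Rightarrow> nat) \<Rightarrow> nat \<Rightarrow> nat" where
  "cleared r j t \<equiv> \<lambda>i. if i < j then unset_bit (Suc (Suc r)) (t i) else t i"

lemma cleared_Suc: "(cleared r j t)(j := unset_bit (Suc (Suc r)) (t j)) = cleared r (Suc j) t"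
  by (auto simp: less_Suc_eq)

lemma leads_Clr:
  assumes "(Clr r # K, p) \<in> states c"
    and rep: "tape_rep W u t \<rho>" and i: "i \<le> Suc (length x)"
  shows "\<exists>u' t'. tape_rep W u' t' (\<rho>(r := 0)) \<and>
    leads M x (Suc W) (cfg (Clr r # K) (Scan False) i t 0 out) (cfg K (Scan False) i t' 0 out)"
proof -
  have u: "u \<le> W" using rep by (simp add: tape_rep_def)
  have bits: "bit (t j) (Suc 0) \<longleftrightarrow> j < u" for j
    using rep by (simp add: tape_rep_def)
  have "leads M x (Suc W) (cfg (Clr r # K) (Scan False) i (cleared r j t) j out)
    (cfg (Clr r # K) (Ret False) i (cleared r u t) u out)" if "j \<le> u" for j
    using that
  proof (induction j rule: inc_induct)
    case base
    have nm: "next_move (Clr r # K) (Scan False) a (cleared r u t u) =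
        Some ((Clr r # K, Ret False), Stay, (cleared r u t u, Stay), None)" for a
      using bits by simp
    show ?case
      by (rule leads_cfg_silent, rule phase_states[OF assms(1)], use u in simp, rule i, rule nm)
        (simp add: leads_refl fun_upd_idem)
  next
    case (step j)
    have nm: "next_move (Clr r # K) (Scan False) a (cleared r j t j) =
        Some ((Clr r # K, Scan False), Stay, (unset_bit (Suc (Suc r)) (t j), GoRight), None)" for a
      using bits step(2) by simp
    show ?case
      by (rule leads_cfg_silent, rule phase_states[OF assms(1)], use u step in simp, rule i, rule nm,
          unfold cleared_Suc) (use step in simp)
  qed
  from this[of 0] have "leads M x (Suc W) (cfg (Clr r # K) (Scan False) i t 0 out)
    (cfg (Clr r # K) (Ret False) i (cleared r u t) u out)" by simp
  moreover have "leads M x (Suc W) (cfg (Clr r # K) (Ret False) i (cleared r u t) u out)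
    (cfg (after (Clr r) False @ K) (Scan False) i (cleared r u t) 0 out)"
    using rep i by (intro leads_return[OF assms(1)]) (auto simp: tape_rep_def bit_unset_bit_iff)
  ultimately have "leads M x (Suc W) (cfg (Clr r # K) (Scan False) i t 0 out)
    (cfg K (Scan False) i (cleared r u t) 0 out)" using leads_trans by fastforce
  \<comment> \<open>Outside the zone in use the digits of the register are 0 already, so clearing
    the zone clears the register.\<close>
  moreover have "\<not> bit (\<rho> r) j" if "u \<le> j" for j
    using rep that by (auto simp: tape_rep_def nat_less_power_iff_bit)
  then have "tape_rep W u (cleared r u t) (\<rho>(r := 0))"
    using rep by (auto simp: tape_rep_def bit_unset_bit_iff not_less)
  ultimately show ?thesis by blast
qed

lemma leads_Inc:
  assumes "(Inc r # K, p) \<in> states c" and less: "Suc (\<rho> r) < 2 ^ W"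
    and rep: "tape_rep W u t \<rho>" and i: "i \<le> Suc (length x)"
  shows "\<exists>u' t'. tape_rep W u' t' (\<rho>(r := Suc (\<rho> r))) \<and>
    leads M x (Suc W) (cfg (Inc r # K) (Scan False) i t 0 out) (cfg K (Scan False) i t' 0 out)"
proof -
  have u: "u \<le> W" using rep by (simp add: tape_rep_def)
  have bits: "bit (t j) (Suc (Suc r)) \<longleftrightarrow> bit (\<rho> r) j" for j
    using rep by (simp add: tape_rep_def)
  have zero: "\<not> bit (\<rho> r) j" if "u \<le> j" for j
    using rep that by (auto simp: tape_rep_def nat_less_power_iff_bit)
  \<comment> \<open>The lowest zero digit, where the carry stops. It exists because all digits from
    u on are zero.\<close>
  define v where "v = (LEAST j. \<not> bit (\<rho> r) j)"
  have v: "\<not> bit (\<rho> r) v" "\<And>j. j < v \<Longrightarrow> bit (\<rho> r) j"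
    unfolding v_def using LeastI[of "\<lambda>j. \<not> bit (\<rho> r) j", OF zero[OF order_refl]]
    by (blast dest: not_less_Least)+
  have "v \<le> u" using zero v(2)[of u] by (meson leI order_refl)
  have Suc_bits: "bit (Suc (\<rho> r)) j \<longleftrightarrow> (if j < v then False else if j = v then True else bit (\<rho> r) j)" for j
    using v by (intro bit_Suc_nat_iff) auto
  \<comment> \<open>A carry that stops at digit W or beyond would make the successor too large for W
    bits.\<close>
  have "v < W"
  proof (rule ccontr)
    assume "\<not> v < W"
    then show False using less Suc_bits[of v] by (auto simp: nat_less_power_iff_bit)
  qed
  define t' where "t' = (cleared r v t)(v := set_bit (Suc 0) (set_bit (Suc (Suc r)) (t v)))"
  have "leads M x (Suc W) (cfg (Inc r # K) (Scan False) i (cleared r j t) j out)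
    (cfg (Inc r # K) (Ret False) i t' v out)" if "j \<le> v" for j
    using that
  proof (induction j rule: inc_induct)
    case base
    have nm: "next_move (Inc r # K) (Scan False) a (cleared r v t v) = Some ((Inc r # K, Ret False),
        Stay, (set_bit (Suc 0) (set_bit (Suc (Suc r)) (t v)), Stay), None)" for a
      using bits v(1) by simp
    show ?case
      by (rule leads_cfg_silent, rule phase_states[OF assms(1)], use \<open>v < W\<close> in simp, rule i,
          rule nm, unfold t'_def[symmetric]) (simp add: leads_refl)
  next
    case (step j)
    have nm: "next_move (Inc r # K) (Scan False) a (cleared r j t j) =
        Some ((Inc r # K, Scan False), Stay, (unset_bit (Suc (Suc r)) (t j), GoRight), None)" for a
      using bits v(2)[OF step(2)] by simp
    show ?case
      by (rule leads_cfg_silent, rule phase_states[OF assms(1)], use \<open>v < W\<close> step in simp, rule i,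
          rule nm, unfold cleared_Suc) (use step in simp)
  qed
  from this[of 0] have "leads M x (Suc W) (cfg (Inc r # K) (Scan False) i t 0 out)
    (cfg (Inc r # K) (Ret False) i t' v out)" by simp
  moreover have "leads M x (Suc W) (cfg (Inc r # K) (Ret False) i t' v out)
    (cfg (after (Inc r) False @ K) (Scan False) i t' 0 out)"
    using rep i \<open>v < W\<close>
    by (intro leads_return[OF assms(1)]) (auto simp: tape_rep_def t'_def bit_set_bit_iff bit_unset_bit_iff)
  ultimately have "leads M x (Suc W) (cfg (Inc r # K) (Scan False) i t 0 out)
    (cfg K (Scan False) i t' 0 out)" using leads_trans by fastforce
  moreover have "tape_rep W (max u (Suc v)) t' (\<rho>(r := Suc (\<rho> r)))"
  proof -
    have "\<rho> s < 2 ^ max u (Suc v)" for s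
    proof -
      have "\<rho> s < 2 ^ u" using rep by (simp add: tape_rep_def)
      also have "(2::nat) ^ u \<le> 2 ^ max u (Suc v)" by simp
      finally show ?thesis .
    qed
    moreover have "Suc (\<rho> r) < 2 ^ max u (Suc v)"
      by (auto simp: nat_less_power_iff_bit Suc_bits zero)
    moreover have "bit (t' j) (Suc (Suc s)) \<longleftrightarrow> bit ((\<rho>(r := Suc (\<rho> r))) s) j" for s j
      using rep by (auto simp: tape_rep_def t'_def bit_set_bit_iff bit_unset_bit_iff Suc_bits)
    moreover have "bit (t' j) 0 \<longleftrightarrow> j = 0" for j
      using rep by (auto simp: tape_rep_def t'_def bit_set_bit_iff bit_unset_bit_iff)
    moreover have "bit (t' j) (Suc 0) \<longleftrightarrow> j < max u (Suc v)" for j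
      using rep \<open>v \<le> u\<close> by (auto simp: tape_rep_def t'_def bit_set_bit_iff bit_unset_bit_iff)
    ultimately show ?thesis using rep \<open>v < W\<close> u by (auto simp: tape_rep_def)
  qed
  ultimately show ?thesis by blast
qed

lemma leads_immediate:
  assumes "(d # K, p) \<in> states c" and "immediate d (input_at x i) = Some (b, m, y)"
  shows "leads M x (Suc W) (cfg (d # K) (Scan False) i t 0 out)
    (cfg (after d b @ K) (Scan False) (min (move m i) (Suc (length x))) t 0
      (out @ (case y of None \<Rightarrow> [] | Some y \<Rightarrow> [y])))"
proof -
  have nm: "next_move (d # K) (Scan False) (input_at x i) (t 0) =
      Some ((after d b @ K, Scan False), m, (t 0, Stay), y)"
    using assms(2) by simp
  show ?thesis
    by (rule leads_cfg, rule phase_states[OF assms(1)], simp, rule nm) (simp add: leads_refl)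
qed

lemma exec_input_bound:
  assumes "exec x W d s s'" and "fst (snd s) \<le> Suc (length x)"
  shows "fst (snd s') \<le> Suc (length x)"
  using assms by (induction rule: exec.induct) auto

text \<open>The rest K of the stack is arbitrary, since the first part of a sequence and the body of
  a loop run with more programs waiting than the whole does. Termination is no issue, as
  \<open>exec\<close> relates the stores of terminating runs only.\<close>

lemma leads_exec:
  assumes "exec x W d s s'" and "(d # K, p) \<in> states c" and "tape_rep W u t (fst s)"
    and "fst (snd s) \<le> Suc (length x)"
  shows "\<exists>u' t'. tape_rep W u' t' (fst s') \<and>
    leads M x (Suc W) (cfg (d # K) (Scan False) (fst (snd s)) t 0 (snd (snd s)))
      (cfg K (Scan False) (fst (snd s')) t' 0 (snd (snd s')))"
  using assms
proof (induction arbitrary: K p u t rule: exec.induct)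
  case (Clr r \<rho> h out)
  then show ?case using leads_Clr[of r K p W u t \<rho> h x out] by (simp only: fst_conv snd_conv)
next
  case (Inc \<rho> r h out)
  then show ?case using leads_Inc[of r K p \<rho> W u t h x out] by (simp only: fst_conv snd_conv)
next
  case (Emit b \<rho> h out)
  then show ?case using leads_immediate[OF Emit(1), of x h False Stay "Some b" W t out]
    by (auto simp: min_absorb1)
next
  case (Head m \<rho> h out)
  then show ?case using leads_immediate[OF Head(1), of x h False m None W t out]
    by auto
next
  case (Seq d1 s s' d2 s'')
  obtain \<rho> h out where s: "s = (\<rho>, h, out)" by (cases s)
  have 1: "leads M x (Suc W) (cfg (Seq d1 d2 # K) (Scan False) h t 0 out)
    (cfg (d1 # d2 # K) (Scan False) h t 0 out)"
    using leads_immediate[OF Seq.prems(1), of x h False Stay None W t out] Seq.prems s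
    by (simp add: min_absorb1)
  have st1: "(d1 # d2 # K, Scan False) \<in> states c"
    using after_states(1)[OF Seq.prems(1), of False False] by simp
  from Seq.IH(1)[OF this Seq.prems(2,3)] obtain u' t' where
    2: "tape_rep W u' t' (fst s')" "leads M x (Suc W) (cfg (d1 # d2 # K) (Scan False) h t 0 out)
      (cfg (d2 # K) (Scan False) (fst (snd s')) t' 0 (snd (snd s')))"
    using s by auto
  have "(d2 # K, Scan False) \<in> states c" by (rule after_states(2)[OF st1])
  from Seq.IH(2)[OF this 2(1) exec_input_bound[OF Seq.hyps(1) Seq.prems(3)]]
    leads_trans[OF leads_trans[OF 1 2(2)]] s
  show ?case by auto
next
  case (If tst s d1 d2 s')
  obtain \<rho> h out where s: "s = (\<rho>, h, out)" by (cases s)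
  have "leads M x (Suc W) (cfg (If tst d1 d2 # K) (Scan False) h t 0 out)
    (cfg (after (If tst d1 d2) (holds x tst s) @ K) (Scan False) h t 0 out)"
  proof (cases tst)
    case (Less r r')
    then show ?thesis
      using leads_test[OF If.prems(1) _ If.prems(2), where r = r and r' = r' and x = x and i = h and out = out] If.prems s Less by simp
  next
    case (Sym P)
    then show ?thesis
      using leads_immediate[OF If.prems(1), of x h "P (input_at x h)" Stay None W t out] If.prems s Sym
      by (simp add: min_absorb1)
  qed
  then have 1: "leads M x (Suc W) (cfg (If tst d1 d2 # K) (Scan False) h t 0 out)
    (cfg ((if holds x tst s then d1 else d2) # K) (Scan False) h t 0 out)" by simp
  have "((if holds x tst s then d1 else d2) # K, Scan False) \<in> states c"
    using after_states(1)[OF If.prems(1), of "holds x tst s" False] by simp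
  from If.IH[OF this If.prems(2,3)] leads_trans[OF 1] s show ?case by auto
next
  case (WhileF tst s d)
  obtain \<rho> h out where s: "s = (\<rho>, h, out)" by (cases s)
  have "leads M x (Suc W) (cfg (While tst d # K) (Scan False) h t 0 out)
    (cfg (after (While tst d) (holds x tst s) @ K) (Scan False) h t 0 out)"
  proof (cases tst)
    case (Less r r')
    then show ?thesis
      using leads_test[OF WhileF.prems(1) _ WhileF.prems(2), where r = r and r' = r' and x = x and i = h and out = out]
        WhileF.prems s Less by simp
  next
    case (Sym P)
    then show ?thesis
      using leads_immediate[OF WhileF.prems(1), of x h "P (input_at x h)" Stay None W t out] WhileF.prems s Sym
      by (simp add: min_absorb1)
  qed
  then show ?case using WhileF s by auto
next
  case (WhileT tst s d s' s'')
  obtain \<rho> h out where s: "s = (\<rho>, h, out)" by (cases s)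
  have 1: "leads M x (Suc W) (cfg (While tst d # K) (Scan False) h t 0 out)
    (cfg (after (While tst d) (holds x tst s) @ K) (Scan False) h t 0 out)"
  proof (cases tst)
    case (Less r r')
    then show ?thesis
      using leads_test[OF WhileT.prems(1) _ WhileT.prems(2), where r = r and r' = r' and x = x and i = h and out = out]
        WhileT.prems s Less by simp
  next
    case (Sym P)
    then show ?thesis
      using leads_immediate[OF WhileT.prems(1), of x h "P (input_at x h)" Stay None W t out] WhileT.prems s Sym
      by (simp add: min_absorb1)
  qed
  have st1: "(d # While tst d # K, Scan False) \<in> states c"
    using after_states(1)[OF WhileT.prems(1), of True False] by simp
  from WhileT.IH(1)[OF this WhileT.prems(2,3)] obtain u' t' where
    2: "tape_rep W u' t' (fst s')" "leads M x (Suc W) (cfg (d # While tst d # K) (Scan False) h t 0 out)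
      (cfg (While tst d # K) (Scan False) (fst (snd s')) t' 0 (snd (snd s')))"
    using s by auto
  have "(While tst d # K, Scan False) \<in> states c" by (rule after_states(2)[OF st1])
  have "leads M x (Suc W) (cfg (While tst d # K) (Scan False) h t 0 out)
    (cfg (While tst d # K) (Scan False) (fst (snd s')) t' 0 (snd (snd s')))"
    using leads_trans[OF _ 2(2)] 1 WhileT.hyps(1) by simp
  from WhileT.IH(2)[OF \<open>(While tst d # K, Scan False) \<in> states c\<close> 2(1)
      exec_input_bound[OF WhileT.hyps(2) WhileT.prems(3)]] leads_trans[OF this] s
  show ?case by auto
qed

text \<open>The space is W + 1 because a scan recognises the end of the zone by visiting the first
  cell after it; \<open>1 \<le> W\<close> leaves room for the initial zone of one cell.\<close>

lemma machine_correct: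
  assumes "exec x W c (\<lambda>_. 0, 0, []) (\<rho>, h, y)" and "1 \<le> W"
  shows "\<exists>n. action M x (run M x n) = None \<and> coutput (run M x n) = y"
    and "runs_in_space M x (Suc W)"
proof -
  let ?t = "(\<lambda>_. 0)(0 := set_bit 0 (set_bit (Suc 0) 0)) :: nat \<Rightarrow> nat"
  have "tape_rep W 1 ?t (\<lambda>_. 0)"
    using assms(2) by (auto simp: tape_rep_def bit_set_bit_iff bit_Suc_0_iff bit_0)
  moreover have st: "([c], Scan False) \<in> states c" by (rule phase_states[OF init_in_states])
  ultimately obtain u t where t: "leads M x (Suc W) (cfg [c] (Scan False) 0 ?t 0 [])
      (cfg [] (Scan False) h t 0 y)"
    using leads_exec[OF assms(1) st] by auto
  have "leads M x (Suc W) (init_config M) (cfg [] (Scan False) h t 0 y)"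
    unfolding init_cfg
    by (rule leads_cfg_silent, rule init_in_states, simp, simp, rule next_move.simps(1)) (use t in simp)
  then obtain n where n: "run M x n = cfg [] (Scan False) h t 0 y"
    "\<forall>i<n. \<forall>(t, h)\<in>set (cworks (run M x i)). h < Suc W"
    unfolding run_def using leads_funpow by blast
  have "([], Scan False) \<in> states c" by (simp add: states_def)
  then have halt: "action M x (run M x n) = None" using action_cfg n(1) by simp
  then show "\<exists>n. action M x (run M x n) = None \<and> coutput (run M x n) = y"
    using n(1) by (intro exI[of _ n]) (simp add: cfg_def)
  \<comment> \<open>A halted configuration is repeated forever, so the space bound extends to all
    times.\<close>
  have "run M x (n + i) = run M x n" for i
    using halt by (induction i) (simp_all add: run_def step_def)
  then have "\<forall>(t, h)\<in>set (cworks (run M x i)). h < Suc W" if "n \<le> i" for i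
    using that n(1) by (metis (no_types, lifting) add_diff_inverse_nat not_le cfg_def select_convs(3)
      case_prodI2 empty_set empty_iff list.set(2) insert_iff prod.inject zero_less_Suc)
  then show "runs_in_space M x (Suc W)" using n(2) unfolding runs_in_space_def by (meson not_le)
qed

end


section \<open>Halting in logarithmic space takes polynomial time\<close>

text \<open>The output is left out: no step depends on it, and the number of configurations that
  include it would not be polynomial.\<close>

definition memory :: "'b config \<Rightarrow> nat \<times> nat \<times> ((nat \<Rightarrow> nat) \<times> nat) list" where
  "memory cf = (cstate cf, cinput cf, cworks cf)"

lemma memory_action: "memory cf = memory cf' \<Longrightarrow> action M x cf = action M x cf'"
  by (simp add: memory_def action_def)

lemma memory_step: "memory cf = memory cf' \<Longrightarrow> memory (step M x cf) = memory (step M x cf')"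
  by (simp add: step_def memory_action[of cf cf'] split: option.split prod.split)
    (simp add: memory_def)

lemma run_halted: "action M x (run M x n) = None \<Longrightarrow> run M x (n + k) = run M x n"
  by (induction k) (simp_all add: run_def step_def)

lemma memory_run: "memory (run M x i) = memory (run M x j) \<Longrightarrow>
    memory (run M x (i + k)) = memory (run M x (j + k))"
proof (induction k)
  case (Suc k)
  from memory_step[OF Suc.IH[OF Suc.prems], of M x] show ?case by (simp add: run_def)
qed simp

text \<open>The head stays below s, so the cells from s on are never written and remain blank. The
  tape is thus determined by its first s cells, as counting configurations requires.\<close>

lemma run_one_tape:
  assumes wf: "wf_transducer M" and one: "num_tapes M = 1" and space: "runs_in_space M x s"
  shows "\<exists>t h. cworks (run M x n) = [(t, h)] \<and> h < s \<and> (\<forall>j. t j < num_symbols M) \<and>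
    (\<forall>j\<ge>s. t j = 0) \<and> cstate (run M x n) < num_states M \<and> cinput (run M x n) \<le> Suc (length x)"
proof (induction n)
  case 0
  have "cworks (run M x 0) = [(\<lambda>_. 0, 0)]" using one by (simp add: run_def init_config_def)
  moreover from this have "0 < s" using space by (force simp: runs_in_space_def dest: spec[of _ 0])
  ultimately show ?case using wf by (simp add: wf_transducer_def run_def init_config_def)
next
  case (Suc n)
  then obtain t h where *: "cworks (run M x n) = [(t, h)]" "h < s" "\<And>j. t j < num_symbols M"
    "\<And>j. s \<le> j \<Longrightarrow> t j = 0" "cstate (run M x n) < num_states M"
    "cinput (run M x n) \<le> Suc (length x)" by blast
  have step: "run M x (Suc n) = step M x (run M x n)" by (simp add: run_def)
  show ?case
  proof (cases "action M x (run M x n)")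
    case None
    then show ?thesis using * by (simp add: step step_def)
  next
    case (Some a)
    obtain q d acts out where a: "a = (q, d, acts, out)" by (cases a)
    have tr: "trans M (cstate (run M x n)) (input_at x (cinput (run M x n))) [t h] = Some (q, d, acts, out)"
      using Some * by (simp add: action_def a)
    have "length [t h] = num_tapes M" "\<forall>s\<in>set [t h]. s < num_symbols M" using one *(3) by auto
    then have ok: "q < num_states M" "length acts = 1" "\<forall>(s, e)\<in>set acts. s < num_symbols M"
      using wf *(5) tr one unfolding wf_transducer_def by metis+
    then obtain b e where acts: "acts = [(b, e)]" "b < num_symbols M"
      by (cases acts) auto
    have works: "cworks (run M x (Suc n)) = [(t(h := b), move e h)]"
      using Some * by (simp add: step step_def a acts)
    then have "move e h < s" using space by (force simp: runs_in_space_def dest: spec[of _ "Suc n"])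
    moreover have "cstate (run M x (Suc n)) = q"
      and "cinput (run M x (Suc n)) \<le> Suc (length x)"
      using Some by (simp_all add: step step_def a)
    ultimately show ?thesis using works ok acts * by (intro exI[of _ "t(h := b)"] exI[of _ "move e h"]) auto
  qed
qed

text \<open>A run that repeats a memory before halting never halts. The bound is the number of
  memories: states, input positions, contents of s cells and positions of the work head.\<close>

lemma halting_time:
  assumes wf: "wf_transducer M" and one: "num_tapes M = 1" and space: "runs_in_space M x s"
    and halt: "action M x (run M x n) = None"
  shows "outputs_in_time M x (coutput (run M x n))
    (num_states M * ((length x + 2) * (num_symbols M ^ s * s)))"
proof -
  define m where "m = (LEAST m. action M x (run M x m) = None)"
  have m: "action M x (run M x m) = None" "\<And>i. i < m \<Longrightarrow> action M x (run M x i) \<noteq> None"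
    unfolding m_def using LeastI[of "\<lambda>m. action M x (run M x m) = None", OF halt] by (blast dest: not_less_Least)+
  have "m \<le> n" using m(2) halt by (meson not_le)
  then have same: "run M x n = run M x m" using run_halted[OF m(1), of "n - m"] by simp
  \<comment> \<open>A finite substitute for the memory, whose tape is a function on all natural
    numbers.\<close>
  define core where "core = (\<lambda>i. (cstate (run M x i), cinput (run M x i),
      map (fst (hd (cworks (run M x i)))) [0..<s], snd (hd (cworks (run M x i)))))"
  have memory: "memory (run M x i) = memory (run M x j)" if "core i = core j" for i j
  proof -
    obtain t h where i: "cworks (run M x i) = [(t, h)]" "\<forall>j\<ge>s. t j = 0"
      using run_one_tape[OF wf one space, of i] by blast
    obtain t' h' where j: "cworks (run M x j) = [(t', h')]" "\<forall>j\<ge>s. t' j = 0"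
      using run_one_tape[OF wf one space, of j] by blast
    have "t k = t' k" for k
      using that i j by (cases "k < s") (auto simp: core_def)
    then have "t = t'" by blast
    then show ?thesis using that i j by (auto simp: core_def memory_def)
  qed
  have "inj_on core {..m}"
  proof (rule linorder_inj_onI')
    fix i j assume ij: "i \<in> {..m}" "j \<in> {..m}" "i < j"
    show "core i \<noteq> core j"
    proof
      \<comment> \<open>Equal memories at times i and j have equal futures, so the run would halt
        already at time \<open>i + (m - j)\<close>, before its first halting time m.\<close>
      assume "core i = core j"
      from memory_run[OF memory[OF this], of "m - j"] ij
      have "memory (run M x (i + (m - j))) = memory (run M x m)" by simp
      from memory_action[OF this, of M x] m(1) have "action M x (run M x (i + (m - j))) = None" by simp
      moreover have "i + (m - j) < m" using ij by auto
      ultimately show False using m(2) by blast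
    qed
  qed
  moreover have "core ` {..m} \<subseteq> {..<num_states M} \<times> ({..<length x + 2} \<times>
      ({xs. set xs \<subseteq> {..<num_symbols M} \<and> length xs = s} \<times> {..<s}))"
  proof
    fix y assume "y \<in> core ` {..m}"
    then obtain i where y: "y = core i" by blast
    obtain t h where "cworks (run M x i) = [(t, h)]" "h < s" "\<forall>j. t j < num_symbols M"
      "cstate (run M x i) < num_states M" "cinput (run M x i) \<le> Suc (length x)"
      using run_one_tape[OF wf one space, of i] by blast
    then show "y \<in> {..<num_states M} \<times> ({..<length x + 2} \<times>
      ({xs. set xs \<subseteq> {..<num_symbols M} \<and> length xs = s} \<times> {..<s}))"
      by (auto simp: y core_def)
  qed
  ultimately have "card {..m} \<le> card ({..<num_states M} \<times> ({..<length x + 2} \<times>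
      ({xs. set xs \<subseteq> {..<num_symbols M} \<and> length xs = s} \<times> {..<s})))"
    by (intro card_inj_on_le) (auto simp: finite_lists_length_eq)
  then have "m \<le> num_states M * ((length x + 2) * (num_symbols M ^ s * s))"
    by (simp add: card_cartesian_product card_lists_length_eq)
  then show ?thesis unfolding outputs_in_time_def using m(1) same by auto
qed

lemma power_floorlog_le: "2 ^ Suc (floorlog 2 n) \<le> 4 * Suc n"
proof (cases "n = 0")
  case True
  then show ?thesis by (simp add: floorlog_def)
next
  case False
  then have "2 ^ (floorlog 2 n - 1) \<le> n" using floorlog_bounds[of n 2] by simp
  moreover have "(2::nat) ^ Suc (floorlog 2 n) \<le> 4 * 2 ^ (floorlog 2 n - 1)"
    by (cases "floorlog 2 n") auto
  ultimately show ?thesis by (meson le_SucI mult_le_mono2 order.trans)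
qed

lemma less_power_floorlog: "n < 2 ^ floorlog 2 n"
  using floorlog_bounds[of n 2] by (cases "n = 0") (auto simp: floorlog_def)

text \<open>Brings a bound by powers of n + 1 into the shape of the time bounds, a multiple of
  \<open>n ^ d\<close> plus a constant, which has to cover n = 0 as well.\<close>

lemma Suc_power_le: "Suc n ^ d \<le> 2 ^ d * n ^ d + (2::nat) ^ d"
proof (cases "n = 0")
  case False
  then have "Suc n ^ d \<le> (2 * n) ^ d" by (intro power_mono) auto
  then show ?thesis by (simp add: power_mult_distrib)
qed (use one_le_power[of "2::nat" d] in \<open>simp add: trans_le_add2\<close>)

text \<open>The power of 2 whose exponent is the logarithm plus one is at most linear in n, so a
  number of tape contents exponential in the space is polynomial in n.\<close>

lemma configurations_polynomial:
  "\<exists>C d. \<forall>n. S * ((n + 2) * ((2 ^ a) ^ (e * floorlog 2 n + e) * (e * floorlog 2 n + e))) \<le> C * n ^ d + (C::nat)"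
proof -
  \<comment> \<open>Degree \<open>a * e\<close> for the tape contents, one more for the input
    positions and one more for the head positions.\<close>
  define d where "d = a * e + 2"
  have "S * ((n + 2) * ((2 ^ a) ^ (e * floorlog 2 n + e) * (e * floorlog 2 n + e)))
      \<le> (S * e * 4 ^ d * 2 ^ d) * n ^ d + (S * e * 4 ^ d * 2 ^ d)" for n
  proof -
    define l where "l = Suc (floorlog 2 n)"
    have l: "2 ^ l \<le> 4 * Suc n" unfolding l_def by (rule power_floorlog_le)
    have "e * floorlog 2 n + e = e * l" by (simp add: l_def)
    moreover have "(2 ^ a) ^ (e * l) = ((2::nat) ^ l) ^ (a * e)"
      by (simp add: power_mult[symmetric] mult.commute mult.left_commute)
    moreover have "((2::nat) ^ l) ^ (a * e) \<le> (4 * Suc n) ^ (a * e)" using l by (intro power_mono) auto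
    moreover have "l \<le> 4 * Suc n" using l less_exp[of l] by linarith
    moreover have "n + 2 \<le> 4 * Suc n" by simp
    ultimately have "S * ((n + 2) * ((2 ^ a) ^ (e * floorlog 2 n + e) * (e * floorlog 2 n + e)))
        \<le> S * ((4 * Suc n) * ((4 * Suc n) ^ (a * e) * (e * (4 * Suc n))))"
      by (simp only:) (intro mult_le_mono order_refl)
    also have "\<dots> = S * e * (4 * Suc n) ^ d"
      by (simp only: d_def power_add power2_eq_square ac_simps)
    also have "\<dots> = S * e * 4 ^ d * Suc n ^ d" by (simp only: power_mult_distrib ac_simps)
    also have "\<dots> \<le> S * e * 4 ^ d * (2 ^ d * n ^ d + 2 ^ d)"
      by (intro mult_le_mono order_refl Suc_power_le)
    finally show ?thesis by (simp add: algebra_simps)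
  qed
  then show ?thesis by blast
qed

lemma runs_in_space_mono: "runs_in_space M x s \<Longrightarrow> s \<le> s' \<Longrightarrow> runs_in_space M x s'"
  by (force simp: runs_in_space_def intro: less_le_trans)

text \<open>A polynomial bound on the registers is a logarithmic bound on their numbers of digits.
  No bound on the number of steps of the program is assumed.\<close>

lemma poly_time_log_spaceI:
  fixes f :: "'a::finite list \<Rightarrow> 'b::finite list"
  assumes exec: "\<And>w W. (length w + 2) ^ D < 2 ^ W \<Longrightarrow> \<exists>\<rho> h. exec w W c (\<lambda>_. 0, 0, []) (\<rho>, h, f w)"
  shows "poly_time_log_space_computable f"
proof -
  obtain N where N: "below N c" using ex_below by blast
  obtain idx where idx: "inj_on idx (states c)" "idx ` states c = {..<card (states c)}"
      "idx ([c], Init) = (0::nat)"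
    using ex_index[OF finite_states, of "([c], Init)" c] by (auto simp: states_def self_conts)
  interpret compiled N c idx "machine N c idx"
    using N idx by unfold_locales auto
  let ?M = "machine N c idx"
  \<comment> \<open>The factor D comes from the registers; the 2 covers the extra digit in W and the
    extra cell visited by scans.\<close>
  define e where "e = D + 2"
  have space: "runs_in_space ?M x (e * floorlog 2 (length x) + e)"
    and halt: "\<exists>n. action ?M x (run ?M x n) = None \<and> coutput (run ?M x n) = f x" for x
  proof -
    define l where "l = floorlog 2 (length x)"
    \<comment> \<open>Since \<open>length x + 2\<close> is at most \<open>2 ^ Suc l\<close>, its
      D-th power is at most \<open>2 ^ (D * Suc l)\<close>; one more digit makes the bound
      strict.\<close>
    define W where "W = Suc (D * Suc l)"
    have "length x + 2 \<le> 2 ^ Suc l" using less_power_floorlog[of "length x"] by (simp add: l_def)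
    then have "(length x + 2) ^ D \<le> (2 ^ Suc l) ^ D" by (intro power_mono) auto
    also have "\<dots> = 2 ^ (D * Suc l)" by (metis power_mult mult.commute)
    also have "\<dots> < 2 ^ W" unfolding W_def by (rule power_strict_increasing) simp_all
    finally obtain \<rho> h where *: "exec x W c (\<lambda>_. 0, 0, []) (\<rho>, h, f x)" using exec by blast
    have "1 \<le> W" by (simp add: W_def)
    note machine_correct[OF * this]
    moreover have "Suc W \<le> e * floorlog 2 (length x) + e" by (simp add: W_def e_def l_def algebra_simps)
    ultimately show "runs_in_space ?M x (e * floorlog 2 (length x) + e)"
      and "\<exists>n. action ?M x (run ?M x n) = None \<and> coutput (run ?M x n) = f x"
      by (auto intro: runs_in_space_mono)
  qed
  obtain C d where Cd: "\<And>n. card (states c) * ((n + 2) *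
      ((2 ^ (N + 2)) ^ (e * floorlog 2 n + e) * (e * floorlog 2 n + e))) \<le> C * n ^ d + C"
    using configurations_polynomial by meson
  have "outputs_in_time ?M x (f x) (C * length x ^ d + C)" for x
  proof -
    obtain n where "action ?M x (run ?M x n) = None" "coutput (run ?M x n) = f x" using halt by blast
    with halting_time[OF wf _ space, of x n] have "outputs_in_time ?M x (f x)
      (card (states c) * ((length x + 2) * ((2 ^ (N + 2)) ^ (e * floorlog 2 (length x) + e) *
        (e * floorlog 2 (length x) + e))))"
      by (simp add: machine_def alphabet_def)
    then show ?thesis using Cd[of "length x"] unfolding outputs_in_time_def by (meson order.trans)
  qed
  then show ?thesis unfolding poly_time_log_space_computable_def using wf space by blast
qed


section \<open>Functions computed by programs\<close>

definition For :: "nat \<Rightarrow> nat \<Rightarrow> ('a, 'b) com \<Rightarrow> ('a, 'b) com" where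
  "For v r c = Seq (Clr v) (While (Less v r) (Seq c (Inc v)))"

abbreviation Skip :: "('a, 'b) com" where "Skip \<equiv> Head Stay"

text \<open>The invariant has to fix the counter and the bound, so the body may read them but must
  preserve them. The counter never exceeds N, so the loop itself only asks that N fits into W
  bits.\<close>

lemma exec_For:
  assumes N: "N < 2 ^ W" and init: "I 0 (\<rho>(v := 0)) h out"
    and step: "\<And>i \<rho> h out. i < N \<Longrightarrow> I i \<rho> h out \<Longrightarrow>
      \<exists>\<rho>' h' out'. exec w W c (\<rho>, h, out) (\<rho>', h', out') \<and> \<rho>' v = i \<and> I (Suc i) (\<rho>'(v := Suc i)) h' out'"
    and vars: "\<And>i \<rho> h out. I i \<rho> h out \<Longrightarrow> \<rho> v = i \<and> \<rho> r = N"
  shows "\<exists>\<rho>' h' out'. exec w W (For v r c) (\<rho>, h, out) (\<rho>', h', out') \<and> I N \<rho>' h' out'"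
proof -
  have "\<exists>\<rho>' h' out'. exec w W (While (Less v r) (Seq c (Inc v))) (\<rho>, h, out) (\<rho>', h', out') \<and> I N \<rho>' h' out'"
    if "i \<le> N" "I i \<rho> h out" for i \<rho> h out
    using that
  proof (induction i arbitrary: \<rho> h out rule: inc_induct)
    case base
    have "exec w W (While (Less v r) (Seq c (Inc v))) (\<rho>, h, out) (\<rho>, h, out)"
      by (rule exec.WhileF) (use vars[OF base] in simp)
    with base show ?case by blast
  next
    case (step i)
    from assms(3)[OF step(2,4)] obtain \<rho>' h' out' where
      *: "exec w W c (\<rho>, h, out) (\<rho>', h', out')" "\<rho>' v = i" "I (Suc i) (\<rho>'(v := Suc i)) h' out'" by blast
    from step.IH[OF *(3)] obtain \<rho>'' h'' out'' where
      **: "exec w W (While (Less v r) (Seq c (Inc v))) (\<rho>'(v := Suc i), h', out') (\<rho>'', h'', out'')" "I N \<rho>'' h'' out''"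
      by blast
    have "exec w W (Inc v) (\<rho>', h', out') (\<rho>'(v := Suc i), h', out')"
      using exec.Inc[of \<rho>' v W w h' out'] *(2) step(2) N by simp
    with *(1) have "exec w W (Seq c (Inc v)) (\<rho>, h, out) (\<rho>'(v := Suc i), h', out')" by (rule exec.Seq)
    moreover have "holds w (Less v r) (\<rho>, h, out)" using vars[OF step(4)] step(2) by simp
    ultimately have "exec w W (While (Less v r) (Seq c (Inc v))) (\<rho>, h, out) (\<rho>'', h'', out'')"
      using **(1) exec.WhileT by metis
    with **(2) show ?case by blast
  qed
  from this[OF _ init] show ?thesis unfolding For_def by (meson exec.Clr exec.Seq zero_le)
qed

lemma exec_add:
  assumes "\<rho> t + \<rho> r < 2 ^ W" and "distinct [t, r, v]"
  shows "\<exists>\<rho>'. exec w W (For v r (Inc t)) (\<rho>, h, out) (\<rho>', h, out) \<and>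
    \<rho>' t = \<rho> t + \<rho> r \<and> (\<forall>i. i \<noteq> t \<and> i \<noteq> v \<longrightarrow> \<rho>' i = \<rho> i)"
proof -
  let ?I = "\<lambda>i \<rho>' h' out'. \<rho>' v = i \<and> \<rho>' t = \<rho> t + i \<and> (\<forall>i. i \<noteq> t \<and> i \<noteq> v \<longrightarrow> \<rho>' i = \<rho> i) \<and>
    h' = h \<and> out' = out"
  have "\<exists>\<rho>' h' out'. exec w W (For v r (Inc t)) (\<rho>, h, out) (\<rho>', h', out') \<and> ?I (\<rho> r) \<rho>' h' out'"
  proof (rule exec_For[where I = ?I])
    fix i \<rho>' h' out'
    assume i: "i < \<rho> r" and I: "?I i \<rho>' h' out'"
    then have "exec w W (Inc t) (\<rho>', h', out') (\<rho>'(t := Suc (\<rho>' t)), h', out')"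
      using assms by (intro exec.Inc) auto
    then show "\<exists>\<rho>'' h'' out''. exec w W (Inc t) (\<rho>', h', out') (\<rho>'', h'', out'') \<and> \<rho>'' v = i \<and>
        ?I (Suc i) (\<rho>''(v := Suc i)) h'' out''"
      using I assms(2) by (intro exI[of _ "\<rho>'(t := Suc (\<rho>' t))"] exI[of _ h'] exI[of _ out']) auto
  qed (use assms in auto)
  then show ?thesis by blast
qed

definition copy :: "nat \<Rightarrow> nat \<Rightarrow> nat \<Rightarrow> ('a, 'b) com" where
  "copy t r v = Seq (Clr t) (For v r (Inc t))"

lemma exec_copy:
  assumes "\<rho> r < 2 ^ W" and "distinct [t, r, v]"
  shows "\<exists>\<rho>'. exec w W (copy t r v) (\<rho>, h, out) (\<rho>', h, out) \<and>
    \<rho>' t = \<rho> r \<and> (\<forall>i. i \<noteq> t \<and> i \<noteq> v \<longrightarrow> \<rho>' i = \<rho> i)"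
proof -
  obtain \<rho>' where "exec w W (For v r (Inc t)) (\<rho>(t := 0), h, out) (\<rho>', h, out)"
    "\<rho>' t = \<rho> r" "\<forall>i. i \<noteq> t \<and> i \<noteq> v \<longrightarrow> \<rho>' i = \<rho> i"
    using exec_add[of "\<rho>(t := 0)" t r W v w h out] assms by auto
  then show ?thesis unfolding copy_def by (meson exec.Clr exec.Seq)
qed

lemma exec_home: "exec w W (While (Sym (\<lambda>s. s \<noteq> LeftEnd)) (Head GoLeft)) (\<rho>, h, out) (\<rho>, 0, out)"
proof (induction h rule: less_induct)
  case (less h)
  show ?case
  proof (cases "h = 0")
    case True
    then show ?thesis
      using exec.WhileF[of w "Sym (\<lambda>s. s \<noteq> LeftEnd)" "(\<rho>, h, out)"] by (simp add: input_at_def)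
  next
    case False
    have "exec w W (Head GoLeft) (\<rho>, h, out) (\<rho>, min (h - 1) (Suc (length w)), out)"
      using exec.Head[of w W GoLeft] by simp
    moreover have "exec w W (While (Sym (\<lambda>s. s \<noteq> LeftEnd)) (Head GoLeft))
        (\<rho>, min (h - 1) (Suc (length w)), out) (\<rho>, 0, out)"
      using False by (intro less.IH) auto
    ultimately show ?thesis using False
      by (intro exec.WhileT[where s = "(\<rho>, h, out)"]) (auto simp: input_at_def)
  qed
qed

text \<open>The head returns to the left end and counts from there, as its current position is
  unknown. The additional move skips the endmarker, so that the value 0 denotes the first
  letter.\<close>

definition seek :: "nat \<Rightarrow> nat \<Rightarrow> ('a, 'b) com" where
  "seek r v = Seq (While (Sym (\<lambda>s. s \<noteq> LeftEnd)) (Head GoLeft))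
    (Seq (For v r (Head GoRight)) (Head GoRight))"

lemma exec_seek:
  assumes "\<rho> r < 2 ^ W" and "v \<noteq> r"
  shows "\<exists>\<rho>'. exec w W (seek r v) (\<rho>, h, out) (\<rho>', min (Suc (\<rho> r)) (Suc (length w)), out) \<and>
    (\<forall>i. i \<noteq> v \<longrightarrow> \<rho>' i = \<rho> i)"
proof -
  let ?I = "\<lambda>i \<rho>' h' out'. \<rho>' v = i \<and> (\<forall>i. i \<noteq> v \<longrightarrow> \<rho>' i = \<rho> i) \<and>
    h' = min i (Suc (length w)) \<and> out' = out"
  have "\<exists>\<rho>' h' out'. exec w W (For v r (Head GoRight)) (\<rho>, 0, out) (\<rho>', h', out') \<and> ?I (\<rho> r) \<rho>' h' out'"
  proof (rule exec_For[where I = ?I])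
    fix i \<rho>' h' out'
    assume i: "i < \<rho> r" and I: "?I i \<rho>' h' out'"
    have "exec w W (Head GoRight) (\<rho>', h', out') (\<rho>', min (move GoRight h') (Suc (length w)), out')"
      by (rule exec.Head)
    then show "\<exists>\<rho>'' h'' out''. exec w W (Head GoRight) (\<rho>', h', out') (\<rho>'', h'', out'') \<and> \<rho>'' v = i \<and>
        ?I (Suc i) (\<rho>''(v := Suc i)) h'' out''"
      using I assms(2) by (intro exI[of _ "\<rho>'"] exI[of _ "min (move GoRight h') (Suc (length w))"] exI[of _ out'])
        (auto simp: min_def)
  qed (use assms in auto)
  then obtain \<rho>' where *: "exec w W (For v r (Head GoRight)) (\<rho>, 0, out) (\<rho>', min (\<rho> r) (Suc (length w)), out)"
    "\<forall>i. i \<noteq> v \<longrightarrow> \<rho>' i = \<rho> i" by blast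
  have "exec w W (Head GoRight) (\<rho>', min (\<rho> r) (Suc (length w)), out)
      (\<rho>', min (Suc (\<rho> r)) (Suc (length w)), out)"
    using exec.Head[of w W GoRight \<rho>' "min (\<rho> r) (Suc (length w))" out] by (simp add: min_def split: if_splits)
  from exec.Seq[OF exec_home exec.Seq[OF *(1) this]] *(2) show ?thesis unfolding seek_def by blast
qed

definition count_input :: "nat \<Rightarrow> ('a, 'b) com" where
  "count_input r = Seq (While (Sym (\<lambda>s. s \<noteq> LeftEnd)) (Head GoLeft)) (Seq (Head GoRight) (Seq (Clr r)
    (While (Sym (\<lambda>s. s \<noteq> RightEnd)) (Seq (Inc r) (Head GoRight)))))"

lemma exec_count_input:
  assumes "length w < 2 ^ W"
  shows "exec w W (count_input r) (\<rho>, h, out) (\<rho>(r := length w), Suc (length w), out)"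
proof -
  let ?c = "While (Sym (\<lambda>s. s \<noteq> RightEnd)) (Seq (Inc r) (Head GoRight))"
  have loop: "exec w W ?c (\<rho>(r := i), Suc i, out) (\<rho>(r := length w), Suc (length w), out)"
    if "i \<le> length w" for i
    using that
  proof (induction i rule: inc_induct)
    case base
    show ?case by (rule exec.WhileF) (simp add: input_at_def)
  next
    case (step i)
    have "exec w W (Inc r) (\<rho>(r := i), Suc i, out) (\<rho>(r := Suc i), Suc i, out)"
      using exec.Inc[of "\<rho>(r := i)" r W w "Suc i" out] step(2) assms by simp
    moreover have "exec w W (Head GoRight) (\<rho>(r := Suc i), Suc i, out) (\<rho>(r := Suc i), Suc (Suc i), out)"
      using exec.Head[of w W GoRight "\<rho>(r := Suc i)" "Suc i" out] step(2) by (simp add: min_def)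
    ultimately have "exec w W (Seq (Inc r) (Head GoRight)) (\<rho>(r := i), Suc i, out)
        (\<rho>(r := Suc i), Suc (Suc i), out)" by (rule exec.Seq)
    moreover have "holds w (Sym (\<lambda>s. s \<noteq> RightEnd)) (\<rho>(r := i), Suc i, out)"
      using step(2) by (simp add: input_at_def)
    ultimately show ?case using step.IH exec.WhileT by metis
  qed
  have "exec w W (Head GoRight) (\<rho>, 0, out) (\<rho>, 1, out)"
    using exec.Head[of w W GoRight \<rho> 0 out] by simp
  then show ?thesis unfolding count_input_def using loop[of 0]
    by (auto intro!: exec.Seq[OF exec_home] intro: exec.Seq exec.Clr)
qed

text \<open>
  The arguments are read from the registers vs. The registers below k are left unchanged, and the
  result is written to register k. The exponents d and D bound arguments and intermediate values.
\<close>

definition computes :: "('a, 'a) com \<Rightarrow> nat list \<Rightarrow> nat \<Rightarrow> nat \<Rightarrow> nat \<Rightarrow> ('a list \<Rightarrow> nat list \<Rightarrow> nat) \<Rightarrow> bool" where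
  "computes c vs k d D e \<longleftrightarrow> (\<forall>w \<rho> h out W.
    (\<forall>v\<in>set vs. \<rho> v \<le> (length w + 2) ^ d) \<longrightarrow> (length w + 2) ^ D < 2 ^ W \<longrightarrow>
    e w (map \<rho> vs) \<le> (length w + 2) ^ D \<and>
    (\<exists>\<rho>' h'. exec w W c (\<rho>, h, out) (\<rho>', h', out) \<and> (\<forall>i<k. \<rho>' i = \<rho> i) \<and> \<rho>' k = e w (map \<rho> vs)))"

text \<open>The list of arguments is an environment in de Bruijn style, the most recently bound
  variable in front. The registers vs and k are arbitrary so that a program can be placed above the
  registers of an enclosing one; D may depend on the degree d of the arguments.\<close>

definition ls_fun :: "('a list \<Rightarrow> nat list \<Rightarrow> nat) \<Rightarrow> bool" where
  "ls_fun e \<longleftrightarrow> (\<forall>vs k d. set vs \<subseteq> {..<k} \<longrightarrow> (\<exists>c D. computes c vs k d D e))"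

definition prints :: "('a, 'a) com \<Rightarrow> nat list \<Rightarrow> nat \<Rightarrow> nat \<Rightarrow> nat \<Rightarrow> ('a list \<Rightarrow> nat list \<Rightarrow> 'a list) \<Rightarrow> bool" where
  "prints c vs k d D f \<longleftrightarrow> (\<forall>w \<rho> h out W.
    (\<forall>v\<in>set vs. \<rho> v \<le> (length w + 2) ^ d) \<longrightarrow> (length w + 2) ^ D < 2 ^ W \<longrightarrow>
    (\<exists>\<rho>' h'. exec w W c (\<rho>, h, out) (\<rho>', h', out @ f w (map \<rho> vs)) \<and> (\<forall>i<k. \<rho>' i = \<rho> i)))"

definition ls_out :: "('a list \<Rightarrow> nat list \<Rightarrow> 'a list) \<Rightarrow> bool" where
  "ls_out f \<longleftrightarrow> (\<forall>vs k d. set vs \<subseteq> {..<k} \<longrightarrow> (\<exists>c D. prints c vs k d D f))"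

lemma computesD:
  assumes "computes c vs k d D e" and "\<forall>v\<in>set vs. \<rho> v \<le> (length w + 2) ^ d"
    and "(length w + 2) ^ D < 2 ^ W"
  obtains \<rho>' h' where "exec w W c (\<rho>, h, out) (\<rho>', h', out)" "\<forall>i<k. \<rho>' i = \<rho> i"
    "\<rho>' k = e w (map \<rho> vs)" "e w (map \<rho> vs) \<le> (length w + 2) ^ D"
  using assms unfolding computes_def by blast

lemma printsD:
  assumes "prints c vs k d D f" and "\<forall>v\<in>set vs. \<rho> v \<le> (length w + 2) ^ d"
    and "(length w + 2) ^ D < 2 ^ W"
  obtains \<rho>' h' where "exec w W c (\<rho>, h, out) (\<rho>', h', out @ f w (map \<rho> vs))" "\<forall>i<k. \<rho>' i = \<rho> i"
  using assms unfolding prints_def by blast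

lemma power_bound_mono: "x \<le> y \<Longrightarrow> (n + 2) ^ x \<le> ((n + 2) ^ y :: nat)"
  by (intro power_increasing) auto

lemma power_bound_less: "(n + 2) ^ y < B \<Longrightarrow> x \<le> y \<Longrightarrow> (n + 2) ^ x < (B :: nat)"
  using power_bound_mono[of x y n] by linarith

lemma map_regs_cong: "set vs \<subseteq> {..<k} \<Longrightarrow> \<forall>i<k. \<rho>' i = \<rho> i \<Longrightarrow> map \<rho>' vs = map \<rho> vs"
  by auto

section \<open>Basic computable functions and their composition\<close>

lemma ls_fun_zero: "ls_fun (\<lambda>w \<rho>. 0)"
  unfolding ls_fun_def computes_def
proof (intro allI impI exI[of _ 0] exI[of _ "Clr _"] conjI)
  fix k :: nat and w :: "'a list" and \<rho> h and out :: "'a list" and W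
  show "\<exists>\<rho>' h'. exec w W (Clr k) (\<rho>, h, out) (\<rho>', h', out) \<and> (\<forall>i<k. \<rho>' i = \<rho> i) \<and> \<rho>' k = 0"
    by (intro exI conjI, rule exec.Clr) auto
qed simp

lemma ls_fun_Suc: "ls_fun a \<Longrightarrow> ls_fun (\<lambda>w \<rho>. Suc (a w \<rho>))"
  unfolding ls_fun_def
proof (intro allI impI)
  fix vs :: "nat list" and k d :: nat assume a: "\<forall>vs k d. set vs \<subseteq> {..<k} \<longrightarrow> (\<exists>c D. computes c vs k d D a)"
    and vs: "set vs \<subseteq> {..<k}"
  then obtain c D where c: "computes c vs k d D a" by blast
  have "computes (Seq c (Inc k)) vs k d (Suc D) (\<lambda>w \<rho>. Suc (a w \<rho>))"
    unfolding computes_def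
  proof (intro allI impI)
    fix w :: "'a list" and \<rho> :: "nat \<Rightarrow> nat" and h :: nat and out :: "'a list" and W :: nat
    assume \<rho>: "\<forall>v\<in>set vs. \<rho> v \<le> (length w + 2) ^ d" and W: "(length w + 2) ^ Suc D < 2 ^ W"
    from computesD[OF c \<rho> power_bound_less[OF W le_SucI[OF order_refl]], of h out]
    obtain \<rho>' h' where *: "exec w W c (\<rho>, h, out) (\<rho>', h', out)" "\<forall>i<k. \<rho>' i = \<rho> i"
      "\<rho>' k = a w (map \<rho> vs)" "a w (map \<rho> vs) \<le> (length w + 2) ^ D" by blast
    \<comment> \<open>The base \<open>length w + 2\<close> is at least 2, so one more in the
      exponent at least doubles the bound, which makes room for the added 1.\<close>
    have "Suc (a w (map \<rho> vs)) \<le> (length w + 2) ^ D + (length w + 2) ^ D"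
      using *(4) one_le_power[of "length w + 2" D] by linarith
    also have "\<dots> \<le> (length w + 2) ^ Suc D" by simp
    finally have le: "Suc (a w (map \<rho> vs)) \<le> (length w + 2) ^ Suc D" .
    then have "exec w W (Inc k) (\<rho>', h', out) (\<rho>'(k := Suc (\<rho>' k)), h', out)"
      using W *(3) by (intro exec.Inc) linarith
    from exec.Seq[OF *(1) this] le *
    show "Suc (a w (map \<rho> vs)) \<le> (length w + 2) ^ Suc D \<and>
      (\<exists>\<rho>' h'. exec w W (Seq c (Inc k)) (\<rho>, h, out) (\<rho>', h', out) \<and> (\<forall>i<k. \<rho>' i = \<rho> i) \<and>
        \<rho>' k = Suc (a w (map \<rho> vs)))"
      by (auto intro!: exI)
  qed
  then show "\<exists>c D. computes c vs k d D (\<lambda>w \<rho>. Suc (a w \<rho>))" by blast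
qed

lemma ls_fun_const: "ls_fun (\<lambda>w \<rho>. n)"
  by (induction n) (simp_all add: ls_fun_zero ls_fun_Suc)

lemma ls_fun_hd: "ls_fun (\<lambda>w \<rho>. hd \<rho>)"
  unfolding ls_fun_def
proof (intro allI impI)
  fix vs :: "nat list" and k d :: nat assume vs: "set vs \<subseteq> {..<k}"
  show "\<exists>c D. computes c vs k d D (\<lambda>(w::'a list) \<rho>. hd \<rho>)"
  proof (cases vs)
    case Nil
    \<comment> \<open>\<open>hd []\<close> is an unspecified but fixed number, which a constant
      program produces.\<close>
    obtain c D where "computes c vs k d D (\<lambda>(w::'a list) \<rho>. hd [])"
      using ls_fun_const[unfolded ls_fun_def] vs by blast
    then have "computes c vs k d D (\<lambda>(w::'a list) \<rho>. hd \<rho>)" using Nil by (simp add: computes_def)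
    then show ?thesis by blast
  next
    case (Cons v vs')
    have "computes (copy k v (Suc k)) vs k d d (\<lambda>(w::'a list) \<rho>. hd \<rho>)"
      unfolding computes_def
    proof (intro allI impI)
      fix w :: "'a list" and \<rho> h and out :: "'a list" and W
      assume \<rho>: "\<forall>v\<in>set vs. \<rho> v \<le> (length w + 2) ^ d" and W: "(length w + 2) ^ d < 2 ^ W"
      obtain \<rho>' where "exec w W (copy k v (Suc k)) (\<rho>, h, out) (\<rho>', h, out)"
        "\<rho>' k = \<rho> v" "\<forall>i. i \<noteq> k \<and> i \<noteq> Suc k \<longrightarrow> \<rho>' i = \<rho> i"
        using exec_copy[of \<rho> v W k "Suc k" w h out] \<rho> W vs Cons by auto
      then show "hd (map \<rho> vs) \<le> (length w + 2) ^ d \<and>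
        (\<exists>\<rho>' h'. exec w W (copy k v (Suc k)) (\<rho>, h, out) (\<rho>', h', out) \<and>
          (\<forall>i<k. \<rho>' i = \<rho> i) \<and> \<rho>' k = hd (map \<rho> vs))"
        using \<rho> Cons by (intro conjI exI[of _ \<rho>'] exI[of _ h]) auto
    qed
    then show ?thesis by blast
  qed
qed

lemma ls_fun_tl: "ls_fun a \<Longrightarrow> ls_fun (\<lambda>w \<rho>. a w (tl \<rho>))"
  unfolding ls_fun_def
proof (intro allI impI)
  fix vs :: "nat list" and k d :: nat assume a: "\<forall>vs k d. set vs \<subseteq> {..<k} \<longrightarrow> (\<exists>c D. computes c vs k d D a)"
    and vs: "set vs \<subseteq> {..<k}"
  have sub: "set (tl vs) \<subseteq> set vs" by (cases vs) auto
  with vs have "set (tl vs) \<subseteq> {..<k}" by blast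
  with a obtain c D where c: "computes c (tl vs) k d D a" by blast
  have "computes c vs k d D (\<lambda>w \<rho>. a w (tl \<rho>))"
    using c sub unfolding computes_def by (simp add: map_tl[symmetric] subset_iff)
  then show "\<exists>c D. computes c vs k d D (\<lambda>w \<rho>. a w (tl \<rho>))" by blast
qed

lemma extend_bound:
  fixes n :: nat and \<rho> \<rho>' :: "nat \<Rightarrow> nat"
  assumes vs: "set vs \<subseteq> {..<k}" and \<rho>: "\<forall>v\<in>set vs. \<rho> v \<le> (n + 2) ^ d"
    and eq: "\<forall>i<k. \<rho>' i = \<rho> i" and new: "\<rho>' u \<le> (n + 2) ^ D"
  shows "\<forall>v\<in>set (u # vs). \<rho>' v \<le> (n + 2) ^ (d + D)"
proof
  fix v assume "v \<in> set (u # vs)"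
  then consider "v = u" | "v \<in> set vs" by auto
  then show "\<rho>' v \<le> (n + 2) ^ (d + D)"
  proof cases
    case 1
    then show ?thesis using order.trans[OF new power_bound_mono[OF le_add2]] by simp
  next
    case 2
    with vs eq \<rho> have "\<rho>' v \<le> (n + 2) ^ d" by auto
    then show ?thesis using order.trans[OF _ power_bound_mono[OF le_add1]] by blast
  qed
qed

text \<open>Composition: the value of \<open>a\<close> is kept in register k and serves as the
  newest variable of \<open>F\<close>, whose result is then moved down to k. The degree d + D bounds
  old and new arguments alike.\<close>

lemma ls_fun_let:
  assumes F: "ls_fun (\<lambda>w \<rho>. F w (tl \<rho>) (hd \<rho>))" and a: "ls_fun a"
  shows "ls_fun (\<lambda>w \<rho>. F w \<rho> (a w \<rho>))"
  unfolding ls_fun_def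
proof (intro allI impI)
  fix vs :: "nat list" and k d :: nat assume vs: "set vs \<subseteq> {..<k}"
  with a obtain c D where c: "computes c vs k d D a" unfolding ls_fun_def by blast
  from vs have "set (k # vs) \<subseteq> {..<Suc k}" by auto
  with F obtain c' D' where c': "computes c' (k # vs) (Suc k) (d + D) D' (\<lambda>w \<rho>. F w (tl \<rho>) (hd \<rho>))"
    unfolding ls_fun_def by blast
  let ?c = "Seq c (Seq c' (copy k (Suc k) (Suc (Suc k))))"
  have "computes ?c vs k d (D + D') (\<lambda>w \<rho>. F w \<rho> (a w \<rho>))"
    unfolding computes_def
  proof (intro allI impI)
    fix w :: "'a list" and \<rho> :: "nat \<Rightarrow> nat" and h :: nat and out :: "'a list" and W :: nat
    assume \<rho>: "\<forall>v\<in>set vs. \<rho> v \<le> (length w + 2) ^ d" and W: "(length w + 2) ^ (D + D') < 2 ^ W"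
    from computesD[OF c \<rho> power_bound_less[OF W le_add1], of h out] obtain \<rho>' h' where
      *: "exec w W c (\<rho>, h, out) (\<rho>', h', out)" "\<forall>i<k. \<rho>' i = \<rho> i"
      "\<rho>' k = a w (map \<rho> vs)" "a w (map \<rho> vs) \<le> (length w + 2) ^ D" by blast
    have map: "map \<rho>' (k # vs) = a w (map \<rho> vs) # map \<rho> vs"
      using * map_regs_cong[OF vs *(2)] by simp
    have "\<rho>' k \<le> (length w + 2) ^ D" using * by simp
    from computesD[OF c' extend_bound[OF vs \<rho> *(2) this] power_bound_less[OF W le_add2], of h' out]
    obtain \<rho>'' h'' where
      **: "exec w W c' (\<rho>', h', out) (\<rho>'', h'', out)" "\<forall>i<Suc k. \<rho>'' i = \<rho>' i"
      "\<rho>'' (Suc k) = F w (map \<rho> vs) (a w (map \<rho> vs))"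
      "F w (map \<rho> vs) (a w (map \<rho> vs)) \<le> (length w + 2) ^ D'" unfolding map list.sel by blast
    have le: "F w (map \<rho> vs) (a w (map \<rho> vs)) \<le> (length w + 2) ^ (D + D')"
      using **(4) power_bound_mono[OF le_add2, of "length w" D' D] by linarith
    obtain \<rho>3 where ***: "exec w W (copy k (Suc k) (Suc (Suc k))) (\<rho>'', h'', out) (\<rho>3, h'', out)"
      "\<rho>3 k = \<rho>'' (Suc k)" "\<forall>i. i \<noteq> k \<and> i \<noteq> Suc (Suc k) \<longrightarrow> \<rho>3 i = \<rho>'' i"
      using exec_copy[of \<rho>'' "Suc k" W k "Suc (Suc k)" w h'' out] le W **(3) by auto
    have "exec w W ?c (\<rho>, h, out) (\<rho>3, h'', out)"
      using *(1) **(1) ***(1) by (blast intro: exec.Seq)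
    moreover have "\<forall>i<k. \<rho>3 i = \<rho> i" using *(2) **(2) ***(3) by simp
    ultimately show "F w (map \<rho> vs) (a w (map \<rho> vs)) \<le> (length w + 2) ^ (D + D') \<and>
      (\<exists>\<rho>' h'. exec w W ?c (\<rho>, h, out) (\<rho>', h', out) \<and> (\<forall>i<k. \<rho>' i = \<rho> i) \<and>
        \<rho>' k = F w (map \<rho> vs) (a w (map \<rho> vs)))"
      using le ***(2) **(3) by auto
  qed
  then show "\<exists>c D. computes c vs k d D (\<lambda>w \<rho>. F w \<rho> (a w \<rho>))" by blast
qed

text \<open>The source of all iteration in functions: products, quantifiers and counting are derived
  from it.\<close>

lemma ls_fun_sum:
  assumes Q: "ls_fun (\<lambda>w \<rho>. Q w (tl \<rho>) (hd \<rho>))" and a: "ls_fun a"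
  shows "ls_fun (\<lambda>w \<rho>. \<Sum>v<a w \<rho>. Q w \<rho> v)"
  unfolding ls_fun_def
proof (intro allI impI)
  fix vs :: "nat list" and k d :: nat assume vs: "set vs \<subseteq> {..<k}"
  define n v q u where "n = k + 1" and "v = k + 2" and "q = k + 3" and "u = k + 4"
  note regs = n_def v_def q_def u_def
  from vs have vs': "set vs \<subseteq> {..<n}" "set (v # vs) \<subseteq> {..<q}" by (auto simp: regs)
  from a vs'(1) obtain c D where c: "computes c vs n d D a" unfolding ls_fun_def by blast
  from Q vs'(2) obtain c' D' where c': "computes c' (v # vs) q (d + D) D' (\<lambda>w \<rho>. Q w (tl \<rho>) (hd \<rho>))"
    unfolding ls_fun_def by blast
  let ?body = "Seq c' (For u q (Inc k))"
  let ?c = "Seq c (Seq (Clr k) (For v n ?body))"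
  have "computes ?c vs k d (D + D') (\<lambda>w \<rho>. \<Sum>v<a w \<rho>. Q w \<rho> v)"
    unfolding computes_def
  proof (intro allI impI)
    fix w :: "'a list" and \<rho> :: "nat \<Rightarrow> nat" and h :: nat and out :: "'a list" and W :: nat
    assume \<rho>: "\<forall>v\<in>set vs. \<rho> v \<le> (length w + 2) ^ d" and W: "(length w + 2) ^ (D + D') < 2 ^ W"
    from computesD[OF c \<rho> power_bound_less[OF W le_add1], of h out] obtain \<rho>' h' where
      *: "exec w W c (\<rho>, h, out) (\<rho>', h', out)" "\<forall>i<n. \<rho>' i = \<rho> i"
      "\<rho>' n = a w (map \<rho> vs)" "a w (map \<rho> vs) \<le> (length w + 2) ^ D" by blast
    define N S where "N = a w (map \<rho> vs)" and "S = (\<lambda>i. \<Sum>v<i. Q w (map \<rho> vs) v)"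
    \<comment> \<open>The last conjunct bounds the partial sums. As the number of summands has
      degree D and each summand degree D', the exponent D + D' suffices throughout.\<close>
    let ?I = "\<lambda>i \<rho>' h' out'. \<rho>' v = i \<and> \<rho>' n = N \<and> \<rho>' k = S i \<and> (\<forall>i<k. \<rho>' i = \<rho> i) \<and> out' = out \<and>
      S i \<le> i * (length w + 2) ^ D'"
    have "\<exists>\<rho>'' h'' out''. exec w W (For v n ?body) (\<rho>'(k := 0), h', out) (\<rho>'', h'', out'') \<and> ?I N \<rho>'' h'' out''"
    proof (rule exec_For[where I = ?I])
      show "N < 2 ^ W"
        using *(4) power_bound_less[OF W le_add1] by (simp add: N_def)
      show "?I 0 ((\<rho>'(k := 0))(v := 0)) h' out"
        using * by (auto simp: S_def N_def regs)
    next
      fix i \<rho>1 h1 out1 assume i: "i < N" and I: "?I i \<rho>1 h1 out1"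
      have eq: "\<forall>i<k. \<rho>1 i = \<rho> i" using I by blast
      have "\<rho>1 v \<le> (length w + 2) ^ D" using I i *(4) by (simp add: N_def)
      from computesD[OF c' extend_bound[OF vs \<rho> eq this] power_bound_less[OF W le_add2], of h1 out]
      obtain \<rho>2 h2 where
        **: "exec w W c' (\<rho>1, h1, out) (\<rho>2, h2, out)" "\<forall>i<q. \<rho>2 i = \<rho>1 i"
        "\<rho>2 q = Q w (map \<rho> vs) i" "Q w (map \<rho> vs) i \<le> (length w + 2) ^ D'"
        using I map_regs_cong[OF vs eq] by auto
      have S_Suc: "S (Suc i) = S i + Q w (map \<rho> vs) i" by (simp add: S_def)
      then have Sle: "S (Suc i) \<le> Suc i * (length w + 2) ^ D'" using I **(4) by simp
      also have "\<dots> \<le> (length w + 2) ^ D * (length w + 2) ^ D'"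
        using i *(4) by (intro mult_le_mono1) (simp add: N_def)
      also have "\<dots> < 2 ^ W" using W by (simp add: power_add)
      finally have "\<rho>2 k + \<rho>2 q < 2 ^ W" using **(2,3) I S_Suc by (simp add: regs)
      then obtain \<rho>3 where ***: "exec w W (For u q (Inc k)) (\<rho>2, h2, out) (\<rho>3, h2, out)"
        "\<rho>3 k = \<rho>2 k + \<rho>2 q" "\<forall>i. i \<noteq> k \<and> i \<noteq> u \<longrightarrow> \<rho>3 i = \<rho>2 i"
        using exec_add[of \<rho>2 k q W u w h2 out] by (auto simp: regs)
      have "exec w W ?body (\<rho>1, h1, out1) (\<rho>3, h2, out)"
        using **(1) ***(1) I by (blast intro: exec.Seq)
      moreover have "\<rho>3 v = i \<and> ?I (Suc i) (\<rho>3(v := Suc i)) h2 out"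
        using ***(2,3) **(2,3) I S_Suc Sle by (auto simp: regs)
      ultimately show "\<exists>\<rho>' h' out'. exec w W ?body (\<rho>1, h1, out1) (\<rho>', h', out') \<and> \<rho>' v = i \<and>
          ?I (Suc i) (\<rho>'(v := Suc i)) h' out'" by blast
    qed auto
    then obtain \<rho>'' h'' where ***: "exec w W (For v n ?body) (\<rho>'(k := 0), h', out) (\<rho>'', h'', out)"
      "\<rho>'' k = S N" "\<forall>i<k. \<rho>'' i = \<rho> i" "S N \<le> N * (length w + 2) ^ D'" by blast
    have "exec w W ?c (\<rho>, h, out) (\<rho>'', h'', out)"
      using *(1) ***(1) by (blast intro: exec.Seq exec.Clr)
    moreover have "S N \<le> (length w + 2) ^ (D + D')"
      using order.trans[OF ***(4)[unfolded N_def] mult_le_mono1[OF *(4)]] by (simp only: N_def power_add)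
    ultimately show "(\<Sum>v<a w (map \<rho> vs). Q w (map \<rho> vs) v) \<le> (length w + 2) ^ (D + D') \<and>
      (\<exists>\<rho>' h'. exec w W ?c (\<rho>, h, out) (\<rho>', h', out) \<and> (\<forall>i<k. \<rho>' i = \<rho> i) \<and>
        \<rho>' k = (\<Sum>v<a w (map \<rho> vs). Q w (map \<rho> vs) v))"
      using ***(2,3) unfolding S_def N_def by blast
  qed
  then show "\<exists>c D. computes c vs k d D (\<lambda>w \<rho>. \<Sum>v<a w \<rho>. Q w \<rho> v)" by blast
qed

lemma ls_fun_length: "ls_fun (\<lambda>w \<rho>. length w)"
  unfolding ls_fun_def
proof (intro allI impI)
  fix vs :: "nat list" and k d :: nat
  have "computes (count_input k) vs k d 1 (\<lambda>(w::'a list) \<rho>. length w)"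
    unfolding computes_def
  proof (intro allI impI)
    fix w :: "'a list" and \<rho> h and out :: "'a list" and W
    assume "(length w + 2) ^ 1 < 2 ^ W"
    then have "exec w W (count_input k) (\<rho>, h, out) (\<rho>(k := length w), Suc (length w), out)"
      by (intro exec_count_input) simp
    then show "length w \<le> (length w + 2) ^ 1 \<and> (\<exists>\<rho>' h'. exec w W (count_input k) (\<rho>, h, out) (\<rho>', h', out) \<and>
        (\<forall>i<k. \<rho>' i = \<rho> i) \<and> \<rho>' k = length w)"
      by (intro conjI exI[of _ "\<rho>(k := length w)"] exI[of _ "Suc (length w)"]) auto
  qed
  then show "\<exists>c D. computes c vs k d D (\<lambda>(w::'a list) \<rho>. length w)" by blast
qed

definition sym_at :: "'a list \<Rightarrow> nat \<Rightarrow> 'a \<Rightarrow> bool" where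
  "sym_at w p s \<longleftrightarrow> p < length w \<and> w ! p = s"

lemma input_at_sym: "input_at w (min (Suc p) (Suc (length w))) = Letter s \<longleftrightarrow> sym_at w p s"
  by (auto simp: input_at_def sym_at_def min_def)

definition ls_pred :: "('a list \<Rightarrow> nat list \<Rightarrow> bool) \<Rightarrow> bool" where
  "ls_pred P \<longleftrightarrow> ls_fun (\<lambda>w \<rho>. of_bool (P w \<rho>))"

lemma ls_pred_sym_at:
  assumes a: "ls_fun a"
  shows "ls_pred (\<lambda>w \<rho>. sym_at w (a w \<rho>) s)"
  unfolding ls_pred_def ls_fun_def
proof (intro allI impI)
  fix vs :: "nat list" and k d :: nat assume vs: "set vs \<subseteq> {..<k}"
  then have "set vs \<subseteq> {..<Suc k}" by auto
  with a obtain c D where c: "computes c vs (Suc k) d D a" unfolding ls_fun_def by blast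
  let ?if = "If (Sym (\<lambda>t. t = Letter s)) (Inc k) Skip"
  let ?c = "Seq c (Seq (seek (Suc k) (Suc (Suc k))) (Seq (Clr k) ?if))"
  have "computes ?c vs k d D (\<lambda>w \<rho>. of_bool (sym_at w (a w \<rho>) s))"
    unfolding computes_def
  proof (intro allI impI)
    fix w :: "'a list" and \<rho> :: "nat \<Rightarrow> nat" and h :: nat and out :: "'a list" and W :: nat
    assume \<rho>: "\<forall>v\<in>set vs. \<rho> v \<le> (length w + 2) ^ d" and W: "(length w + 2) ^ D < 2 ^ W"
    from computesD[OF c \<rho> W, of h out] obtain \<rho>' h' where
      *: "exec w W c (\<rho>, h, out) (\<rho>', h', out)" "\<forall>i<Suc k. \<rho>' i = \<rho> i"
      "\<rho>' (Suc k) = a w (map \<rho> vs)" "a w (map \<rho> vs) \<le> (length w + 2) ^ D" by blast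
    define p where "p = a w (map \<rho> vs)"
    obtain \<rho>'' where **: "exec w W (seek (Suc k) (Suc (Suc k))) (\<rho>', h', out)
        (\<rho>'', min (Suc p) (Suc (length w)), out)" "\<forall>i<Suc k. \<rho>'' i = \<rho>' i"
      using exec_seek[of \<rho>' "Suc k" W "Suc (Suc k)" w h' out] * W by (auto simp: p_def)
    have W1: "1 < (2::nat) ^ W"
      using W one_le_power[of "length w + 2" D] by linarith
    have test: "holds w (Sym (\<lambda>t. t = Letter s)) (\<rho>''(k := 0), min (Suc p) (Suc (length w)), out) \<longleftrightarrow>
        sym_at w p s"
      by (simp only: holds.simps input_at_sym)
    have "exec w W ?if (\<rho>''(k := 0), min (Suc p) (Suc (length w)), out)
        (\<rho>''(k := of_bool (sym_at w p s)), min (Suc p) (Suc (length w)), out)"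
    proof (cases "sym_at w p s")
      case True
      have "exec w W (Inc k) (\<rho>''(k := 0), min (Suc p) (Suc (length w)), out)
        (\<rho>''(k := 1), min (Suc p) (Suc (length w)), out)"
        using exec.Inc[of "\<rho>''(k := 0)" k W w "min (Suc p) (Suc (length w))" out] W1 by simp
      then show ?thesis by (intro exec.If) (simp only: test True if_True of_bool_eq)
    next
      case False
      have "exec w W Skip (\<rho>''(k := 0), min (Suc p) (Suc (length w)), out)
        (\<rho>''(k := 0), min (Suc p) (Suc (length w)), out)"
        using exec.Head[of w W Stay "\<rho>''(k := 0)" "min (Suc p) (Suc (length w))" out]
        by (simp del: min_Suc_Suc)
      then show ?thesis by (intro exec.If) (simp only: test False if_False of_bool_eq)
    qed
    with *(1) **(1) have "exec w W ?c (\<rho>, h, out)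
        (\<rho>''(k := of_bool (sym_at w p s)), min (Suc p) (Suc (length w)), out)"
      by (blast intro: exec.Seq exec.Clr)
    moreover have "of_bool (sym_at w p s) \<le> (length w + 2) ^ D"
      using one_le_power[of "length w + 2" D] by (cases "sym_at w p s") auto
    ultimately show "of_bool (sym_at w (a w (map \<rho> vs)) s) \<le> (length w + 2) ^ D \<and>
      (\<exists>\<rho>' h'. exec w W ?c (\<rho>, h, out) (\<rho>', h', out) \<and> (\<forall>i<k. \<rho>' i = \<rho> i) \<and>
        \<rho>' k = of_bool (sym_at w (a w (map \<rho> vs)) s))"
      using *(2) **(2) unfolding p_def
      by (intro conjI exI[of _ "\<rho>''(k := of_bool (sym_at w (a w (map \<rho> vs)) s))"]) auto
  qed
  then show "\<exists>c D. computes c vs k d D (\<lambda>w \<rho>. of_bool (sym_at w (a w \<rho>) s))" by blast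
qed

lemma ls_pred_less:
  assumes a: "ls_fun a" and b: "ls_fun b"
  shows "ls_pred (\<lambda>w \<rho>. a w \<rho> < b w \<rho>)"
  unfolding ls_pred_def ls_fun_def
proof (intro allI impI)
  fix vs :: "nat list" and k d :: nat assume vs: "set vs \<subseteq> {..<k}"
  then have vs': "set vs \<subseteq> {..<Suc k}" "set vs \<subseteq> {..<Suc (Suc k)}" by auto
  from a vs'(1) obtain c D where c: "computes c vs (Suc k) d D a" unfolding ls_fun_def by blast
  from b vs'(2) obtain c' D' where c': "computes c' vs (Suc (Suc k)) d D' b" unfolding ls_fun_def by blast
  let ?if = "If (Less (Suc k) (Suc (Suc k))) (Inc k) Skip"
  let ?c = "Seq c (Seq c' (Seq (Clr k) ?if))"
  have "computes ?c vs k d (D + D') (\<lambda>w \<rho>. of_bool (a w \<rho> < b w \<rho>))"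
    unfolding computes_def
  proof (intro allI impI)
    fix w :: "'a list" and \<rho> :: "nat \<Rightarrow> nat" and h :: nat and out :: "'a list" and W :: nat
    assume \<rho>: "\<forall>v\<in>set vs. \<rho> v \<le> (length w + 2) ^ d" and W: "(length w + 2) ^ (D + D') < 2 ^ W"
    from computesD[OF c \<rho> power_bound_less[OF W le_add1], of h out] obtain \<rho>' h' where
      *: "exec w W c (\<rho>, h, out) (\<rho>', h', out)" "\<forall>i<Suc k. \<rho>' i = \<rho> i"
      "\<rho>' (Suc k) = a w (map \<rho> vs)" by metis
    have eq: "map \<rho>' vs = map \<rho> vs" using map_regs_cong[OF vs'(1) *(2)] .
    have "\<forall>v\<in>set vs. \<rho>' v \<le> (length w + 2) ^ d" using \<rho> vs'(1) *(2) by auto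
    from computesD[OF c' this power_bound_less[OF W le_add2], of h' out] obtain \<rho>'' h'' where
      **: "exec w W c' (\<rho>', h', out) (\<rho>'', h'', out)" "\<forall>i<Suc (Suc k). \<rho>'' i = \<rho>' i"
      "\<rho>'' (Suc (Suc k)) = b w (map \<rho> vs)" unfolding eq by metis
    define p where "p \<longleftrightarrow> a w (map \<rho> vs) < b w (map \<rho> vs)"
    have W1: "1 < (2::nat) ^ W"
      using W one_le_power[of "length w + 2" "D + D'"] by linarith
    have test: "holds w (Less (Suc k) (Suc (Suc k))) (\<rho>''(k := 0), h'', out) \<longleftrightarrow> p"
      using *(3) **(2,3) by (simp add: p_def)
    \<comment> \<open>\<open>Skip\<close> cuts the position of the head off at the right endmarker,
      and nothing is known about the incoming position, hence the two forms.\<close>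
    have "exec w W ?if (\<rho>''(k := 0), h'', out) (\<rho>''(k := of_bool p), min h'' (Suc (length w)), out) \<or>
      exec w W ?if (\<rho>''(k := 0), h'', out) (\<rho>''(k := of_bool p), h'', out)"
    proof (cases p)
      case True
      have "exec w W (Inc k) (\<rho>''(k := 0), h'', out) (\<rho>''(k := 1), h'', out)"
        using exec.Inc[of "\<rho>''(k := 0)" k W w h'' out] W1 by simp
      then have "exec w W ?if (\<rho>''(k := 0), h'', out) (\<rho>''(k := 1), h'', out)"
        by (intro exec.If) (simp only: test True if_True)
      then show ?thesis using True by simp
    next
      case False
      have "exec w W Skip (\<rho>''(k := 0), h'', out) (\<rho>''(k := 0), min h'' (Suc (length w)), out)"
        using exec.Head[of w W Stay "\<rho>''(k := 0)" h'' out] by simp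
      then have "exec w W ?if (\<rho>''(k := 0), h'', out) (\<rho>''(k := 0), min h'' (Suc (length w)), out)"
        by (intro exec.If) (simp only: test False if_False)
      then show ?thesis using False by simp
    qed
    then obtain h3 where "exec w W ?if (\<rho>''(k := 0), h'', out) (\<rho>''(k := of_bool p), h3, out)" by blast
    with *(1) **(1) have "exec w W ?c (\<rho>, h, out) (\<rho>''(k := of_bool p), h3, out)"
      by (blast intro: exec.Seq exec.Clr)
    moreover have "of_bool p \<le> (length w + 2) ^ (D + D')"
      using one_le_power[of "length w + 2" "D + D'"] by (cases p) auto
    ultimately show "of_bool (a w (map \<rho> vs) < b w (map \<rho> vs)) \<le> (length w + 2) ^ (D + D') \<and>
      (\<exists>\<rho>' h'. exec w W ?c (\<rho>, h, out) (\<rho>', h', out) \<and> (\<forall>i<k. \<rho>' i = \<rho> i) \<and>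
        \<rho>' k = of_bool (a w (map \<rho> vs) < b w (map \<rho> vs)))"
      using *(2) **(2) unfolding p_def[symmetric]
      by (intro conjI exI[of _ "\<rho>''(k := of_bool p)"]) auto
  qed
  then show "\<exists>c D. computes c vs k d D (\<lambda>w \<rho>. of_bool (a w \<rho> < b w \<rho>))" by blast
qed

section \<open>Computable output\<close>

lemma ls_out_Nil: "ls_out (\<lambda>w \<rho>. [])"
proof -
  have "prints Skip vs k d 0 (\<lambda>(w::'a list) \<rho>. [])" for vs k d
    unfolding prints_def
  proof (intro allI impI)
    fix w :: "'a list" and \<rho> :: "nat \<Rightarrow> nat" and h :: nat and out :: "'a list" and W :: nat
    have "exec w W Skip (\<rho>, h, out) (\<rho>, min (move Stay h) (Suc (length w)), out @ [])"
      using exec.Head[of w W Stay \<rho> h out] by simp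
    then show "\<exists>\<rho>' h'. exec w W Skip (\<rho>, h, out) (\<rho>', h', out @ []) \<and> (\<forall>i<k. \<rho>' i = \<rho> i)" by blast
  qed
  then show ?thesis unfolding ls_out_def by blast
qed

lemma ls_out_single: "ls_out (\<lambda>w \<rho>. [s])"
proof -
  have "prints (Emit s) vs k d 0 (\<lambda>w \<rho>. [s])" for vs k d
    unfolding prints_def by (intro allI impI exI conjI, rule exec.Emit) simp
  then show ?thesis unfolding ls_out_def by blast
qed

lemma ls_out_append:
  assumes f: "ls_out f" and g: "ls_out g"
  shows "ls_out (\<lambda>w \<rho>. f w \<rho> @ g w \<rho>)"
  unfolding ls_out_def
proof (intro allI impI)
  fix vs :: "nat list" and k d :: nat assume vs: "set vs \<subseteq> {..<k}"
  with f obtain c D where c: "prints c vs k d D f" unfolding ls_out_def by blast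
  from g vs obtain c' D' where c': "prints c' vs k d D' g" unfolding ls_out_def by blast
  have "prints (Seq c c') vs k d (D + D') (\<lambda>w \<rho>. f w \<rho> @ g w \<rho>)"
    unfolding prints_def
  proof (intro allI impI)
    fix w :: "'a list" and \<rho> :: "nat \<Rightarrow> nat" and h :: nat and out :: "'a list" and W :: nat
    assume \<rho>: "\<forall>v\<in>set vs. \<rho> v \<le> (length w + 2) ^ d" and W: "(length w + 2) ^ (D + D') < 2 ^ W"
    from printsD[OF c \<rho> power_bound_less[OF W le_add1], of h out] obtain \<rho>' h' where
      *: "exec w W c (\<rho>, h, out) (\<rho>', h', out @ f w (map \<rho> vs))" "\<forall>i<k. \<rho>' i = \<rho> i" by blast
    have eq: "map \<rho>' vs = map \<rho> vs" using map_regs_cong[OF vs *(2)] .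
    have "\<forall>v\<in>set vs. \<rho>' v \<le> (length w + 2) ^ d" using \<rho> vs *(2) by auto
    from printsD[OF c' this power_bound_less[OF W le_add2], of h' "out @ f w (map \<rho> vs)"] obtain \<rho>'' h'' where
      "exec w W c' (\<rho>', h', out @ f w (map \<rho> vs)) (\<rho>'', h'', (out @ f w (map \<rho> vs)) @ g w (map \<rho> vs))"
      "\<forall>i<k. \<rho>'' i = \<rho>' i" unfolding eq by blast
    with * show "\<exists>\<rho>' h'. exec w W (Seq c c') (\<rho>, h, out) (\<rho>', h', out @ f w (map \<rho> vs) @ g w (map \<rho> vs)) \<and>
        (\<forall>i<k. \<rho>' i = \<rho> i)"
      by (intro exI[of _ \<rho>''] exI[of _ h'']) (auto intro: exec.Seq)
  qed
  then show "\<exists>c D. prints c vs k d D (\<lambda>w \<rho>. f w \<rho> @ g w \<rho>)" by blast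
qed

lemma ls_out_loop:
  assumes f: "ls_out (\<lambda>w \<rho>. f w (tl \<rho>) (hd \<rho>))" and a: "ls_fun a"
  shows "ls_out (\<lambda>w \<rho>. concat (map (f w \<rho>) [0..<a w \<rho>]))"
  unfolding ls_out_def
proof (intro allI impI)
  fix vs :: "nat list" and k d :: nat assume vs: "set vs \<subseteq> {..<k}"
  with a obtain c D where c: "computes c vs k d D a" unfolding ls_fun_def by blast
  define v q where "v = k + 1" and "q = k + 2"
  note regs = v_def q_def
  from vs have "set (v # vs) \<subseteq> {..<q}" by (auto simp: regs)
  with f obtain c' D' where c': "prints c' (v # vs) q (d + D) D' (\<lambda>w \<rho>. f w (tl \<rho>) (hd \<rho>))"
    unfolding ls_out_def by blast
  let ?c = "Seq c (For v k c')"
  have "prints ?c vs k d (D + D') (\<lambda>w \<rho>. concat (map (f w \<rho>) [0..<a w \<rho>]))"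
    unfolding prints_def
  proof (intro allI impI)
    fix w :: "'a list" and \<rho> :: "nat \<Rightarrow> nat" and h :: nat and out :: "'a list" and W :: nat
    assume \<rho>: "\<forall>v\<in>set vs. \<rho> v \<le> (length w + 2) ^ d" and W: "(length w + 2) ^ (D + D') < 2 ^ W"
    from computesD[OF c \<rho> power_bound_less[OF W le_add1], of h out] obtain \<rho>' h' where
      *: "exec w W c (\<rho>, h, out) (\<rho>', h', out)" "\<forall>i<k. \<rho>' i = \<rho> i"
      "\<rho>' k = a w (map \<rho> vs)" "a w (map \<rho> vs) \<le> (length w + 2) ^ D" by blast
    define N S where "N = a w (map \<rho> vs)" and "S = (\<lambda>i. concat (map (f w (map \<rho> vs)) [0..<i]))"
    let ?I = "\<lambda>i \<rho>' h' out'. \<rho>' v = i \<and> \<rho>' k = N \<and> (\<forall>i<k. \<rho>' i = \<rho> i) \<and> out' = out @ S i"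
    have "\<exists>\<rho>'' h'' out''. exec w W (For v k c') (\<rho>', h', out) (\<rho>'', h'', out'') \<and> ?I N \<rho>'' h'' out''"
    proof (rule exec_For[where I = ?I])
      show "N < 2 ^ W"
        using *(4) power_bound_less[OF W le_add1] by (simp add: N_def)
      show "?I 0 (\<rho>'(v := 0)) h' out"
        using * by (auto simp: S_def N_def regs)
    next
      fix i \<rho>1 h1 out1 assume i: "i < N" and I: "?I i \<rho>1 h1 out1"
      have eq: "\<forall>i<k. \<rho>1 i = \<rho> i" using I by blast
      have "\<rho>1 v \<le> (length w + 2) ^ D" using I i *(4) by (simp add: N_def)
      from printsD[OF c' extend_bound[OF vs \<rho> eq this] power_bound_less[OF W le_add2], of h1 "out @ S i"]
      obtain \<rho>2 h2 where
        **: "exec w W c' (\<rho>1, h1, out @ S i) (\<rho>2, h2, (out @ S i) @ f w (map \<rho> vs) i)" "\<forall>i<q. \<rho>2 i = \<rho>1 i"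
        using I map_regs_cong[OF vs eq] by auto
      have "\<rho>2 v = i \<and> ?I (Suc i) (\<rho>2(v := Suc i)) h2 ((out @ S i) @ f w (map \<rho> vs) i)"
        using **(2) I by (auto simp: regs S_def)
      then show "\<exists>\<rho>' h' out'. exec w W c' (\<rho>1, h1, out1) (\<rho>', h', out') \<and> \<rho>' v = i \<and>
          ?I (Suc i) (\<rho>'(v := Suc i)) h' out'" using **(1) I by blast
    qed auto
    then obtain \<rho>'' h'' where ***: "exec w W (For v k c') (\<rho>', h', out) (\<rho>'', h'', out @ S N)"
      "\<forall>i<k. \<rho>'' i = \<rho> i" by blast
    with *(1) show "\<exists>\<rho>' h'. exec w W ?c (\<rho>, h, out)
        (\<rho>', h', out @ concat (map (f w (map \<rho> vs)) [0..<a w (map \<rho> vs)])) \<and> (\<forall>i<k. \<rho>' i = \<rho> i)"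
      unfolding S_def N_def by (blast intro: exec.Seq)
  qed
  then show "\<exists>c D. prints c vs k d D (\<lambda>w \<rho>. concat (map (f w \<rho>) [0..<a w \<rho>]))" by blast
qed

lemma ls_out_computable:
  fixes f :: "'a::finite list \<Rightarrow> 'a list"
  assumes "ls_out (\<lambda>w \<rho>. f w)"
  shows "poly_time_log_space_computable f"
proof -
  have "\<exists>c D. prints c [] 0 0 D (\<lambda>w \<rho>. f w)"
    using assms unfolding ls_out_def by (metis empty_set empty_subsetI)
  then obtain c D where c: "prints c [] 0 0 D (\<lambda>w \<rho>. f w)" by blast
  show ?thesis
  proof (rule poly_time_log_spaceI)
    fix w :: "'a list" and W assume "(length w + 2) ^ D < 2 ^ W"
    then obtain \<rho>' h' where "exec w W c (\<lambda>_. 0, 0, []) (\<rho>', h', [] @ f w)"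
      using printsD[OF c, of "\<lambda>_. 0" w W 0 "[]"] by auto
    then show "\<exists>\<rho> h. exec w W c (\<lambda>_. 0, 0, []) (\<rho>, h, f w)" by auto
  qed
qed


section \<open>Closure properties\<close>

named_theorems ls_intros

text \<open>The projections give access to the seven most recent variables, enough for the nesting
  of binders in the definitions to come.\<close>

lemmas [ls_intros] = ls_fun_const ls_fun_hd
  ls_fun_tl[OF ls_fun_hd]
  ls_fun_tl[OF ls_fun_tl[OF ls_fun_hd]]
  ls_fun_tl[OF ls_fun_tl[OF ls_fun_tl[OF ls_fun_hd]]]
  ls_fun_tl[OF ls_fun_tl[OF ls_fun_tl[OF ls_fun_tl[OF ls_fun_hd]]]]
  ls_fun_tl[OF ls_fun_tl[OF ls_fun_tl[OF ls_fun_tl[OF ls_fun_tl[OF ls_fun_hd]]]]]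
  ls_fun_tl[OF ls_fun_tl[OF ls_fun_tl[OF ls_fun_tl[OF ls_fun_tl[OF ls_fun_tl[OF ls_fun_hd]]]]]]
  ls_fun_Suc ls_fun_sum ls_fun_length ls_pred_sym_at ls_pred_less

lemma ls_fun_of_bool [ls_intros]: "ls_pred P \<Longrightarrow> ls_fun (\<lambda>w \<rho>. of_bool (P w \<rho>))"
  by (simp add: ls_pred_def)

lemma ls_pred_const [ls_intros]: "ls_pred (\<lambda>w \<rho>. P)"
  by (simp add: ls_pred_def ls_fun_const)

lemma ls_fun_mult [ls_intros]:
  assumes "ls_fun a" and "ls_fun b"
  shows "ls_fun (\<lambda>w \<rho>. a w \<rho> * b w \<rho>)"
proof -
  have "ls_fun (\<lambda>w \<rho>. \<Sum>v<a w \<rho>. b w \<rho>)"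
    by (rule ls_fun_sum[where Q = "\<lambda>w \<rho> v. b w \<rho>"]) (rule ls_fun_tl assms)+
  then show ?thesis by simp
qed

lemma ls_pred_not [ls_intros]:
  assumes "ls_pred P"
  shows "ls_pred (\<lambda>w \<rho>. \<not> P w \<rho>)"
proof -
  have "ls_pred (\<lambda>w \<rho>. of_bool (P w \<rho>) < (1::nat))"
    by (rule ls_pred_less ls_fun_of_bool ls_fun_const assms)+
  then show ?thesis by simp
qed

lemma ls_pred_conj [ls_intros]:
  assumes "ls_pred P" and "ls_pred Q"
  shows "ls_pred (\<lambda>w \<rho>. P w \<rho> \<and> Q w \<rho>)"
  using ls_fun_mult[OF assms[unfolded ls_pred_def]] by (simp add: ls_pred_def of_bool_conj)

lemma ls_pred_disj [ls_intros]:
  assumes "ls_pred P" and "ls_pred Q"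
  shows "ls_pred (\<lambda>w \<rho>. P w \<rho> \<or> Q w \<rho>)"
proof -
  have "ls_pred (\<lambda>w \<rho>. \<not> (\<not> P w \<rho> \<and> \<not> Q w \<rho>))"
    by (rule ls_pred_not ls_pred_conj assms)+
  then show ?thesis by simp
qed

lemma ls_pred_imp [ls_intros]:
  assumes "ls_pred P" and "ls_pred Q"
  shows "ls_pred (\<lambda>w \<rho>. P w \<rho> \<longrightarrow> Q w \<rho>)"
  unfolding imp_conv_disj by (rule ls_pred_disj ls_pred_not assms)+

lemma ls_pred_le [ls_intros]:
  assumes "ls_fun a" and "ls_fun b"
  shows "ls_pred (\<lambda>w \<rho>. a w \<rho> \<le> b w \<rho>)"
  using ls_pred_not[OF ls_pred_less[OF assms(2,1)]] by (simp add: not_less)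

lemma ls_pred_eq [ls_intros]:
  assumes "ls_fun a" and "ls_fun b"
  shows "ls_pred (\<lambda>w \<rho>. a w \<rho> = b w \<rho>)"
  using ls_pred_conj[OF ls_pred_le[OF assms] ls_pred_le[OF assms(2,1)]] by (simp add: eq_iff)

lemma ls_pred_iff [ls_intros]:
  assumes "ls_pred P" and "ls_pred Q"
  shows "ls_pred (\<lambda>w \<rho>. P w \<rho> \<longleftrightarrow> Q w \<rho>)"
  unfolding iff_conv_conj_imp by (rule ls_pred_conj ls_pred_imp assms)+

lemma ls_pred_ex [ls_intros]:
  assumes "ls_pred (\<lambda>w \<rho>. Q w (tl \<rho>) (hd \<rho>))" and "ls_fun a"
  shows "ls_pred (\<lambda>w \<rho>. \<exists>v<a w \<rho>. Q w \<rho> v)"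
proof -
  have "ls_pred (\<lambda>w \<rho>. (0::nat) < (\<Sum>v<a w \<rho>. of_bool (Q w \<rho> v)))"
    by (rule ls_pred_less ls_fun_const ls_fun_sum[where Q = "\<lambda>w \<rho> v. of_bool (Q w \<rho> v)"]
      ls_fun_of_bool assms)+
  moreover have "(0::nat) < (\<Sum>v<n. of_bool (P v)) \<longleftrightarrow> (\<exists>v<n. P v)" for n and P :: "nat \<Rightarrow> bool"
    by (auto simp: zero_less_iff_neq_zero)
  ultimately show ?thesis by simp
qed

lemma ls_pred_all [ls_intros]:
  assumes "ls_pred (\<lambda>w \<rho>. Q w (tl \<rho>) (hd \<rho>))" and "ls_fun a"
  shows "ls_pred (\<lambda>w \<rho>. \<forall>v<a w \<rho>. Q w \<rho> v)"
  using ls_pred_not[OF ls_pred_ex[where Q = "\<lambda>w \<rho> v. \<not> Q w \<rho> v", OF ls_pred_not[OF assms(1)] assms(2)]]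
  by simp

lemma sum_of_bool_less: "a \<le> n \<Longrightarrow> (\<Sum>i<n. of_bool (i < a)) = (a::nat)"
proof -
  assume "a \<le> n"
  then have "{i. i < n \<and> i < a} = {..<a}" by auto
  then show ?thesis by (simp add: sum.If_cases of_bool_def Int_def)
qed

text \<open>Both summands are obtained by counting, the outer index selecting which one. The range
  must be long enough for both, and the product of their successors is such a range that is
  available without addition.\<close>

lemma ls_fun_add [ls_intros]:
  assumes "ls_fun a" and "ls_fun b"
  shows "ls_fun (\<lambda>w \<rho>. a w \<rho> + b w \<rho>)"
proof -
  have "ls_fun (\<lambda>w \<rho>. \<Sum>v<2::nat. \<Sum>i<Suc (a w \<rho>) * Suc (b w \<rho>).
      of_bool (v < 1 \<and> i < a w \<rho> \<or> \<not> v < 1 \<and> i < b w \<rho>))"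
    by (rule ls_intros ls_fun_tl assms)+
  moreover have "(\<Sum>v<2::nat. \<Sum>i<Suc m * Suc n. of_bool (v < 1 \<and> i < m \<or> \<not> v < (1::nat) \<and> i < n)) = m + n" for m n :: nat
    using sum_of_bool_less[of m "Suc m * Suc n"] sum_of_bool_less[of n "Suc m * Suc n"]
    by (simp add: numeral_2_eq_2)
  ultimately show ?thesis by simp
qed

lemma ls_fun_if [ls_intros]:
  assumes "ls_pred P" and "ls_fun a" and "ls_fun b"
  shows "ls_fun (\<lambda>w \<rho>. if P w \<rho> then a w \<rho> else b w \<rho>)"
proof -
  have "ls_fun (\<lambda>w \<rho>. of_bool (P w \<rho>) * a w \<rho> + of_bool (\<not> P w \<rho>) * b w \<rho>)"
    by (rule ls_intros assms)+
  moreover have "(\<lambda>w \<rho>. of_bool (P w \<rho>) * a w \<rho> + of_bool (\<not> P w \<rho>) * b w \<rho>) =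
      (\<lambda>w \<rho>. if P w \<rho> then a w \<rho> else b w \<rho>)"
    by (auto simp: fun_eq_iff)
  ultimately show ?thesis by simp
qed

text \<open>With this rule a defined operation is analysed once, on variables, and then applied to
  arbitrary computable arguments.\<close>

lemma ls_fun_app1:
  assumes "ls_fun (\<lambda>w \<rho>. F w (hd \<rho>))" and "ls_fun a"
  shows "ls_fun (\<lambda>w \<rho>. F w (a w \<rho>))"
  using ls_fun_let[where F = "\<lambda>w \<rho> v. F w v", OF assms] .

lemma ls_fun_app2:
  assumes F: "ls_fun (\<lambda>w \<rho>. F w (hd (tl \<rho>)) (hd \<rho>))" and a: "ls_fun a" and b: "ls_fun b"
  shows "ls_fun (\<lambda>w \<rho>. F w (a w \<rho>) (b w \<rho>))"
proof -
  have "ls_fun (\<lambda>w \<rho>. F w (hd \<rho>) (b w (tl \<rho>)))"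
    by (rule ls_fun_let[where F = "\<lambda>w \<rho> v. F w (hd \<rho>) v", OF F ls_fun_tl[OF b]])
  from ls_fun_let[where F = "\<lambda>w \<rho> v. F w v (b w \<rho>)", OF this a] show ?thesis .
qed

lemmas ls_pred_app1 = ls_fun_app1[where F = "\<lambda>w a. of_bool (P w a)" for P, folded ls_pred_def]
lemmas ls_pred_app2 = ls_fun_app2[where F = "\<lambda>w a b. of_bool (P w a b)" for P, folded ls_pred_def]

lemma ls_out_Cons: "ls_out f \<Longrightarrow> ls_out (\<lambda>w \<rho>. s # f w \<rho>)"
  using ls_out_append[OF ls_out_single, of f s] by simp

lemma ls_out_tl: "ls_out f \<Longrightarrow> ls_out (\<lambda>w \<rho>. f w (tl \<rho>))"
  unfolding ls_out_def
proof (intro allI impI)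
  fix vs :: "nat list" and k d :: nat
  assume f: "\<forall>vs k d. set vs \<subseteq> {..<k} \<longrightarrow> (\<exists>c D. prints c vs k d D f)"
    and vs: "set vs \<subseteq> {..<k}"
  have sub: "set (tl vs) \<subseteq> set vs" by (cases vs) auto
  with vs have "set (tl vs) \<subseteq> {..<k}" by blast
  with f obtain c D where c: "prints c (tl vs) k d D f" by blast
  have "prints c vs k d D (\<lambda>w \<rho>. f w (tl \<rho>))"
    using c sub unfolding prints_def by (simp add: map_tl[symmetric] subset_iff)
  then show "\<exists>c D. prints c vs k d D (\<lambda>w \<rho>. f w (tl \<rho>))" by blast
qed

text \<open>Each branch is a loop of length 0 or 1.\<close>

lemma ls_out_if:
  assumes P: "ls_pred P" and f: "ls_out f" and g: "ls_out g"
  shows "ls_out (\<lambda>w \<rho>. if P w \<rho> then f w \<rho> else g w \<rho>)"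
proof -
  have "ls_out (\<lambda>w \<rho>. concat (map (\<lambda>v. f w \<rho>) [0..<of_bool (P w \<rho>)]) @
      concat (map (\<lambda>v. g w \<rho>) [0..<of_bool (\<not> P w \<rho>)]))"
    by (intro ls_out_append ls_out_loop[where f = "\<lambda>w \<rho> v. f w \<rho>"]
      ls_out_loop[where f = "\<lambda>w \<rho> v. g w \<rho>"] ls_out_tl f g ls_fun_of_bool P ls_pred_not)
  moreover have "(\<lambda>w \<rho>. concat (map (\<lambda>v. f w \<rho>) [0..<of_bool (P w \<rho>)]) @
      concat (map (\<lambda>v. g w \<rho>) [0..<of_bool (\<not> P w \<rho>)])) = (\<lambda>w \<rho>. if P w \<rho> then f w \<rho> else g w \<rho>)"
    by (auto simp: fun_eq_iff)
  ultimately show ?thesis by simp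
qed


section \<open>Reading encoded instances by positions\<close>

fun bits :: "sym list \<Rightarrow> bool list" where
  "bits (SBit b # w) = b # bits w"
| "bits w = []"

abbreviation item :: "sym list \<Rightarrow> nat \<Rightarrow> bool" where
  "item w p \<equiv> sym_at w p SItem"

abbreviation negative :: "sym list \<Rightarrow> nat \<Rightarrow> bool" where
  "negative w p \<equiv> sym_at w (Suc p) SNeg"

definition start :: "sym list \<Rightarrow> nat \<Rightarrow> nat" where
  "start w p = (if negative w p then Suc (Suc p) else Suc p)"

definition name_at :: "sym list \<Rightarrow> nat \<Rightarrow> name" where
  "name_at w p = bits (drop (start w p) w)"

definition lit_at :: "sym list \<Rightarrow> nat \<Rightarrow> literal" where
  "lit_at w p = (if negative w p then Neg (name_at w p) else Pos (name_at w p))"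

text \<open>The end marks before p count the completed clauses, so this is the index of the clause,
  or list of names, in which p lies.\<close>

definition cnum :: "sym list \<Rightarrow> nat \<Rightarrow> nat" where
  "cnum w p = (\<Sum>e<p. of_bool (sym_at w e SEnd))"

definition items :: "sym list \<Rightarrow> nat list" where
  "items w = filter (item w) [0..<length w]"

definition clause_at :: "sym list \<Rightarrow> nat \<Rightarrow> literal list" where
  "clause_at w k = map (lit_at w) (filter (\<lambda>p. cnum w p = k) (items w))"

lemma var_lit_at [simp]: "var (lit_at w p) = name_at w p"
  by (simp add: lit_at_def)

lemma lit_true_lit_at [simp]: "lit_true \<alpha> (lit_at w p) \<longleftrightarrow> (\<alpha> (name_at w p) \<longleftrightarrow> \<not> negative w p)"
  by (simp add: lit_at_def)

lemma sym_at_Cons_0 [simp]: "sym_at (a # w) 0 s \<longleftrightarrow> a = s"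
  by (simp add: sym_at_def)

lemma sym_at_Cons_Suc [simp]: "sym_at (a # w) (Suc p) s \<longleftrightarrow> sym_at w p s"
  by (simp add: sym_at_def)

lemma sym_at_drop: "sym_at (drop s w) i a \<longleftrightarrow> sym_at w (s + i) a"
  by (auto simp: sym_at_def add.commute)

lemma sym_at_less: "sym_at w p s \<Longrightarrow> p < length w"
  by (simp add: sym_at_def)

lemma finite_items: "finite {q. item w q \<and> P q}"
  by (rule finite_subset[of _ "{..<length w}"]) (auto dest: sym_at_less)

lemma name_at_Cons_Suc [simp]: "name_at (a # w) (Suc p) = name_at w p"
  by (simp add: name_at_def start_def)

lemma lit_at_Cons_Suc [simp]: "lit_at (a # w) (Suc p) = lit_at w p"
  by (simp add: lit_at_def)

lemma cnum_0 [simp]: "cnum w 0 = 0"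
  by (simp add: cnum_def)

lemma cnum_Cons_Suc [simp]: "cnum (a # w) (Suc p) = of_bool (a = SEnd) + cnum w p"
  unfolding cnum_def by (subst sum.lessThan_Suc_shift) simp

lemma filter_upt_Suc: "filter P [0..<Suc n] = (if P 0 then [0] else []) @ map Suc (filter (\<lambda>i. P (Suc i)) [0..<n])"
  by (subst upt_conv_Cons) (simp_all add: map_Suc_upt[symmetric] filter_map comp_def del: upt_Suc)

lemma items_Cons: "items (a # w) = (if a = SItem then [0] else []) @ map Suc (items w)"
  by (simp add: items_def filter_upt_Suc del: upt_Suc)

lemma clause_at_Cons:
  "clause_at (a # w) k =
    (if a = SEnd then (if k = 0 then [] else clause_at w (k - 1))
     else if a = SItem \<and> k = 0 then lit_at (a # w) 0 # clause_at w k else clause_at w k)"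
  by (cases k) (auto simp: clause_at_def items_Cons filter_map comp_def)

text \<open>A go-between for proofs: reading by positions and \<open>enc_cnf\<close> are both
  compared with this recursion. A last clause without end mark is dropped, just as it gets no index
  below the total count of end marks.\<close>

fun parse :: "sym list \<Rightarrow> cnf" where
  "parse [] = []"
| "parse (a # w) =
    (if a = SEnd then [] # parse w
     else if a = SItem then (case parse w of [] \<Rightarrow> [] | cl # \<phi> \<Rightarrow> (lit_at (a # w) 0 # cl) # \<phi>)
     else parse w)"

lemma parse_clauses: "map (clause_at w) [0..<cnum w (length w)] = parse w"
proof (induction w)
  case (Cons a w)
  consider "a = SEnd" | "a = SItem" | "a \<noteq> SEnd" "a \<noteq> SItem" by blast
  then show ?case
  proof cases
    case 1
    have "map (clause_at (a # w)) [0..<Suc (cnum w (length w))] =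
        clause_at (a # w) 0 # map (clause_at (a # w)) (map Suc [0..<cnum w (length w)])"
      by (simp add: map_Suc_upt upt_conv_Cons del: upt_Suc)
    moreover have "map (clause_at (a # w)) (map Suc [0..<cnum w (length w)]) = parse w"
      using Cons.IH 1 by (simp add: clause_at_Cons comp_def del: upt_Suc map_Suc_upt)
    moreover have "clause_at (a # w) 0 = []" using 1 by (simp add: clause_at_Cons)
    moreover have "cnum (a # w) (length (a # w)) = Suc (cnum w (length w))" using 1 by simp
    ultimately show ?thesis using 1 by (simp only: parse.simps if_True refl)
  next
    case 2
    show ?thesis
    proof (cases "cnum w (length w)")
      case 0
      then show ?thesis using 2 Cons by simp
    next
      case (Suc n)
      have *: "[0..<Suc n] = 0 # [1..<Suc n]" by (simp add: upt_conv_Cons del: upt_Suc)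
      have "map (clause_at w) [1..<Suc n] = map (clause_at (a # w)) [1..<Suc n]"
        using 2 by (simp add: clause_at_Cons)
      then show ?thesis using Cons.IH[symmetric] 2 unfolding Suc *
        by (simp add: clause_at_Cons Suc * del: upt_Suc)
    qed
  next
    case 3
    then show ?thesis using Cons by (simp add: clause_at_Cons)
  qed
qed simp

lemma bits_append: "(\<And>b t. r \<noteq> SBit b # t) \<Longrightarrow> bits (map SBit v @ r) = v"
proof (induction v)
  case Nil
  then show ?case by (cases r rule: bits.cases) auto
qed simp

text \<open>What follows must not start with a bit, which would lengthen the name, nor with a
  negation mark, which would negate a positive literal with empty name.\<close>

lemma lit_at_enc_literal:
  assumes "\<And>b t. r \<noteq> SBit b # t" and "\<And>t. r \<noteq> SNeg # t"
  shows "lit_at (enc_literal l @ r) 0 = l"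
proof (cases l)
  case (Pos v)
  have "\<not> negative (SItem # map SBit v @ r) 0"
    using assms(2) by (cases v; cases r) (auto simp: sym_at_def)
  then show ?thesis using Pos assms(1) by (simp add: lit_at_def name_at_def start_def bits_append)
next
  case (Neg v)
  then show ?thesis using assms(1) by (simp add: lit_at_def name_at_def start_def bits_append)
qed

lemma parse_bits: "parse (map SBit v @ r) = parse r"
  by (induction v) auto

lemma items_bits: "map (lit_at (map SBit v @ r)) (items (map SBit v @ r)) = map (lit_at r) (items r)"
  by (induction v) (auto simp: items_Cons comp_def)

lemma parse_clause:
  "parse (concat (map enc_literal cl) @ SEnd # r) = cl # parse r"
proof (induction cl)
  case (Cons l cl)
  let ?r = "concat (map enc_literal cl) @ SEnd # r"
  have l: "lit_at (enc_literal l @ ?r) 0 = l"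
    by (rule lit_at_enc_literal) (rule enc_literals_not_bit enc_literals_not_neg)+
  have "parse (enc_literal l @ ?r) = (l # cl) # parse r"
    using l Cons by (cases l) (simp_all add: parse_bits)
  then show ?case by simp
qed simp

lemma parse_enc_cnf: "parse (enc_cnf \<phi>) = \<phi>"
  by (induction \<phi>) (simp_all add: enc_cnf_def parse_clause)

lemma items_clause:
  "map (lit_at (concat (map enc_literal cl) @ SEnd # r)) (items (concat (map enc_literal cl) @ SEnd # r)) =
    cl @ map (lit_at r) (items r)"
proof (induction cl)
  case Nil
  then show ?case by (simp add: items_Cons comp_def)
next
  case (Cons l cl)
  let ?r = "concat (map enc_literal cl) @ SEnd # r"
  have l: "lit_at (enc_literal l @ ?r) 0 = l"
    by (rule lit_at_enc_literal) (rule enc_literals_not_bit enc_literals_not_neg)+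
  have "map (lit_at (enc_literal l @ ?r)) (items (enc_literal l @ ?r)) = l # map (lit_at ?r) (items ?r)"
    using l by (cases l) (simp_all add: items_Cons comp_def items_bits)
  then show ?case using Cons by simp
qed

lemma items_enc_cnf: "map (lit_at (enc_cnf \<phi>)) (items (enc_cnf \<phi>)) = concat \<phi>"
  by (induction \<phi>) (simp_all add: enc_cnf_def items_clause, simp add: items_def)

lemma clauses_enc_cnf:
  "map (clause_at (enc_cnf \<phi>)) [0..<cnum (enc_cnf \<phi>) (length (enc_cnf \<phi>))] = \<phi>"
  by (simp add: parse_clauses parse_enc_cnf)

section \<open>Local characterisation of encodings\<close>

definition is_bit :: "sym list \<Rightarrow> nat \<Rightarrow> bool" where
  "is_bit w p \<longleftrightarrow> sym_at w p (SBit True) \<or> sym_at w p (SBit False)"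

text \<open>Conditions on neighbouring symbols and the end only, so that bounded quantifiers over
  positions decide membership in the range of \<open>enc_cnf\<close>.\<close>

definition well_formed :: "sym list \<Rightarrow> bool" where
  "well_formed w \<longleftrightarrow> (length w = 0 \<or> (\<exists>p<length w. Suc p = length w \<and> sym_at w p SEnd)) \<and>
    (\<forall>p<length w. is_bit w p \<longrightarrow> (\<exists>q<p. Suc q = p \<and> \<not> sym_at w q SEnd)) \<and>
    (\<forall>p<length w. sym_at w p SNeg \<longrightarrow> (\<exists>q<p. Suc q = p \<and> sym_at w q SItem))"

fun follows :: "sym \<Rightarrow> sym \<Rightarrow> bool" where
  "follows a (SBit b) \<longleftrightarrow> a \<noteq> SEnd"
| "follows a SNeg \<longleftrightarrow> a = SItem"
| "follows a _ \<longleftrightarrow> True"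

text \<open>The induction strips symbols from the left, so w may be the suffix of an encoding that
  starts inside a literal: with its negation mark, or with the rest of its name.\<close>

lemma well_formed_enc_literals:
  assumes "w \<noteq> []" and "last w = SEnd" and "successively follows w"
  shows "\<exists>b v ls \<phi>. w = (if b then [SNeg] else []) @ map SBit v @ concat (map enc_literal ls) @ SEnd # enc_cnf \<phi>"
  using assms
proof (induction w)
  case (Cons a w)
  show ?case
  proof (cases "w = []")
    case True
    then show ?thesis using Cons.prems
      by (intro exI[of _ False] exI[of _ "[]"]) (simp add: enc_cnf_def)
  next
    case False
    with Cons have suc: "follows a (hd w)" "successively follows w"
      by (simp_all add: successively_Cons)
    from Cons.IH[OF False _ suc(2)] Cons.prems False obtain b v ls \<phi> where
      w: "w = (if b then [SNeg] else []) @ map SBit v @ concat (map enc_literal ls) @ SEnd # enc_cnf \<phi>"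
      by auto
    show ?thesis
    proof (cases a)
      case (SBit x)
      then have "\<not> b" using suc(1) w by auto
      then show ?thesis using w SBit
        by (intro exI[of _ False] exI[of _ "x # v"] exI[of _ ls] exI[of _ \<phi>]) simp
    next
      case SItem
      then show ?thesis using w
        by (intro exI[of _ False] exI[of _ "[]"] exI[of _ "(if b then Neg v else Pos v) # ls"] exI[of _ \<phi>]) simp
    next
      case SNeg
      then have "\<not> b" using suc(1) w by auto
      then show ?thesis using w SNeg
        by (intro exI[of _ True] exI[of _ v] exI[of _ ls] exI[of _ \<phi>]) simp
    next
      case SEnd
      then have "\<not> b" "v = []" using suc(1) w by (cases b; cases v; simp)+
      then show ?thesis using w SEnd
        by (intro exI[of _ False] exI[of _ "[]"] exI[of _ "[]"] exI[of _ "ls # \<phi>"]) (simp add: enc_cnf_def)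
    qed
  qed
qed simp

lemma well_formed_successively:
  assumes "well_formed w"
  shows "successively follows w"
  unfolding successively_conv_nth
proof (intro allI impI)
  fix i assume i: "Suc i < length w"
  show "follows (w ! i) (w ! Suc i)"
  proof (cases "w ! Suc i")
    case (SBit b)
    then have "is_bit w (Suc i)" using i by (cases b) (auto simp: is_bit_def sym_at_def)
    then show ?thesis using assms i SBit by (auto simp: well_formed_def sym_at_def)
  next
    case SNeg
    then show ?thesis using assms i by (auto simp: well_formed_def sym_at_def)
  qed auto
qed

lemma well_formed_hd:
  assumes "well_formed w" and "w \<noteq> []"
  shows "hd w = SItem \<or> hd w = SEnd"
proof (cases "hd w")
  case (SBit b)
  then have "is_bit w 0" using assms(2) by (cases b; cases w) (auto simp: is_bit_def sym_at_def)
  then show ?thesis using assms by (auto simp: well_formed_def)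
next
  case SNeg
  then have "sym_at w 0 SNeg" using assms(2) by (cases w) (auto simp: sym_at_def)
  then show ?thesis using assms by (auto simp: well_formed_def)
qed auto

lemma successively_bits: "successively follows (map SBit v)"
proof (induction v)
  case (Cons b v)
  then show ?case by (cases v) (auto simp: successively_Cons)
qed simp

lemma successively_literal: "successively follows (enc_literal l)" "last (enc_literal l) \<noteq> SEnd"
  "hd (enc_literal l) = SItem"
proof -
  have "successively follows (SItem # map SBit v)" "successively follows (SItem # SNeg # map SBit v)" for v
    using successively_bits[of v] by (cases v; simp add: successively_Cons)+
  then show "successively follows (enc_literal l)" by (cases l) simp_all
  have "last (SItem # map SBit v) \<noteq> SEnd" "last (SNeg # map SBit v) \<noteq> SEnd" for v
    by (cases v rule: rev_cases; simp)+
  then show "last (enc_literal l) \<noteq> SEnd" by (cases l) (simp_all del: last.simps add: last_ConsR)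
  show "hd (enc_literal l) = SItem" by (cases l) simp_all
qed

lemma successively_enc_cnf:
  "successively follows (enc_cnf \<phi>) \<and> (\<phi> \<noteq> [] \<longrightarrow> enc_cnf \<phi> \<noteq> [] \<and> last (enc_cnf \<phi>) = SEnd \<and>
    hd (enc_cnf \<phi>) \<in> {SItem, SEnd})"
proof (induction \<phi>)
  case Nil
  then show ?case by (simp add: enc_cnf_def)
next
  case (Cons cl \<phi>)
  have cl: "successively follows (concat (map enc_literal cl) @ SEnd # enc_cnf \<phi>) \<and>
      hd (concat (map enc_literal cl) @ SEnd # enc_cnf \<phi>) \<in> {SItem, SEnd}"
  proof (induction cl)
    case Nil
    then show ?case using Cons by (cases "\<phi> = []") (auto simp: successively_Cons enc_cnf_def)
  next
    case (Cons l cl)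
    have "enc_literal l \<noteq> []" by (cases l) auto
    then show ?case using Cons successively_literal[of l]
      by (auto simp: successively_append_iff)
  qed
  have "enc_cnf (cl # \<phi>) = concat (map enc_literal cl) @ SEnd # enc_cnf \<phi>" by (simp add: enc_cnf_def)
  with cl Cons show ?case by (cases "\<phi> = []") (auto simp: enc_cnf_def)
qed

lemma well_formedI:
  assumes "successively follows w" and "w \<noteq> [] \<Longrightarrow> last w = SEnd \<and> hd w \<in> {SItem, SEnd}"
  shows "well_formed w"
proof -
  have suc: "follows (w ! q) (w ! Suc q)" if "Suc q < length w" for q
    using assms(1) that by (simp add: successively_conv_nth)
  have first: "w ! 0 \<in> {SItem, SEnd}" if "0 < length w"
    using assms(2) that by (simp add: hd_conv_nth)
  show ?thesis
    unfolding well_formed_def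
  proof (intro conjI allI impI)
    show "length w = 0 \<or> (\<exists>p<length w. Suc p = length w \<and> sym_at w p SEnd)"
      using assms(2) by (cases "w = []") (auto simp: sym_at_def last_conv_nth intro!: exI[of _ "length w - 1"])
    fix p assume p: "p < length w"
    show "\<exists>q<p. Suc q = p \<and> \<not> sym_at w q SEnd" if "is_bit w p"
      using that p suc first by (cases p) (auto simp: is_bit_def sym_at_def dest: suc)
    show "\<exists>q<p. Suc q = p \<and> sym_at w q SItem" if "sym_at w p SNeg"
      using that p suc first by (cases p) (auto simp: sym_at_def dest: suc)
  qed
qed

lemma well_formed_iff: "well_formed w \<longleftrightarrow> (\<exists>\<phi>. w = enc_cnf \<phi>)"
proof
  assume wf: "well_formed w"
  show "\<exists>\<phi>. w = enc_cnf \<phi>"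
  proof (cases "w = []")
    case True
    then show ?thesis by (intro exI[of _ "[]"]) (simp add: enc_cnf_def)
  next
    case False
    moreover have "last w = SEnd"
      using wf False unfolding well_formed_def sym_at_def last_conv_nth[OF False]
      by (metis diff_Suc_1 length_0_conv)
    ultimately obtain b v ls \<phi> where
      w: "w = (if b then [SNeg] else []) @ map SBit v @ concat (map enc_literal ls) @ SEnd # enc_cnf \<phi>"
      using well_formed_enc_literals well_formed_successively[OF wf] by blast
    then have "\<not> b" "v = []" using well_formed_hd[OF wf False] by (cases b; cases v; simp)+
    then show ?thesis using w by (intro exI[of _ "ls # \<phi>"]) (simp add: enc_cnf_def)
  qed
next
  assume "\<exists>\<phi>. w = enc_cnf \<phi>"
  then obtain \<phi> where w: "w = enc_cnf \<phi>" by blast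
  show "well_formed w"
    using successively_enc_cnf[of \<phi>] unfolding w
    by (intro well_formedI) (cases "\<phi> = []"; auto simp: enc_cnf_def)+
qed


section \<open>Reading names and clauses in logarithmic space\<close>

lemma ls_is_bit [ls_intros]: "ls_fun a \<Longrightarrow> ls_pred (\<lambda>w \<rho>. is_bit w (a w \<rho>))"
  by (rule ls_pred_app1[where P = is_bit]) (unfold is_bit_def, (rule ls_intros | assumption)+)

lemma ls_start [ls_intros]: "ls_fun a \<Longrightarrow> ls_fun (\<lambda>w \<rho>. start w (a w \<rho>))"
  by (rule ls_fun_app1[where F = start]) (unfold start_def, (rule ls_intros | assumption)+)

lemma ls_cnum [ls_intros]: "ls_fun a \<Longrightarrow> ls_fun (\<lambda>w \<rho>. cnum w (a w \<rho>))"
  by (rule ls_fun_app1[where F = cnum]) (unfold cnum_def, (rule ls_intros | assumption)+)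

lemma ls_well_formed [ls_intros]: "ls_pred (\<lambda>w \<rho>. well_formed w)"
  unfolding well_formed_def by (rule ls_intros)+

lemma less_length_bits: "i < length (bits u) \<longleftrightarrow> (\<forall>j<Suc i. is_bit u j)"
proof (induction u arbitrary: i rule: bits.induct)
  case (1 b u)
  have "(\<forall>j<Suc i. is_bit (SBit b # u) j) \<longleftrightarrow> (\<forall>j<i. is_bit u j)"
  proof -
    have "is_bit (SBit b # u) 0" by (cases b) (auto simp: is_bit_def)
    moreover have "is_bit (SBit b # u) (Suc j) \<longleftrightarrow> is_bit u j" for j by (simp add: is_bit_def)
    ultimately show ?thesis by (simp add: All_less_Suc2)
  qed
  then show ?case using 1 by (cases i) auto
qed (auto simp: is_bit_def sym_at_def)

lemma nth_bits: "i < length (bits u) \<Longrightarrow> bits u ! i \<longleftrightarrow> sym_at u i (SBit True)"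
proof (induction u arbitrary: i rule: bits.induct)
  case (1 b u)
  then show ?case by (cases i) auto
qed auto

lemma length_bits: "length (bits u) \<le> length u"
  by (induction u rule: bits.induct) auto

lemma is_bit_drop: "is_bit (drop s w) i \<longleftrightarrow> is_bit w (s + i)"
  by (simp add: is_bit_def sym_at_drop)

definition name_length :: "sym list \<Rightarrow> nat \<Rightarrow> nat" where
  "name_length w p = length (name_at w p)"

text \<open>A symbol belongs to the name iff it and all symbols from the start up to it are bits, so
  the length is a count of positions. Lists are never values of the language, only their lengths and
  entries are.\<close>

lemma name_length_eq:
  "name_length w p = (\<Sum>i<length w. of_bool (\<forall>j<Suc i. is_bit w (start w p + j)))"
proof -
  have "name_length w p \<le> length w"
    using length_bits[of "drop (start w p) w"] by (simp add: name_length_def name_at_def)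
  then have "name_length w p = (\<Sum>i<length w. of_bool (i < name_length w p))"
    by (rule sum_of_bool_less[symmetric])
  then show ?thesis
    by (simp add: name_length_def name_at_def less_length_bits is_bit_drop)
qed

lemma ls_name_length [ls_intros]: "ls_fun a \<Longrightarrow> ls_fun (\<lambda>w \<rho>. name_length w (a w \<rho>))"
  by (rule ls_fun_app1[where F = name_length]) (unfold name_length_eq, (rule ls_intros | assumption)+)

definition same_name :: "sym list \<Rightarrow> nat \<Rightarrow> nat \<Rightarrow> bool" where
  "same_name w p q \<longleftrightarrow> name_at w p = name_at w q"

lemma same_name_iff:
  "same_name w p q \<longleftrightarrow> name_length w p = name_length w q \<and>
    (\<forall>i<name_length w p. sym_at w (start w p + i) (SBit True) \<longleftrightarrow> sym_at w (start w q + i) (SBit True))"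
  unfolding same_name_def name_at_def name_length_def list_eq_iff_nth_eq
  by (auto simp: nth_bits sym_at_drop)

lemma ls_same_name [ls_intros]:
  "ls_fun a \<Longrightarrow> ls_fun b \<Longrightarrow> ls_pred (\<lambda>w \<rho>. same_name w (a w \<rho>) (b w \<rho>))"
  by (rule ls_pred_app2[where P = same_name]) (unfold same_name_iff, (rule ls_intros | assumption)+)

definition clause_length :: "sym list \<Rightarrow> nat \<Rightarrow> nat" where
  "clause_length w k = (\<Sum>p<length w. of_bool (item w p \<and> cnum w p = k))"

lemma ls_clause_length [ls_intros]: "ls_fun a \<Longrightarrow> ls_fun (\<lambda>w \<rho>. clause_length w (a w \<rho>))"
  by (rule ls_fun_app1[where F = clause_length]) (unfold clause_length_def, (rule ls_intros | assumption)+)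

lemma sum_of_bool_card: "(\<Sum>p<n. of_bool (P p)) = card {p. p < n \<and> P p}" for n :: nat
  by (simp add: of_bool_def sum.If_cases Int_def)

lemma clause_length_card: "clause_length w k = card {p. item w p \<and> cnum w p = k}"
  unfolding clause_length_def sum_of_bool_card by (intro arg_cong[where f = card]) (auto dest: sym_at_less)

lemma length_clause_at: "length (clause_at w k) = clause_length w k"
proof -
  have "distinct (filter (\<lambda>p. cnum w p = k) (items w))" by (simp add: items_def)
  then have "length (clause_at w k) = card {p. p < length w \<and> item w p \<and> cnum w p = k}"
    by (simp add: clause_at_def distinct_card[symmetric] items_def)
  then show ?thesis unfolding clause_length_def sum_of_bool_card .
qed

lemma set_items: "set (items w) = {p. item w p}"
  by (auto simp: items_def dest: sym_at_less)

lemma set_clause_at: "set (clause_at w k) = lit_at w ` {p. item w p \<and> cnum w p = k}"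
  by (auto simp: clause_at_def set_items)

section \<open>Powers of two, binary digits and the binary logarithm\<close>

definition is_power2 :: "nat \<Rightarrow> bool" where
  "is_power2 v \<longleftrightarrow> (\<exists>i. v = 2 ^ i)"

text \<open>For a power of two v this is the binary digit of z of weight v. Digits are addressed by
  weight to avoid exponentiation.\<close>

definition halving :: "nat \<Rightarrow> nat \<Rightarrow> bool" where
  "halving z v \<longleftrightarrow> odd (z div v)"

lemma even_nat_iff: "even (q::nat) \<longleftrightarrow> (\<exists>s<Suc q. q = s + s)"
  by (auto elim!: evenE intro!: exI[of _ "q div 2"])

lemma dvd_nat_iff: "d dvd v \<longleftrightarrow> v = 0 \<or> (\<exists>e<Suc v. v = d * e)" for d v :: nat
proof
  assume "d dvd v"
  then obtain e where e: "v = d * e" by blast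
  show "v = 0 \<or> (\<exists>e<Suc v. v = d * e)"
  proof (cases "v = 0")
    case False
    then have "e \<le> v" using e by (cases d) auto
    then have "e < Suc v" by simp
    then show ?thesis using e by blast
  qed simp
qed auto

lemma ls_even [ls_intros]: "ls_fun a \<Longrightarrow> ls_pred (\<lambda>w \<rho>. even (a w \<rho>))"
  by (rule ls_pred_app1[where P = "\<lambda>w. even"]) (unfold even_nat_iff, (rule ls_intros | assumption)+)

lemma ls_dvd [ls_intros]: "ls_fun a \<Longrightarrow> ls_fun b \<Longrightarrow> ls_pred (\<lambda>w \<rho>. a w \<rho> dvd b w \<rho>)"
  by (rule ls_pred_app2[where P = "\<lambda>w. (dvd)"]) (unfold dvd_nat_iff, (rule ls_intros | assumption)+)

text \<open>Halving an even number preserves the condition on the divisors, which yields the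
  exponent by induction. The right-hand side needs neither exponents nor unbounded
  quantifiers.\<close>

lemma is_power2_iff: "is_power2 v \<longleftrightarrow> 0 < v \<and> (\<forall>d<Suc v. d dvd v \<longrightarrow> d = 1 \<or> even d)"
proof
  assume "is_power2 v"
  then obtain i where v: "v = 2 ^ i" unfolding is_power2_def by blast
  have "d = 1 \<or> even d" if "d dvd v" for d
  proof (rule disjCI)
    assume "\<not> even d"
    then have "coprime d (2 ^ i)" by simp
    then show "d = 1" using coprime_common_divisor[of d "2 ^ i" d] that v by simp
  qed
  then show "0 < v \<and> (\<forall>d<Suc v. d dvd v \<longrightarrow> d = 1 \<or> even d)" using v by simp
next
  assume "0 < v \<and> (\<forall>d<Suc v. d dvd v \<longrightarrow> d = 1 \<or> even d)"
  then show "is_power2 v"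
  proof (induction v rule: less_induct)
    case (less v)
    show ?case
    proof (cases "v = 1")
      case True
      then show ?thesis unfolding is_power2_def by (metis power_0)
    next
      case False
      then have "even v" using less.prems by auto
      then obtain u where u: "v = 2 * u" by blast
      then have "is_power2 u" using less by auto
      then show ?thesis using u unfolding is_power2_def by (metis power_Suc)
    qed
  qed
qed

lemma ls_is_power2 [ls_intros]: "ls_fun a \<Longrightarrow> ls_pred (\<lambda>w \<rho>. is_power2 (a w \<rho>))"
  by (rule ls_pred_app1[where P = "\<lambda>w. is_power2"]) (unfold is_power2_iff, (rule ls_intros | assumption)+)

lemma halving_iff: "halving z v \<longleftrightarrow> (\<exists>q<Suc z. \<exists>r<v. z = q * v + r \<and> \<not> even q)"
proof
  assume "halving z v"
  then have odd: "odd (z div v)" by (simp add: halving_def)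
  then have "0 < v" by (cases v) auto
  then show "\<exists>q<Suc z. \<exists>r<v. z = q * v + r \<and> \<not> even q"
    using odd by (intro exI[of _ "z div v"] conjI exI[of _ "z mod v"]) (auto simp: less_Suc_eq_le)
qed (auto simp: halving_def)

lemma ls_halving [ls_intros]: "ls_fun a \<Longrightarrow> ls_fun b \<Longrightarrow> ls_pred (\<lambda>w \<rho>. halving (a w \<rho>) (b w \<rho>))"
  by (rule ls_pred_app2[where P = "\<lambda>w. halving"]) (unfold halving_iff, (rule ls_intros | assumption)+)

lemma power_le_iff_floorlog: "0 < k \<Longrightarrow> 2 ^ i \<le> k \<longleftrightarrow> i < floorlog 2 k"
  using floorlog_ge_SucI[of 2 i k] floorlog_geD[of "Suc i" 2 k] by auto

text \<open>The binary representation of k has one digit for each power of two up to k.\<close>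

lemma floorlog_eq_sum: "floorlog 2 k = (\<Sum>v<Suc k. of_bool (is_power2 v))"
proof (cases "k = 0")
  case True
  then show ?thesis by (simp add: floorlog_def is_power2_def)
next
  case False
  have "{v. v < Suc k \<and> is_power2 v} = (\<lambda>i. 2 ^ i) ` {i. i < floorlog 2 k}"
    using False by (auto simp: is_power2_def power_le_iff_floorlog[symmetric] less_Suc_eq_le)
  moreover have "inj_on (\<lambda>i. (2::nat) ^ i) A" for A by (intro inj_onI) simp
  ultimately show ?thesis unfolding sum_of_bool_card by (simp add: card_image)
qed

lemma ls_floorlog [ls_intros]: "ls_fun a \<Longrightarrow> ls_fun (\<lambda>w \<rho>. floorlog 2 (a w \<rho>))"
  by (rule ls_fun_app1[where F = "\<lambda>w. floorlog 2"]) (unfold floorlog_eq_sum, (rule ls_intros | assumption)+)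


section \<open>From exact covers to 2CNF formulas\<close>

definition names :: "sym list \<Rightarrow> nat \<Rightarrow> name list" where
  "names w k = map (name_at w) (filter (\<lambda>p. cnum w p = k) (items w))"

abbreviation clauses :: "sym list \<Rightarrow> nat" where
  "clauses w \<equiv> cnum w (length w)"

definition clause_subset :: "sym list \<Rightarrow> nat \<Rightarrow> nat \<Rightarrow> bool" where
  "clause_subset w k l \<longleftrightarrow> (\<forall>p<length w. item w p \<and> cnum w p = k \<longrightarrow>
    (\<exists>q<length w. item w q \<and> cnum w q = l \<and> same_name w p q))"

text \<open>Clause 0 lists the universe, clause 1 the exempt set, and the clauses from 2 on list the
  members of the collection. The last two conditions state that no list has repetitions and that the
  members are distinct as sets.\<close>

definition is_instance :: "sym list \<Rightarrow> bool" where
  "is_instance w \<longleftrightarrow> well_formed w \<and> 2 \<le> clauses w \<and>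
    (\<forall>p<length w. item w p \<longrightarrow> \<not> negative w p) \<and>
    (\<forall>p<length w. \<forall>q<length w. item w p \<and> item w q \<and> cnum w p = cnum w q \<and> same_name w p q \<longrightarrow> p = q) \<and>
    (\<forall>k<clauses w. \<forall>l<k. 2 \<le> l \<longrightarrow> \<not> (clause_subset w k l \<and> clause_subset w l k))"

lemma set_names: "set (names w k) = name_at w ` {p. item w p \<and> cnum w p = k}"
  by (auto simp: names_def set_items)

lemma clause_subset_iff: "clause_subset w k l \<longleftrightarrow> set (names w k) \<subseteq> set (names w l)"
  unfolding clause_subset_def set_names same_name_def image_subset_iff image_iff
  by (simp, metis sym_at_less)

lemma length_names: "length (names w k) = clause_length w k"
  by (simp add: names_def length_clause_at[symmetric] clause_at_def)

lemma distinct_items: "distinct (items w)"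
  by (simp add: items_def)

lemma distinct_names_iff: "distinct (names w k) \<longleftrightarrow>
    (\<forall>p<length w. \<forall>q<length w. item w p \<and> item w q \<and> cnum w p = k \<and> cnum w q = k \<and> same_name w p q \<longrightarrow> p = q)"
  unfolding names_def distinct_map same_name_def using distinct_items
  by (auto simp: inj_on_def set_items dest: sym_at_less)

lemma cnum_mono: "p \<le> q \<Longrightarrow> cnum w p \<le> cnum w q"
  unfolding cnum_def by (intro sum_mono2) auto

lemma clause_at_names:
  assumes "\<forall>p<length w. item w p \<longrightarrow> \<not> negative w p"
  shows "clause_at w k = map Pos (names w k)"
  using assms by (auto simp: clause_at_def names_def lit_at_def set_items dest: sym_at_less)

lemma enc_cnf_clauses:
  assumes "well_formed w"
  shows "w = enc_cnf (map (clause_at w) [0..<clauses w])"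
proof -
  obtain \<phi> where "w = enc_cnf \<phi>" using assms well_formed_iff by blast
  then show ?thesis using clauses_enc_cnf[of \<phi>] by simp
qed

lemma cnum_item_less:
  assumes "well_formed w" and "item w p"
  shows "cnum w p < clauses w"
proof -
  have "w \<noteq> []" using assms(2) by (auto simp: sym_at_def)
  then have "sym_at w (length w - 1) SEnd"
    using assms(1) by (metis One_nat_def diff_Suc_1 length_0_conv well_formed_def)
  moreover have "p \<le> length w - 1" using sym_at_less[OF assms(2)] by simp
  moreover have "clauses w = cnum w (length w - 1) + of_bool (sym_at w (length w - 1) SEnd)"
    using \<open>w \<noteq> []\<close> by (cases "length w") (simp_all add: cnum_def)
  ultimately show ?thesis using cnum_mono[of p "length w - 1" w] by simp
qed

text \<open>An instance is encoded like a formula with positive literals only, one clause per list,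
  so the results on reading formulas apply to it.\<close>

lemma encodes_instance_enc_cnf:
  "encodes_instance w X R C \<longleftrightarrow>
    (\<exists>xs rs cs. distinct xs \<and> distinct rs \<and> (\<forall>as\<in>set cs. distinct as) \<and> distinct (map set cs) \<and>
      X = set xs \<and> R = set rs \<and> C = set ` set cs \<and> w = enc_cnf (map (map Pos) (xs # rs # cs)))"
  unfolding encodes_instance_def concat_enc_names[symmetric] by simp

lemma upt_two: "2 \<le> n \<Longrightarrow> [0..<n] = 0 # 1 # [2..<n]"
  by (simp add: upt_conv_Cons numeral_2_eq_2)

lemma distinct_sets_iff:
  "inj_on (\<lambda>k. set (names w k)) {2..<clauses w} \<longleftrightarrow>
    (\<forall>k<clauses w. \<forall>l<k. 2 \<le> l \<longrightarrow> \<not> (clause_subset w k l \<and> clause_subset w l k))"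
proof
  assume inj: "inj_on (\<lambda>k. set (names w k)) {2..<clauses w}"
  show "\<forall>k<clauses w. \<forall>l<k. 2 \<le> l \<longrightarrow> \<not> (clause_subset w k l \<and> clause_subset w l k)"
  proof (intro allI impI notI)
    fix k l assume "k < clauses w" "l < k" "2 \<le> l" "clause_subset w k l \<and> clause_subset w l k"
    then show False using inj_onD[OF inj, of k l] by (simp add: clause_subset_iff set_eq_subset)
  qed
next
  assume *: "\<forall>k<clauses w. \<forall>l<k. 2 \<le> l \<longrightarrow> \<not> (clause_subset w k l \<and> clause_subset w l k)"
  show "inj_on (\<lambda>k. set (names w k)) {2..<clauses w}"
  proof (rule linorder_inj_onI')
    fix l k assume "l \<in> {2..<clauses w}" "k \<in> {2..<clauses w}" "l < k"
    then show "set (names w l) \<noteq> set (names w k)"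
      using *[rule_format, of k l] by (auto simp: clause_subset_iff)
  qed
qed

lemma is_instance_encodes:
  assumes "is_instance w"
  shows "encodes_instance w (set (names w 0)) (set (names w 1)) ((\<lambda>k. set (names w k)) ` {2..<clauses w})"
  unfolding encodes_instance_enc_cnf
proof (intro exI conjI ballI)
  have dist: "distinct (names w k)" for k
    using assms unfolding is_instance_def distinct_names_iff by metis
  show "distinct (names w 0)" "distinct (names w 1)" by (rule dist)+
  show "distinct as" if "as \<in> set (map (names w) [2..<clauses w])" for as
    using that dist by auto
  show "distinct (map set (map (names w) [2..<clauses w]))"
    using assms unfolding is_instance_def distinct_sets_iff[symmetric] by (simp add: distinct_map comp_def)
  show "(\<lambda>k. set (names w k)) ` {2..<clauses w} = set ` set (map (names w) [2..<clauses w])"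
    by (simp add: image_image)
  have "w = enc_cnf (map (clause_at w) [0..<clauses w])"
    using assms by (intro enc_cnf_clauses) (simp add: is_instance_def)
  also have "map (clause_at w) [0..<clauses w] = map (map Pos) (names w 0 # names w 1 # map (names w) [2..<clauses w])"
    using assms by (simp add: is_instance_def upt_two clause_at_names)
  finally show "w = enc_cnf (map (map Pos) (names w 0 # names w 1 # map (names w) [2..<clauses w]))" .
qed simp_all

lemma encodes_is_instance:
  assumes "encodes_instance w X R C"
  shows "is_instance w"
proof -
  obtain xs rs cs where *: "distinct xs" "distinct rs" "\<forall>as\<in>set cs. distinct as" "distinct (map set cs)"
    "w = enc_cnf (map (map Pos) (xs # rs # cs))"
    using assms unfolding encodes_instance_enc_cnf by blast
  define L where "L = xs # rs # cs"
  have w: "w = enc_cnf (map (map Pos) L)" using * by (simp add: L_def)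
  have cl: "map (clause_at w) [0..<clauses w] = map (map Pos) L"
    unfolding w by (rule clauses_enc_cnf)
  then have len: "clauses w = length L" by (metis diff_zero length_map length_upt)
  have clk: "clause_at w k = map Pos (L ! k)" if "k < length L" for k
    using arg_cong[OF cl, of "\<lambda>xs. xs ! k"] that len by simp
  have "map (lit_at w) (items w) = concat (map (map Pos) L)"
    unfolding w by (rule items_enc_cnf)
  then have "set (map (lit_at w) (items w)) \<subseteq> range Pos" by auto
  then have "lit_at w p \<in> range Pos" if "item w p" for p
    using that by (auto simp: set_items)
  then have pos: "\<forall>p<length w. item w p \<longrightarrow> \<not> negative w p"
    by (fastforce simp: lit_at_def split: if_splits)
  have names: "names w k = L ! k" if "k < length L" for k
    using clk[OF that] clause_at_names[OF pos, of k] by (simp add: inj_map_eq_map inj_def)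
  have "distinct (names w k)" if "k < length L" for k
  proof -
    have "L ! k \<in> set L" using that by simp
    then show ?thesis using * names[OF that] by (auto simp: L_def)
  qed
  \<comment> \<open>Past the last list there are no items, so distinctness holds for every
    k.\<close>
  moreover have "names w k = []" if "\<not> k < length L" for k
  proof -
    have "cnum w p < length L" if "item w p" for p
      using cnum_item_less[OF _ that] w well_formed_iff len by auto
    then show ?thesis using that by (auto simp: names_def filter_empty_conv set_items)
  qed
  ultimately have "distinct (names w k)" for k by (metis distinct.simps(1))
  then have dist: "\<forall>p<length w. \<forall>q<length w. item w p \<and> item w q \<and> cnum w p = cnum w q \<and> same_name w p q \<longrightarrow> p = q"
    unfolding distinct_names_iff by metis
  have "inj_on (\<lambda>k. set (names w k)) {2..<clauses w}"
  proof (rule inj_onI)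
    fix k l assume kl: "k \<in> {2..<clauses w}" "l \<in> {2..<clauses w}" "set (names w k) = set (names w l)"
    \<comment> \<open>The collection starts at clause 2, hence the shift.\<close>
    then have "map set cs ! (k - 2) = map set cs ! (l - 2)"
      using names[of k] names[of l] by (auto simp: len L_def nth_Cons' numeral_2_eq_2)
    moreover have "k - 2 < length (map set cs)" "l - 2 < length (map set cs)"
      using kl by (auto simp: len L_def)
    ultimately have "k - 2 = l - 2" using nth_eq_iff_index_eq[OF *(4)] by blast
    then show "k = l" using kl by auto
  qed
  then show ?thesis
    unfolding is_instance_def distinct_sets_iff[symmetric] using pos dist w len well_formed_iff
    by (auto simp: L_def)
qed


section \<open>Valid cover instances in terms of positions\<close>

abbreviation citem :: "sym list \<Rightarrow> nat \<Rightarrow> bool" where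
  "citem w p \<equiv> item w p \<and> 2 \<le> cnum w p"

definition valid_cover :: "nat \<Rightarrow> sym list \<Rightarrow> bool" where
  "valid_cover c w \<longleftrightarrow> is_instance w \<and>
    (\<forall>p<length w. item w p \<and> cnum w p = 0 \<longrightarrow> name_length w p \<le> c * floorlog 2 (clause_length w 0)) \<and>
    (\<forall>k<clauses w. 0 < k \<longrightarrow> clause_subset w k 0) \<and>
    (\<forall>k<clauses w. 2 \<le> k \<longrightarrow> clause_length w k \<le> 3) \<and>
    (\<forall>p<length w. item w p \<and> cnum w p = 0 \<longrightarrow>
      (\<Sum>q<length w. of_bool (citem w q \<and> same_name w p q)) \<le> (2::nat))"

abbreviation sets :: "sym list \<Rightarrow> name set set" where
  "sets w \<equiv> (\<lambda>k. set (names w k)) ` {2..<clauses w}"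

lemma is_instanceD:
  assumes "is_instance w"
  shows "well_formed w" and "\<And>k. distinct (names w k)"
    and "inj_on (\<lambda>k. set (names w k)) {2..<clauses w}"
    and "\<And>p q. item w p \<Longrightarrow> item w q \<Longrightarrow> cnum w p = cnum w q \<Longrightarrow> name_at w p = name_at w q \<Longrightarrow> p = q"
proof -
  show "well_formed w" "inj_on (\<lambda>k. set (names w k)) {2..<clauses w}"
    using assms unfolding is_instance_def distinct_sets_iff[symmetric] by auto
  show "distinct (names w k)" for k
    using assms unfolding is_instance_def distinct_names_iff by metis
  show "p = q" if "item w p" "item w q" "cnum w p = cnum w q" "name_at w p = name_at w q" for p q
    using assms that sym_at_less unfolding is_instance_def same_name_def by metis
qed

lemma card_names: "is_instance w \<Longrightarrow> card (set (names w k)) = clause_length w k"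
  by (simp add: distinct_card is_instanceD(2) length_names)

text \<open>The members are distinct as sets and none lists a name twice, so occurrences of u in the
  collection correspond one to one to members containing u.\<close>

lemma overlapping_cost_sets:
  assumes "is_instance w"
  shows "overlapping_cost (sets w) u = card {q. citem w q \<and> name_at w q = u}"
proof -
  let ?Q = "{q. citem w q \<and> name_at w q = u}"
  have "{A \<in> sets w. u \<in> A} = (\<lambda>q. set (names w (cnum w q))) ` ?Q"
    using cnum_item_less[OF is_instanceD(1)[OF assms]] by (auto simp: set_names)
  moreover have "inj_on (\<lambda>q. set (names w (cnum w q))) ?Q"
  proof (rule inj_onI)
    fix q r assume q: "q \<in> ?Q" and r: "r \<in> ?Q" and eq: "set (names w (cnum w q)) = set (names w (cnum w r))"
    have "cnum w q \<in> {2..<clauses w}" "cnum w r \<in> {2..<clauses w}"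
      using q r cnum_item_less[OF is_instanceD(1)[OF assms]] by auto
    then have "cnum w q = cnum w r" using inj_onD[OF is_instanceD(3)[OF assms] eq] by blast
    then show "q = r" using is_instanceD(4)[OF assms, of q r] q r by simp
  qed
  ultimately show ?thesis unfolding overlapping_cost_def by (simp add: card_image)
qed

text \<open>Unique readability removes the quantifiers over X, R and C.\<close>

lemma XCE3_2_encodes:
  assumes enc: "encodes_instance w X R C"
  shows "w \<in> XCE3_2 c \<longleftrightarrow> (\<forall>u\<in>X. length u \<le> c * floorlog 2 (card X)) \<and>
    (R \<subseteq> X \<and> (\<forall>A\<in>C. A \<subseteq> X)) \<and> (\<forall>A\<in>C. card A \<le> 3) \<and>
    (\<forall>u\<in>X. overlapping_cost C u \<le> 2) \<and> (\<exists>D\<subseteq>C. exact_cover_exempt X R D)"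
proof -
  have "encodes_instance w X' R' C' \<longleftrightarrow> X' = X \<and> R' = R \<and> C' = C" for X' R' C'
    using encodes_instance_unique[OF enc] enc by blast
  then show ?thesis unfolding XCE3_2_def by auto
qed

lemma XCE3_2_iff:
  "w \<in> XCE3_2 c \<longleftrightarrow> valid_cover c w \<and>
    (\<exists>D\<subseteq>sets w. exact_cover_exempt (set (names w 0)) (set (names w 1)) D)"
proof (cases "is_instance w")
  case False
  then show ?thesis by (auto simp: XCE3_2_def valid_cover_def dest: encodes_is_instance)
next
  case True
  let ?X = "set (names w 0)" and ?R = "set (names w 1)"
  note enc = is_instance_encodes[OF True]
  have eq1: "(\<forall>u\<in>?X. length u \<le> c * floorlog 2 (card ?X)) \<longleftrightarrow>
      (\<forall>p<length w. item w p \<and> cnum w p = 0 \<longrightarrow> name_length w p \<le> c * floorlog 2 (clause_length w 0))"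
  proof -
    have *: "(\<forall>u\<in>?X. P u) \<longleftrightarrow> (\<forall>p<length w. item w p \<and> cnum w p = 0 \<longrightarrow> P (name_at w p))" for P
      unfolding set_names by (auto dest: sym_at_less)
    show ?thesis unfolding card_names[OF True] name_length_def by (rule *)
  qed
  have eq2: "(?R \<subseteq> ?X \<and> (\<forall>A\<in>sets w. A \<subseteq> ?X)) \<longleftrightarrow> (\<forall>k<clauses w. 0 < k \<longrightarrow> clause_subset w k 0)"
  proof -
    have "2 \<le> clauses w" using True by (simp add: is_instance_def)
    have *: "(\<forall>k<clauses w. 0 < k \<longrightarrow> P k) \<longleftrightarrow> P 1 \<and> (\<forall>k\<in>{2..<clauses w}. P k)" for P
    proof (intro iffI allI impI)
      assume "\<forall>k<clauses w. 0 < k \<longrightarrow> P k"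
      then show "P 1 \<and> (\<forall>k\<in>{2..<clauses w}. P k)" using \<open>2 \<le> clauses w\<close> by auto
    next
      fix k assume "P 1 \<and> (\<forall>k\<in>{2..<clauses w}. P k)" "k < clauses w" "0 < k"
      then show "P k" by (cases "k = 1") auto
    qed
    show ?thesis unfolding * ball_simps clause_subset_iff by (rule refl)
  qed
  have eq3: "(\<forall>A\<in>sets w. card A \<le> 3) \<longleftrightarrow> (\<forall>k<clauses w. 2 \<le> k \<longrightarrow> clause_length w k \<le> 3)"
    by (auto simp: card_names[OF True])
  have eq4: "(\<forall>u\<in>?X. overlapping_cost (sets w) u \<le> 2) \<longleftrightarrow>
      (\<forall>p<length w. item w p \<and> cnum w p = 0 \<longrightarrow>
        (\<Sum>q<length w. of_bool (citem w q \<and> same_name w p q)) \<le> (2::nat))"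
  proof -
    have "(\<Sum>q<length w. of_bool (citem w q \<and> same_name w p q)) =
        overlapping_cost (sets w) (name_at w p)" for p
      unfolding overlapping_cost_sets[OF True] sum_of_bool_card same_name_def
      by (intro arg_cong[where f = card]) (auto dest: sym_at_less)
    then show ?thesis unfolding set_names by (auto dest: sym_at_less)
  qed
  show ?thesis
    unfolding XCE3_2_encodes[OF enc, of c] valid_cover_def eq1 eq2 eq3 eq4
    by (simp only: True simp_thms conj_assoc)
qed

section \<open>The formula of a cover instance and its correctness\<close>

definition unary :: "nat \<Rightarrow> name" where
  "unary n = replicate n True"

lemma unary_inject [simp]: "unary m = unary n \<longleftrightarrow> m = n"
  by (auto simp: unary_def dest: arg_cong[where f = length])

text \<open>The lengths of variable names are not restricted, and unary names are printed by a plain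
  loop. Even and odd lengths keep the two kinds of variables apart.\<close>

definition xvar :: "nat \<Rightarrow> name" where "xvar p = unary (p + p)"
definition yvar :: "nat \<Rightarrow> name" where "yvar p = unary (Suc (p + p))"

lemma xvar_yvar [simp]:
  "xvar p = xvar q \<longleftrightarrow> p = q" "yvar p = yvar q \<longleftrightarrow> p = q" "xvar p \<noteq> yvar q" "yvar p \<noteq> xvar q"
  by (simp_all add: xvar_def yvar_def) presburger+

definition adjacent :: "sym list \<Rightarrow> nat \<Rightarrow> nat \<Rightarrow> bool" where
  "adjacent w p q \<longleftrightarrow> citem w p \<and> citem w q \<and> p < q \<and> cnum w p = cnum w q \<and>
    \<not> (\<exists>r<q. p < r \<and> item w r)"

definition last_item :: "sym list \<Rightarrow> nat \<Rightarrow> bool" where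
  "last_item w p \<longleftrightarrow> citem w p \<and> \<not> (\<exists>q<length w. adjacent w p q)"

definition twins :: "sym list \<Rightarrow> nat \<Rightarrow> nat \<Rightarrow> bool" where
  "twins w p q \<longleftrightarrow> citem w p \<and> citem w q \<and> p < q \<and> same_name w p q"

definition compulsory :: "sym list \<Rightarrow> nat \<Rightarrow> bool" where
  "compulsory w u \<longleftrightarrow> item w u \<and> cnum w u = 0 \<and> \<not> (\<exists>r<length w. item w r \<and> cnum w r = 1 \<and> same_name w u r)"

definition links :: "sym list \<Rightarrow> cnf" where
  "links w = concat (map (\<lambda>p. concat (map (\<lambda>q. if adjacent w p q
    then [[Neg (xvar p), Pos (xvar q)], [Neg (yvar q), Pos (yvar p)]] else []) [0..<length w])) [0..<length w])"

definition turns :: "sym list \<Rightarrow> cnf" where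
  "turns w = concat (map (\<lambda>p. if last_item w p then [[Neg (xvar p), Pos (yvar p)]] else []) [0..<length w])"

definition exclusions :: "sym list \<Rightarrow> cnf" where
  "exclusions w = concat (map (\<lambda>p. concat (map (\<lambda>q. if twins w p q
    then [[Neg (yvar p), Neg (yvar q)]] else []) [0..<length w])) [0..<length w])"

text \<open>A compulsory element that lies in no set yields the empty clause and makes the formula
  unsatisfiable, as it should.\<close>

definition coverings :: "sym list \<Rightarrow> cnf" where
  "coverings w = concat (map (\<lambda>u. if compulsory w u
    then [concat (map (\<lambda>q. if citem w q \<and> same_name w u q then [Pos (xvar q)] else []) [0..<length w])]
    else []) [0..<length w])"

text \<open>
  An item p of the collection stands for an occurrence of an element in a set A. Its variables
  \<open>xvar p\<close> and \<open>yvar p\<close> both say that A is chosen. As the former only occurs positively and the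
  latter only negatively outside the links, it suffices that every \<open>xvar\<close> of A implies every
  \<open>yvar\<close> of A. The links are a path through the former and back through the latter.
\<close>

definition cover_formula :: "sym list \<Rightarrow> cnf" where
  "cover_formula w = links w @ turns w @ exclusions w @ coverings w"

lemma set_concat_if: "set (concat (map (\<lambda>p. if P p then [g p] else []) [0..<n])) = g ` {p. p < n \<and> P p}"
  by auto

lemma set_links: "set (links w) = (\<Union>(p, q)\<in>{(p, q). adjacent w p q}.
    {[Neg (xvar p), Pos (xvar q)], [Neg (yvar q), Pos (yvar p)]})"
  unfolding links_def by (auto simp: adjacent_def dest: sym_at_less)

lemma set_turns: "set (turns w) = (\<lambda>p. [Neg (xvar p), Pos (yvar p)]) ` {p. last_item w p}"
  unfolding turns_def set_concat_if by (intro arg_cong2[where f = image]) (auto simp: last_item_def dest: sym_at_less)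

lemma set_exclusions: "set (exclusions w) = (\<lambda>(p, q). [Neg (yvar p), Neg (yvar q)]) ` {(p, q). twins w p q}"
  unfolding exclusions_def by (auto simp: twins_def dest: sym_at_less)

lemma set_coverings: "set (coverings w) = (\<lambda>u. concat (map (\<lambda>q. if citem w q \<and> same_name w u q
    then [Pos (xvar q)] else []) [0..<length w])) ` {u. compulsory w u}"
  unfolding coverings_def set_concat_if
  by (intro arg_cong2[where f = image]) (auto simp: compulsory_def dest: sym_at_less)

locale cover =
  fixes c :: nat and w :: "sym list"
  assumes valid: "valid_cover c w"
begin

lemma inst: "is_instance w"
  using valid by (simp add: valid_cover_def)

lemma cnum_less: "item w p \<Longrightarrow> cnum w p < clauses w"
  using cnum_item_less[OF is_instanceD(1)[OF inst]] .

lemma item_unique: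
  "item w p \<Longrightarrow> item w q \<Longrightarrow> cnum w p = cnum w q \<Longrightarrow> same_name w p q \<Longrightarrow> p = q"
  using is_instanceD(4)[OF inst] by (simp add: same_name_def)

lemma ex_universe: "item w p \<Longrightarrow> 0 < cnum w p \<Longrightarrow> \<exists>q. item w q \<and> cnum w q = 0 \<and> same_name w p q"
proof -
  assume p: "item w p" "0 < cnum w p"
  then have "clause_subset w (cnum w p) 0" using valid cnum_less[OF p(1)] unfolding valid_cover_def by blast
  then show ?thesis using p sym_at_less[OF p(1)] unfolding clause_subset_def by blast
qed

lemma card_citems:
  assumes "item w u" and "cnum w u = 0"
  shows "card {q. citem w q \<and> same_name w u q} \<le> 2"
proof -
  have "{q. q < length w \<and> citem w q \<and> same_name w u q} = {q. citem w q \<and> same_name w u q}"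
    by (auto dest: sym_at_less)
  moreover have "(\<Sum>q<length w. of_bool (citem w q \<and> same_name w u q)) \<le> (2::nat)"
    using valid assms sym_at_less[OF assms(1)] unfolding valid_cover_def by blast
  ultimately show ?thesis unfolding sum_of_bool_card by simp
qed

text \<open>The overlap bound is stated for the universe, so p, q and r are traced to the entry of
  the universe with their name, which would then have three occurrences in the collection.\<close>

lemma twin_unique:
  assumes "citem w p" "citem w q" "citem w r" "same_name w p q" "same_name w p r" "q \<noteq> p" "r \<noteq> p"
  shows "q = r"
proof (rule ccontr)
  assume "q \<noteq> r"
  obtain u where u: "item w u" "cnum w u = 0" "same_name w p u" using ex_universe[of p] assms by auto
  have "{p, q, r} \<subseteq> {q. citem w q \<and> same_name w u q}" using assms u by (auto simp: same_name_def)
  then have "card {p, q, r} \<le> card {q. citem w q \<and> same_name w u q}"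
    using finite_items by (intro card_mono) (simp_all add: conj_assoc)
  moreover have "card {p, q, r} = 3" using assms \<open>q \<noteq> r\<close> by auto
  ultimately show False using card_citems[OF u(1,2)] by simp
qed

lemma predecessor:
  assumes "citem w p" "citem w q" "p < q" "cnum w p = cnum w q"
  shows "\<exists>r. adjacent w r q \<and> p \<le> r"
proof -
  let ?S = "{r. item w r \<and> r < q}"
  define r where "r = Max ?S"
  have "finite ?S" by (rule finite_items)
  moreover have "p \<in> ?S" using assms by simp
  ultimately have "r \<in> ?S" and le: "\<And>s. s \<in> ?S \<Longrightarrow> s \<le> r"
    unfolding r_def using Max_in[of ?S] Max_ge[of ?S] by blast+
  then have r: "item w r" "r < q" "p \<le> r" "\<And>s. item w s \<Longrightarrow> s < q \<Longrightarrow> s \<le> r"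
    using \<open>p \<in> ?S\<close> by auto
  \<comment> \<open>\<open>cnum\<close> is monotone and r lies between p and q, two items of the
    same set.\<close>
  have "cnum w r = cnum w q"
    using cnum_mono[of p r w] cnum_mono[of r q w] r(2,3) assms(4) by auto
  moreover have "\<not> (\<exists>s<q. r < s \<and> item w s)" using r(4) by (meson not_less)
  ultimately have "adjacent w r q" using assms r(1,2) unfolding adjacent_def by auto
  then show ?thesis using r(3) by blast
qed

lemma adjacent_right_unique: "adjacent w p q \<Longrightarrow> adjacent w p r \<Longrightarrow> q = r"
  unfolding adjacent_def by (metis linorder_neqE_nat)

lemma adjacent_left_unique: "adjacent w p q \<Longrightarrow> adjacent w r q \<Longrightarrow> p = r"
  unfolding adjacent_def by (metis linorder_neqE_nat)

lemma ex_last_item: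
  assumes "citem w p"
  shows "\<exists>m. last_item w m \<and> cnum w m = cnum w p \<and> (\<forall>q. item w q \<and> cnum w q = cnum w p \<longrightarrow> q \<le> m)"
proof -
  let ?S = "{r. item w r \<and> cnum w r = cnum w p}"
  define m where "m = Max ?S"
  have "finite ?S" by (rule finite_items)
  moreover have "p \<in> ?S" using assms by simp
  ultimately have m: "m \<in> ?S" "\<And>s. s \<in> ?S \<Longrightarrow> s \<le> m"
    unfolding m_def using Max_in[of ?S] by auto
  have "\<not> adjacent w m q" for q using m(1) m(2)[of q] by (auto simp: adjacent_def)
  then show ?thesis using m assms unfolding last_item_def by (intro exI[of _ m]) auto
qed

text \<open>From \<open>xvar p\<close> the links lead up to \<open>xvar m\<close> for the last item
  m of the set, the turn crosses to \<open>yvar m\<close>, and the other links lead down to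
  \<open>yvar q\<close>. Both p and q are compared with m, so their order is irrelevant.\<close>

lemma formula_chain:
  assumes "\<And>cl. cl \<in> set (links w) \<union> set (turns w) \<Longrightarrow> \<exists>l\<in>set cl. lit_true \<alpha> l"
    and "citem w p" "citem w q" "cnum w p = cnum w q" "\<alpha> (xvar p)"
  shows "\<alpha> (yvar q)"
proof -
  have link: "(\<alpha> (xvar p) \<longrightarrow> \<alpha> (xvar q)) \<and> (\<alpha> (yvar q) \<longrightarrow> \<alpha> (yvar p))" if "adjacent w p q" for p q
    using that assms(1)[of "[Neg (xvar p), Pos (xvar q)]"] assms(1)[of "[Neg (yvar q), Pos (yvar p)]"]
    unfolding set_links by auto
  have turn: "\<alpha> (xvar p) \<longrightarrow> \<alpha> (yvar p)" if "last_item w p" for p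
    using that assms(1)[of "[Neg (xvar p), Pos (yvar p)]"] unfolding set_turns by auto
  have path: "(\<alpha> (xvar p) \<longrightarrow> \<alpha> (xvar q)) \<and> (\<alpha> (yvar q) \<longrightarrow> \<alpha> (yvar p))"
    if "citem w p" "citem w q" "p \<le> q" "cnum w p = cnum w q" for p q
    using that
  proof (induction q rule: less_induct)
    case (less q)
    show ?case
    proof (cases "p = q")
      case False
      then obtain r where r: "adjacent w r q" "p \<le> r" using predecessor[of p q] less.prems by auto
      then have "r < q" "citem w r" "cnum w p = cnum w r" using less.prems by (auto simp: adjacent_def)
      from less.IH[OF this(1) less.prems(1) this(2) r(2) this(3)] link[OF r(1)] show ?thesis by blast
    qed simp
  qed
  obtain m where m: "last_item w m" "cnum w m = cnum w p" "\<forall>q. item w q \<and> cnum w q = cnum w p \<longrightarrow> q \<le> m"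
    using ex_last_item[OF assms(2)] by blast
  have cm: "citem w m" using m(1) by (simp add: last_item_def)
  have "p \<le> m" "q \<le> m" using m(3) assms(2-4) by auto
  then show ?thesis
    using path[OF assms(2) cm] path[OF assms(3) cm] turn[OF m(1)] m(2) assms(4,5) by simp
qed

lemma finite_sets: "D \<subseteq> sets w \<Longrightarrow> finite D"
  by (erule finite_subset) (intro finite_imageI finite_atLeastLessThan)

lemma card_le_1_iff: "D \<subseteq> sets w \<Longrightarrow> card {A \<in> D. u \<in> A} \<le> 1 \<longleftrightarrow>
    (\<forall>A\<in>D. \<forall>B\<in>D. u \<in> A \<and> u \<in> B \<longrightarrow> A = B)"
  using card_le_Suc0_iff_eq[of "{A \<in> D. u \<in> A}"] finite_sets[of D] by auto

lemma satisfiable_imp_cover: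
  assumes "satisfiable (cover_formula w)"
  shows "\<exists>D\<subseteq>sets w. exact_cover_exempt (set (names w 0)) (set (names w 1)) D"
proof -
  obtain \<alpha> where \<alpha>: "\<And>cl. cl \<in> set (cover_formula w) \<Longrightarrow> \<exists>l\<in>set cl. lit_true \<alpha> l"
    using assms unfolding satisfiable_def by blast
  have chain: "\<alpha> (yvar q)" if "citem w p" "citem w q" "cnum w p = cnum w q" "\<alpha> (xvar p)" for p q
    using formula_chain[OF \<alpha> that] by (auto simp: cover_formula_def)
  \<comment> \<open>A set is taken as soon as one of its \<open>xvar\<close> is true. Then all its
    \<open>yvar\<close> are true, so the exclusions rule out a second set with a common element,
    while a covering provides some true \<open>xvar\<close>.\<close>
  define D where "D = (\<lambda>p. set (names w (cnum w p))) ` {p. citem w p \<and> \<alpha> (xvar p)}"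
  have D: "D \<subseteq> sets w" using cnum_less by (auto simp: D_def)
  have excl: "\<not> \<alpha> (yvar p) \<or> \<not> \<alpha> (yvar q)" if "citem w p" "citem w q" "p \<noteq> q" "same_name w p q" for p q
  proof -
    have "twins w p q \<or> twins w q p" using that by (auto simp: twins_def same_name_def)
    then have "[Neg (yvar p), Neg (yvar q)] \<in> set (cover_formula w) \<or>
        [Neg (yvar q), Neg (yvar p)] \<in> set (cover_formula w)"
      unfolding cover_formula_def by (auto simp: set_exclusions)
    then show ?thesis using \<alpha> by fastforce
  qed
  have le: "card {A \<in> D. u \<in> A} \<le> 1" for u
    unfolding card_le_1_iff[OF D]
  proof (intro ballI impI)
    fix A B assume AB: "A \<in> D" "B \<in> D" "u \<in> A \<and> u \<in> B"
    then obtain p q where p: "citem w p" "\<alpha> (xvar p)" "A = set (names w (cnum w p))"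
      and q: "citem w q" "\<alpha> (xvar q)" "B = set (names w (cnum w q))" unfolding D_def by auto
    with AB obtain p' q' where p': "item w p'" "cnum w p' = cnum w p" "name_at w p' = u"
      and q': "item w q'" "cnum w q' = cnum w q" "name_at w q' = u" by (auto simp: set_names)
    have c: "citem w p'" "citem w q'" using p(1) q(1) p'(1,2) q'(1,2) by simp_all
    have "\<alpha> (yvar p')" by (rule chain[OF p(1) c(1) p'(2)[symmetric] p(2)])
    moreover have "\<alpha> (yvar q')" by (rule chain[OF q(1) c(2) q'(2)[symmetric] q(2)])
    ultimately have "p' = q'" using excl[OF c] p'(3) q'(3) by (auto simp: same_name_def)
    then show "A = B" using p q p' q' by simp
  qed
  have ge: "{A \<in> D. u \<in> A} \<noteq> {}" if u: "u \<in> set (names w 0) - set (names w 1)" for u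
  proof -
    obtain p where p: "item w p" "cnum w p = 0" "name_at w p = u" using u by (auto simp: set_names)
    then have "compulsory w p" using u by (force simp: compulsory_def set_names same_name_def)
    then have "\<exists>l\<in>set (concat (map (\<lambda>q. if citem w q \<and> same_name w p q
        then [Pos (xvar q)] else []) [0..<length w])). lit_true \<alpha> l"
      by (intro \<alpha>) (auto simp: cover_formula_def set_coverings)
    then obtain q where "citem w q" "same_name w p q" "\<alpha> (xvar q)" by (auto split: if_splits)
    then show ?thesis using p by (auto simp: D_def set_names same_name_def)
  qed
  have "card {A \<in> D. u \<in> A} = 1" if "u \<in> set (names w 0) - set (names w 1)" for u
  proof -
    have "finite {A \<in> D. u \<in> A}" using finite_sets[OF D] by simp
    then have "0 < card {A \<in> D. u \<in> A}" using ge[OF that] by (simp only: card_gt_0_iff) blast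
    then show ?thesis using le[of u] by linarith
  qed
  then show ?thesis using D le unfolding exact_cover_exempt_def by blast
qed

lemma cover_imp_satisfiable:
  assumes D: "D \<subseteq> sets w" and cover: "exact_cover_exempt (set (names w 0)) (set (names w 1)) D"
  shows "satisfiable (cover_formula w)"
proof -
  \<comment> \<open>All variables of a set get the same value, so links and turns hold
    outright.\<close>
  define \<alpha> where "\<alpha> = (\<lambda>v. \<exists>p. citem w p \<and> set (names w (cnum w p)) \<in> D \<and> (v = xvar p \<or> v = yvar p))"
  have x: "\<alpha> (xvar p) \<longleftrightarrow> set (names w (cnum w p)) \<in> D" if "citem w p" for p
    using that by (auto simp: \<alpha>_def)
  have y: "\<alpha> (yvar p) \<longleftrightarrow> set (names w (cnum w p)) \<in> D" if "citem w p" for p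
    using that by (auto simp: \<alpha>_def)
  have name: "name_at w p \<in> set (names w (cnum w p))" if "item w p" for p
    using that by (auto simp: set_names)
  have eq: "\<alpha> (xvar p) \<longleftrightarrow> \<alpha> (xvar q)" "\<alpha> (yvar p) \<longleftrightarrow> \<alpha> (yvar q)" if "adjacent w p q" for p q
    using that x[of p] x[of q] y[of p] y[of q] by (auto simp: adjacent_def)
  have "\<exists>l\<in>set cl. lit_true \<alpha> l" if "cl \<in> set (cover_formula w)" for cl
  proof -
    from that consider "cl \<in> set (links w)" | "cl \<in> set (turns w)" | "cl \<in> set (exclusions w)" | "cl \<in> set (coverings w)"
      by (auto simp: cover_formula_def)
    then show ?thesis
    proof cases
      case 1
      then show ?thesis using eq by (auto simp: set_links)
    next
      case 2
      then show ?thesis using x y by (auto simp: set_turns last_item_def)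
    next
      case 3
      then obtain p q where pq: "twins w p q" "cl = [Neg (yvar p), Neg (yvar q)]" by (auto simp: set_exclusions)
      then have pq': "citem w p" "citem w q" "p \<noteq> q" "same_name w p q" by (auto simp: twins_def)
      have "\<not> (set (names w (cnum w p)) \<in> D \<and> set (names w (cnum w q)) \<in> D)"
      proof
        assume in_D: "set (names w (cnum w p)) \<in> D \<and> set (names w (cnum w q)) \<in> D"
        obtain u where "item w u" "cnum w u = 0" "same_name w p u" using ex_universe[of p] pq' by auto
        then have "name_at w p \<in> set (names w 0)" by (auto simp: set_names same_name_def)
        then have "card {A \<in> D. name_at w p \<in> A} \<le> 1"
          using cover unfolding exact_cover_exempt_def by (metis DiffI order_refl)
        then have "set (names w (cnum w p)) = set (names w (cnum w q))"
          using in_D name[of p] name[of q] pq' unfolding card_le_1_iff[OF D] by (auto simp: same_name_def)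
        then have "cnum w p = cnum w q"
          using inj_onD[OF is_instanceD(3)[OF inst]] pq' cnum_less by auto
        then show False using item_unique pq' by blast
      qed
      then show ?thesis using pq y pq' by auto
    next
      case 4
      then obtain u where u: "compulsory w u" "cl = concat (map (\<lambda>q. if citem w q \<and> same_name w u q
        then [Pos (xvar q)] else []) [0..<length w])" by (auto simp: set_coverings)
      have "name_at w u \<in> set (names w 0) - set (names w 1)"
        using u(1) by (auto simp: compulsory_def set_names same_name_def dest: sym_at_less)
      then have "card {A \<in> D. name_at w u \<in> A} = 1" using cover unfolding exact_cover_exempt_def by blast
      then have "{A \<in> D. name_at w u \<in> A} \<noteq> {}" by force
      then obtain A where A: "A \<in> D" "name_at w u \<in> A" by blast
      then obtain k where k: "A = set (names w k)" "2 \<le> k" using D by auto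
      then obtain q where "item w q" "cnum w q = k" "name_at w q = name_at w u" using A by (auto simp: set_names)
      then have q: "citem w q" "same_name w u q" "\<alpha> (xvar q)" using x[of q] k A by (auto simp: same_name_def)
      then have "Pos (xvar q) \<in> set cl" using u(2) by (auto dest: sym_at_less)
      then show ?thesis using q(3) by force
    qed
  qed
  then show ?thesis unfolding satisfiable_def by blast
qed

end

section \<open>Occurrences and number of variables in the formula\<close>

lemma occurrences_append: "occurrences (\<phi> @ \<psi>) v = occurrences \<phi> v + occurrences \<psi> v"
  by (simp add: occurrences_def)

lemma occurrences_Cons: "occurrences (cl # \<phi>) v = count_list (map var cl) v + occurrences \<phi> v"
  by (simp add: occurrences_def)

lemma occurrences_Nil [simp]: "occurrences [] v = 0"
  by (simp add: occurrences_def)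

lemma occurrences_concat: "occurrences (concat (map f [0..<n])) v = (\<Sum>i<n. occurrences (f i) v)"
  by (induction n) (simp_all add: occurrences_append)

lemma count_list_concat: "count_list (map var (concat (map f [0..<n]))) v = (\<Sum>i<n. count_list (map var (f i)) v)"
  by (induction n) simp_all

lemma sum_of_bool_le_1:
  fixes n :: nat
  assumes "\<And>p q. P p \<Longrightarrow> P q \<Longrightarrow> p = q"
  shows "(\<Sum>p<n. of_bool (P p)) \<le> (1::nat)"
proof -
  have "finite {p. p < n \<and> P p}" by simp
  then have "card {p. p < n \<and> P p} \<le> Suc 0" using assms by (subst card_le_Suc0_iff_eq) auto
  then show ?thesis by (simp only: sum_of_bool_card One_nat_def)
qed

lemma sum_pair_le:
  fixes n k :: nat
  shows "(\<Sum>p<n. \<Sum>q<n. of_bool (P p q \<and> p = k)) \<le> ((\<Sum>q<n. of_bool (P k q)) :: nat)"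
    and "(\<Sum>p<n. \<Sum>q<n. of_bool (P p q \<and> q = k)) \<le> ((\<Sum>p<n. of_bool (P p k)) :: nat)"
proof -
  have 1: "(\<Sum>q<n. of_bool (P p q \<and> p = k)) = (if p = k then \<Sum>q<n. of_bool (P k q) else (0::nat))" for p
    by auto
  show "(\<Sum>p<n. \<Sum>q<n. of_bool (P p q \<and> p = k)) \<le> ((\<Sum>q<n. of_bool (P k q)) :: nat)"
    unfolding 1 by (simp add: sum.delta)
  have 2: "(\<Sum>q<n. of_bool (P p q \<and> q = k)) = (if k < n then of_bool (P p k) else (0::nat))" for p
  proof -
    have "of_bool (P p q \<and> q = k) = (if q = k then of_bool (P p k) else (0::nat))" for q by simp
    then show ?thesis by (simp add: sum.delta)
  qed
  show "(\<Sum>p<n. \<Sum>q<n. of_bool (P p q \<and> q = k)) \<le> ((\<Sum>p<n. of_bool (P p k)) :: nat)"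
    unfolding 2 by (cases "k < n") simp_all
qed

text \<open>Serves links and exclusions alike. Only an inequality, as k need not be below n.\<close>

lemma occurrences_pairs:
  assumes "\<And>p q. occurrences (f p q) v = of_bool (p = k) + of_bool (q = k)"
  shows "occurrences (concat (map (\<lambda>p. concat (map (\<lambda>q. if P p q then f p q else []) [0..<n])) [0..<n])) v
    \<le> (\<Sum>q<n. of_bool (P k q)) + (\<Sum>p<n. of_bool (P p k))"
proof -
  have "occurrences (if P p q then f p q else []) v = of_bool (P p q \<and> p = k) + of_bool (P p q \<and> q = k)" for p q
    using assms by simp
  then show ?thesis
    using add_mono[OF sum_pair_le(1)[of P k n] sum_pair_le(2)[of P k n]]
    by (simp add: occurrences_concat sum.distrib)
qed

context cover
begin

lemma is_2cnf_cover_formula: "is_2cnf (cover_formula w)"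
  unfolding is_2cnf_def
proof
  fix cl assume "cl \<in> set (cover_formula w)"
  then consider "cl \<in> set (links w) \<union> set (turns w) \<union> set (exclusions w)" | "cl \<in> set (coverings w)"
    by (auto simp: cover_formula_def)
  then show "length cl \<le> 2"
  proof cases
    case 1
    then show ?thesis by (auto simp: set_links set_turns set_exclusions)
  next
    case 2
    then obtain u where u: "compulsory w u" "cl = concat (map (\<lambda>q. if citem w q \<and> same_name w u q
        then [Pos (xvar q)] else []) [0..<length w])" by (auto simp: set_coverings)
    have "length (concat (map (\<lambda>q. if P q then [f q] else []) [0..<n])) = (\<Sum>q<n. of_bool (P q))"
      for P and f :: "nat \<Rightarrow> literal" and n by (induction n) auto
    then have "length cl = card {q. q < length w \<and> citem w q \<and> same_name w u q}"
      unfolding u(2) sum_of_bool_card .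
    also have "\<dots> \<le> card {q. citem w q \<and> same_name w u q}"
      using finite_items by (intro card_mono) (auto simp: conj_assoc)
    finally show ?thesis using card_citems[of u] u(1) by (simp add: compulsory_def)
  qed
qed

lemma adjacent_sums:
  "(\<Sum>q<length w. of_bool (adjacent w k q)) + of_bool (last_item w k) \<le> (1::nat)"
  "(\<Sum>p<length w. of_bool (adjacent w p k)) \<le> (1::nat)"
proof -
  have "(\<Sum>q<length w. of_bool (adjacent w k q)) \<le> (1::nat)"
    by (rule sum_of_bool_le_1) (rule adjacent_right_unique)
  moreover have "(\<Sum>q<length w. of_bool (adjacent w k q)) = (0::nat)" if "last_item w k"
    using that by (simp add: last_item_def)
  ultimately show "(\<Sum>q<length w. of_bool (adjacent w k q)) + of_bool (last_item w k) \<le> (1::nat)"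
    by (cases "last_item w k") simp_all
  show "(\<Sum>p<length w. of_bool (adjacent w p k)) \<le> (1::nat)"
    by (rule sum_of_bool_le_1) (rule adjacent_left_unique)
qed

lemma occurrences_links:
  "v = xvar k \<or> v = yvar k \<Longrightarrow> occurrences (links w) v \<le>
    (\<Sum>q<length w. of_bool (adjacent w k q)) + (\<Sum>p<length w. of_bool (adjacent w p k))"
  unfolding links_def by (rule occurrences_pairs) (auto simp: occurrences_def)

lemma occurrences_turns:
  "v = xvar k \<or> v = yvar k \<Longrightarrow> occurrences (turns w) v \<le> of_bool (last_item w k)"
proof -
  assume v: "v = xvar k \<or> v = yvar k"
  have "occurrences (if last_item w p then [[Neg (xvar p), Pos (yvar p)]] else []) v =
      (if p = k then of_bool (last_item w k) else 0)" for p
    using v by (auto simp: occurrences_def)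
  then show ?thesis unfolding turns_def by (simp add: occurrences_concat sum.delta)
qed

lemma occurrences_exclusions: "occurrences (exclusions w) (yvar k) \<le> 1" "occurrences (exclusions w) (xvar k) = 0"
proof -
  \<comment> \<open>Twins are listed in increasing order, so k may be either component of its
    pair.\<close>
  let ?P = "\<lambda>q. twins w k q \<or> twins w q k"
  have "occurrences (exclusions w) (yvar k) \<le>
      (\<Sum>q<length w. of_bool (twins w k q)) + (\<Sum>p<length w. of_bool (twins w p k))"
    unfolding exclusions_def by (rule occurrences_pairs) (auto simp: occurrences_def)
  also have "\<dots> = (\<Sum>q<length w. of_bool (?P q))"
    unfolding sum.distrib[symmetric] by (intro sum.cong) (auto simp: twins_def)
  also have "\<dots> \<le> 1"
  proof (rule sum_of_bool_le_1)
    fix p q assume "?P p" "?P q"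
    moreover have "citem w k \<and> citem w r \<and> same_name w k r \<and> r \<noteq> k" if "?P r" for r
      using that unfolding twins_def same_name_def by auto
    ultimately show "p = q" using twin_unique[of k p q] by blast
  qed
  finally show "occurrences (exclusions w) (yvar k) \<le> 1" .
  show "occurrences (exclusions w) (xvar k) = 0"
    unfolding exclusions_def by (simp add: occurrences_concat) (simp add: occurrences_def)
qed

text \<open>\<open>xvar k\<close> can occur only in the clause of an entry u of the universe with
  the name of k, and the universe lists that name at most once.\<close>

lemma occurrences_coverings: "occurrences (coverings w) (xvar k) \<le> 1" "occurrences (coverings w) (yvar k) = 0"
proof -
  define cl where "cl = (\<lambda>u. concat (map (\<lambda>q. if citem w q \<and> same_name w u q
      then [Pos (xvar q)] else []) [0..<length w]))"
  have coverings: "coverings w = concat (map (\<lambda>u. if compulsory w u then [cl u] else []) [0..<length w])"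
    by (simp only: coverings_def cl_def)
  have "count_list (map var (if citem w q \<and> same_name w u q then [Pos (xvar q)] else [])) (xvar k) =
      (if q = k then of_bool (citem w k \<and> same_name w u k) else 0)" for u q by simp
  then have "count_list (map var (cl u)) (xvar k) \<le> of_bool (same_name w u k)" for u
    by (simp add: cl_def count_list_concat sum.delta del: map_concat)
  then have "occurrences (if compulsory w u then [cl u] else []) (xvar k) \<le> of_bool (compulsory w u \<and> same_name w u k)" for u
    by (cases "compulsory w u") (simp_all add: occurrences_Cons)
  then have "occurrences (coverings w) (xvar k) \<le> (\<Sum>u<length w. of_bool (compulsory w u \<and> same_name w u k))"
    unfolding coverings occurrences_concat by (intro sum_mono)
  also have "\<dots> \<le> 1"
    by (rule sum_of_bool_le_1, rule item_unique) (auto simp: compulsory_def same_name_def)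
  finally show "occurrences (coverings w) (xvar k) \<le> 1" .
  have "count_list (map var (if citem w q \<and> same_name w u q then [Pos (xvar q)] else [])) (yvar k) = 0" for u q
    by simp
  then have "count_list (map var (cl u)) (yvar k) = 0" for u
    by (simp add: cl_def count_list_concat del: map_concat)
  then have "occurrences (if compulsory w u then [cl u] else []) (yvar k) = 0" for u
    by (simp add: occurrences_Cons)
  then show "occurrences (coverings w) (yvar k) = 0"
    unfolding coverings occurrences_concat by simp
qed

lemma vars_cover_formula: "vars (cover_formula w) \<subseteq> xvar ` {p. citem w p} \<union> yvar ` {p. citem w p}"
  unfolding vars_def cover_formula_def
  by (auto simp: set_links set_turns set_exclusions set_coverings adjacent_def last_item_def twins_def
    split: if_splits)

text \<open>Links and turns contribute at most two: one towards the next item, or the turn at the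
  last item, and one towards the previous item. The third is an exclusion for a \<open>yvar\<close>
  and a covering for an \<open>xvar\<close>.\<close>

lemma occurrences_cover_formula:
  assumes "v \<in> vars (cover_formula w)"
  shows "occurrences (cover_formula w) v \<le> 3"
proof -
  obtain k where v: "v = xvar k \<or> v = yvar k" using assms vars_cover_formula by blast
  have "occurrences (exclusions w) v + occurrences (coverings w) v \<le> 1"
    using v occurrences_exclusions[of k] occurrences_coverings[of k] by auto
  then show ?thesis
    using occurrences_links[OF v] occurrences_turns[OF v] adjacent_sums[of k]
    unfolding cover_formula_def occurrences_append by linarith
qed

text \<open>Two variables for each occurrence of an element in a set, and at most three elements per
  set.\<close>

lemma cover_formula_size: "card (vars (cover_formula w)) \<le> 6 * m_set w"
proof -
  have fin: "finite {p. citem w p}" by (rule finite_items)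
  have "card (vars (cover_formula w)) \<le> card (xvar ` {p. citem w p} \<union> yvar ` {p. citem w p})"
    using fin by (intro card_mono vars_cover_formula) auto
  also have "\<dots> \<le> card (xvar ` {p. citem w p}) + card (yvar ` {p. citem w p})" by (rule card_Un_le)
  also have "\<dots> \<le> card {p. citem w p} + card {p. citem w p}"
    using fin by (intro add_mono card_image_le)
  finally have 1: "card (vars (cover_formula w)) \<le> 2 * card {p. citem w p}" by simp
  have "{p. citem w p} = (\<Union>k\<in>{2..<clauses w}. {p. item w p \<and> cnum w p = k})"
    using cnum_less by auto
  then have "card {p. citem w p} \<le> (\<Sum>k\<in>{2..<clauses w}. card {p. item w p \<and> cnum w p = k})"
    using card_UN_le[of "{2..<clauses w}" "\<lambda>k. {p. item w p \<and> cnum w p = k}"] by simp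
  also have "\<dots> \<le> (\<Sum>k\<in>{2..<clauses w}. 3)"
    using valid by (intro sum_mono) (auto simp: valid_cover_def clause_length_card[symmetric])
  also have "\<dots> = 3 * card (sets w)"
    using is_instanceD(3)[OF inst] by (simp add: card_image)
  also have "\<dots> = 3 * m_set w" using m_set_eq[OF is_instance_encodes[OF inst]] by simp
  finally show ?thesis using 1 by simp
qed

end

section \<open>Printing formulas in logarithmic space\<close>

definition ls_clause :: "(sym list \<Rightarrow> nat list \<Rightarrow> literal list) \<Rightarrow> bool" where
  "ls_clause cl \<longleftrightarrow> ls_out (\<lambda>w \<rho>. concat (map enc_literal (cl w \<rho>)))"

definition ls_cnf :: "(sym list \<Rightarrow> nat list \<Rightarrow> cnf) \<Rightarrow> bool" where
  "ls_cnf F \<longleftrightarrow> ls_out (\<lambda>w \<rho>. enc_cnf (F w \<rho>))"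

named_theorems ls_formula

lemma ls_clause_Nil [ls_formula]: "ls_clause (\<lambda>w \<rho>. [])"
  by (simp add: ls_clause_def ls_out_Nil)

lemma ls_out_replicate: "ls_fun a \<Longrightarrow> ls_out (\<lambda>w \<rho>. replicate (a w \<rho>) s)"
proof -
  assume "ls_fun a"
  then have "ls_out (\<lambda>w \<rho>. concat (map (\<lambda>v. [s]) [0..<a w \<rho>]))"
    by (rule ls_out_loop[where f = "\<lambda>w \<rho> v. [s]", OF ls_out_single])
  moreover have "concat (map (\<lambda>v. [s]) [0..<n]) = replicate n s" for n
    by (induction n) (simp_all add: replicate_append_same)
  ultimately show ?thesis by simp
qed

lemma ls_clause_Pos [ls_formula]:
  assumes "ls_fun a" and "ls_clause cl"
  shows "ls_clause (\<lambda>w \<rho>. Pos (unary (a w \<rho>)) # cl w \<rho>)"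
  using ls_out_Cons[OF ls_out_append[OF ls_out_replicate[OF assms(1), of "SBit True"] assms(2)[unfolded ls_clause_def]], of SItem]
  by (simp add: ls_clause_def unary_def)

lemma ls_clause_Neg [ls_formula]:
  assumes "ls_fun a" and "ls_clause cl"
  shows "ls_clause (\<lambda>w \<rho>. Neg (unary (a w \<rho>)) # cl w \<rho>)"
  using ls_out_Cons[OF ls_out_Cons[OF ls_out_append[OF ls_out_replicate[OF assms(1), of "SBit True"]
    assms(2)[unfolded ls_clause_def]], of SNeg], of SItem]
  by (simp add: ls_clause_def unary_def)

lemma ls_clause_if [ls_formula]:
  assumes "ls_pred P" and "ls_clause cl" and "ls_clause cl'"
  shows "ls_clause (\<lambda>w \<rho>. if P w \<rho> then cl w \<rho> else cl' w \<rho>)"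
  using ls_out_if[OF assms[unfolded ls_clause_def]] by (simp add: ls_clause_def if_distrib)

lemma ls_clause_loop [ls_formula]:
  assumes "ls_clause (\<lambda>w \<rho>. f w (tl \<rho>) (hd \<rho>))" and "ls_fun a"
  shows "ls_clause (\<lambda>w \<rho>. concat (map (\<lambda>v. f w \<rho> v) [0..<a w \<rho>]))"
proof -
  have "ls_out (\<lambda>w \<rho>. concat (map (\<lambda>v. concat (map enc_literal (f w \<rho> v))) [0..<a w \<rho>]))"
    by (rule ls_out_loop[where f = "\<lambda>w \<rho> v. concat (map enc_literal (f w \<rho> v))"])
      (use assms in \<open>simp_all add: ls_clause_def\<close>)
  moreover have "concat (map (\<lambda>v. concat (map enc_literal (g v))) [0..<n]) =
      concat (map enc_literal (concat (map g [0..<n])))" for g n by (induction n) simp_all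
  ultimately show ?thesis unfolding ls_clause_def by simp
qed

lemma enc_cnf_append: "enc_cnf (\<phi> @ \<psi>) = enc_cnf \<phi> @ enc_cnf \<psi>"
  by (simp add: enc_cnf_def)

lemma ls_cnf_Nil [ls_formula]: "ls_cnf (\<lambda>w \<rho>. [])"
  by (simp add: ls_cnf_def enc_cnf_def ls_out_Nil)

lemma ls_cnf_Cons [ls_formula]:
  assumes "ls_clause cl" and "ls_cnf F"
  shows "ls_cnf (\<lambda>w \<rho>. cl w \<rho> # F w \<rho>)"
  using ls_out_append[OF assms(1)[unfolded ls_clause_def] ls_out_Cons[OF assms(2)[unfolded ls_cnf_def], of SEnd]]
  by (simp add: ls_cnf_def enc_cnf_def)

lemma ls_cnf_append [ls_formula]:
  assumes "ls_cnf F" and "ls_cnf G"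
  shows "ls_cnf (\<lambda>w \<rho>. F w \<rho> @ G w \<rho>)"
  using ls_out_append[OF assms[unfolded ls_cnf_def]] by (simp add: ls_cnf_def enc_cnf_append)

lemma ls_cnf_if [ls_formula]:
  assumes "ls_pred P" and "ls_cnf F" and "ls_cnf G"
  shows "ls_cnf (\<lambda>w \<rho>. if P w \<rho> then F w \<rho> else G w \<rho>)"
  using ls_out_if[OF assms[unfolded ls_cnf_def]] by (simp add: ls_cnf_def if_distrib)

lemma ls_cnf_loop [ls_formula]:
  assumes "ls_cnf (\<lambda>w \<rho>. f w (tl \<rho>) (hd \<rho>))" and "ls_fun a"
  shows "ls_cnf (\<lambda>w \<rho>. concat (map (\<lambda>v. f w \<rho> v) [0..<a w \<rho>]))"
proof -
  have "ls_out (\<lambda>w \<rho>. concat (map (\<lambda>v. enc_cnf (f w \<rho> v)) [0..<a w \<rho>]))"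
    by (rule ls_out_loop[where f = "\<lambda>w \<rho> v. enc_cnf (f w \<rho> v)"])
      (use assms in \<open>simp_all add: ls_cnf_def\<close>)
  moreover have "concat (map (\<lambda>v. enc_cnf (g v)) [0..<n]) = enc_cnf (concat (map g [0..<n]))" for g n
    by (induction n) (simp_all add: enc_cnf_append, simp add: enc_cnf_def)
  ultimately show ?thesis unfolding ls_cnf_def by simp
qed

lemma ls_adjacent [ls_intros]: "ls_fun a \<Longrightarrow> ls_fun b \<Longrightarrow> ls_pred (\<lambda>w \<rho>. adjacent w (a w \<rho>) (b w \<rho>))"
  by (rule ls_pred_app2[where P = adjacent]) (unfold adjacent_def, (rule ls_intros | assumption)+)

lemma ls_last_item [ls_intros]: "ls_fun a \<Longrightarrow> ls_pred (\<lambda>w \<rho>. last_item w (a w \<rho>))"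
  by (rule ls_pred_app1[where P = last_item]) (unfold last_item_def, (rule ls_intros | assumption)+)

lemma ls_twins [ls_intros]: "ls_fun a \<Longrightarrow> ls_fun b \<Longrightarrow> ls_pred (\<lambda>w \<rho>. twins w (a w \<rho>) (b w \<rho>))"
  by (rule ls_pred_app2[where P = twins]) (unfold twins_def, (rule ls_intros | assumption)+)

lemma ls_compulsory [ls_intros]: "ls_fun a \<Longrightarrow> ls_pred (\<lambda>w \<rho>. compulsory w (a w \<rho>))"
  by (rule ls_pred_app1[where P = compulsory]) (unfold compulsory_def, (rule ls_intros | assumption)+)

lemma ls_clause_subset [ls_intros]:
  "ls_fun a \<Longrightarrow> ls_fun b \<Longrightarrow> ls_pred (\<lambda>w \<rho>. clause_subset w (a w \<rho>) (b w \<rho>))"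
  by (rule ls_pred_app2[where P = clause_subset]) (unfold clause_subset_def, (rule ls_intros | assumption)+)

lemma ls_valid_cover [ls_intros]: "ls_pred (\<lambda>w \<rho>. valid_cover c w)"
  unfolding valid_cover_def is_instance_def by (rule ls_intros)+

lemma ls_cover_formula: "ls_cnf (\<lambda>w \<rho>. cover_formula w)"
  unfolding cover_formula_def links_def turns_def exclusions_def coverings_def xvar_def yvar_def
  by (rule ls_formula ls_intros)+

lemma XCE3_2_reducible: "(XCE3_2 c, m_set) \<le>sL_m (SAT2_3, m_vbl)"
proof -
  \<comment> \<open>Invalid inputs go to the formula whose only clause is empty: unsatisfiable and
    without variables.\<close>
  let ?F = "\<lambda>w. if valid_cover c w then cover_formula w else [[]]"
  have "ls_cnf (\<lambda>w \<rho>. ?F w)"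
    by (rule ls_formula ls_intros ls_cover_formula)+
  then have "poly_time_log_space_computable (\<lambda>w. enc_cnf (?F w))"
    unfolding ls_cnf_def by (rule ls_out_computable)
  moreover have "w \<in> XCE3_2 c \<longleftrightarrow> enc_cnf (?F w) \<in> SAT2_3" for w
  proof (cases "valid_cover c w")
    case True
    then interpret cover c w by unfold_locales
    have "enc_cnf (cover_formula w) \<in> SAT2_3 \<longleftrightarrow> satisfiable (cover_formula w)"
      unfolding SAT2_3_def using is_2cnf_cover_formula occurrences_cover_formula by (auto simp: enc_cnf_inject)
    then show ?thesis
      using True XCE3_2_iff[of w c] satisfiable_imp_cover cover_imp_satisfiable by auto
  next
    case False
    then show ?thesis using XCE3_2_iff[of w c] by (auto simp: SAT2_3_def enc_cnf_inject satisfiable_def)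
  qed
  moreover have "real (m_vbl (enc_cnf (?F w))) \<le> 6 * real (m_set w) + 1" for w
  proof (cases "valid_cover c w")
    case True
    then interpret cover c w by unfold_locales
    have "real (card (vars (cover_formula w))) \<le> real (6 * m_set w)"
      using cover_formula_size by (simp only: of_nat_le_iff)
    then show ?thesis using True by simp
  next
    case False
    then show ?thesis by (simp add: vars_def)
  qed
  ultimately show ?thesis unfolding sL_m_reducible_def fst_conv snd_conv
    by (intro exI[of _ "\<lambda>w. enc_cnf (?F w)"] exI[of _ 6] exI[of _ 1]) auto
qed


section \<open>From 2CNF formulas to exact covers\<close>

definition valid_sat :: "sym list \<Rightarrow> bool" where
  "valid_sat w \<longleftrightarrow> well_formed w \<and> (\<forall>k<clauses w. clause_length w k \<le> 2) \<and>
    (\<forall>p<length w. item w p \<longrightarrow> (\<Sum>q<length w. of_bool (item w q \<and> same_name w p q)) \<le> (3::nat))"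

definition sat_at :: "sym list \<Rightarrow> (name \<Rightarrow> bool) \<Rightarrow> bool" where
  "sat_at w \<alpha> \<longleftrightarrow> (\<forall>k<clauses w. \<exists>p. item w p \<and> cnum w p = k \<and> (\<alpha> (name_at w p) \<longleftrightarrow> \<not> negative w p))"

lemma count_list_map_card:
  "distinct xs \<Longrightarrow> count_list (map f xs) v = card {x \<in> set xs. f x = v}"
proof (induction xs)
  case (Cons x xs)
  have "{y \<in> set (x # xs). f y = v} = (if f x = v then {x} else {}) \<union> {y \<in> set xs. f y = v}" by auto
  then show ?case using Cons by auto
qed simp

text \<open>Both facts are read off from the formula that w encodes; from then on everything speaks
  of positions in w instead of literals.\<close>

lemma SAT2_3_iff: "w \<in> SAT2_3 \<longleftrightarrow> valid_sat w \<and> (\<exists>\<alpha>. sat_at w \<alpha>)"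
  and m_vbl_well_formed: "well_formed w \<Longrightarrow> m_vbl w = card (name_at w ` {p. item w p})"
proof -
  have *: "(w \<in> SAT2_3 \<longleftrightarrow> valid_sat w \<and> (\<exists>\<alpha>. sat_at w \<alpha>)) \<and> m_vbl w = card (name_at w ` {p. item w p})"
    if wf: "well_formed w"
  proof -
    obtain \<phi> where w: "w = enc_cnf \<phi>" using wf unfolding well_formed_iff ..
    have cl: "\<phi> = map (clause_at w) [0..<clauses w]" using clauses_enc_cnf[of \<phi>] w by simp
    have it: "concat \<phi> = map (lit_at w) (items w)" using items_enc_cnf[of \<phi>] w by simp
    have vars: "vars \<phi> = name_at w ` {p. item w p}"
      unfolding vars_def it by (auto simp: set_items image_image)
    have set: "set \<phi> = clause_at w ` {..<clauses w}" by (subst cl) auto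
    have "w \<in> SAT2_3 \<longleftrightarrow> is_2cnf \<phi> \<and> (\<forall>v\<in>vars \<phi>. occurrences \<phi> v \<le> 3) \<and> satisfiable \<phi>"
      unfolding SAT2_3_def w by (auto simp: enc_cnf_inject)
    moreover have "is_2cnf \<phi> \<longleftrightarrow> (\<forall>k<clauses w. clause_length w k \<le> 2)"
      unfolding is_2cnf_def set by (auto simp: length_clause_at)
    moreover have "(\<forall>v\<in>vars \<phi>. occurrences \<phi> v \<le> 3) \<longleftrightarrow>
        (\<forall>p<length w. item w p \<longrightarrow> (\<Sum>q<length w. of_bool (item w q \<and> same_name w p q)) \<le> (3::nat))"
    proof -
      have "occurrences \<phi> (name_at w p) = (\<Sum>q<length w. of_bool (item w q \<and> same_name w p q))" for p
      proof -
        have "occurrences \<phi> (name_at w p) = count_list (map (name_at w) (items w)) (name_at w p)"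
          unfolding occurrences_def it by (simp add: comp_def)
        also have "\<dots> = card {q \<in> set (items w). name_at w q = name_at w p}"
          by (rule count_list_map_card) (rule distinct_items)
        also have "{q \<in> set (items w). name_at w q = name_at w p} =
            {q. q < length w \<and> item w q \<and> same_name w p q}"
          by (auto simp: set_items same_name_def dest: sym_at_less)
        finally show ?thesis unfolding sum_of_bool_card .
      qed
      then show ?thesis unfolding vars by (auto dest: sym_at_less)
    qed
    moreover have "satisfiable \<phi> \<longleftrightarrow> (\<exists>\<alpha>. sat_at w \<alpha>)"
      unfolding satisfiable_def set sat_at_def by (auto simp: set_clause_at)
    moreover have "m_vbl w = card (vars \<phi>)" unfolding w by simp
    ultimately show ?thesis using wf unfolding valid_sat_def vars by blast
  qed
  show "well_formed w \<Longrightarrow> m_vbl w = card (name_at w ` {p. item w p})" using * by blast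
  show "w \<in> SAT2_3 \<longleftrightarrow> valid_sat w \<and> (\<exists>\<alpha>. sat_at w \<alpha>)"
  proof (cases "well_formed w")
    case False
    then have "w \<notin> SAT2_3" unfolding well_formed_iff SAT2_3_def by blast
    with False show ?thesis by (simp add: valid_sat_def)
  qed (use * in blast)
qed

definition consecutive :: "sym list \<Rightarrow> nat \<Rightarrow> nat \<Rightarrow> bool" where
  "consecutive w p q \<longleftrightarrow> item w p \<and> item w q \<and> p < q \<and> same_name w p q \<and>
    \<not> (\<exists>r<q. p < r \<and> item w r \<and> same_name w p r)"

text \<open>
  For every occurrence p of a variable x there are two sets, the set of p and b meaning that x has
  the value b. The element \<open>3 * p\<close> lies in both, \<open>3 * q + 1\<close> identifies the values at the
  consecutive occurrences p and q of x, and \<open>3 * k + 2\<close> stands for clause k.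
\<close>

definition member :: "sym list \<Rightarrow> nat \<Rightarrow> bool \<Rightarrow> nat \<Rightarrow> bool" where
  "member w p b z \<longleftrightarrow> z = 3 * p \<or> b \<and> z = 3 * p + 1 \<or>
    \<not> b \<and> (\<exists>q<length w. consecutive w p q \<and> z = 3 * q + 1) \<or>
    z = 3 * cnum w p + 2 \<and> (clause_length w (cnum w p) = 1 \<longleftrightarrow> (b \<longleftrightarrow> \<not> negative w p))"

text \<open>Clauses of length 0 are included: their element is compulsory but lies in no set, so
  there is no cover, in accordance with unsatisfiability.\<close>

definition required :: "sym list \<Rightarrow> nat \<Rightarrow> bool" where
  "required w z \<longleftrightarrow> (\<exists>p<length w. item w p \<and> z = 3 * p) \<or>
    (\<exists>q<length w. \<exists>p<q. consecutive w p q \<and> z = 3 * q + 1) \<or>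
    (\<exists>k<clauses w. clause_length w k \<le> 1 \<and> z = 3 * k + 2)"

definition choice_set :: "sym list \<Rightarrow> nat \<Rightarrow> bool \<Rightarrow> nat set" where
  "choice_set w p b = {z. z < 3 * length w \<and> member w p b z}"

definition choice_sets :: "sym list \<Rightarrow> nat set set" where
  "choice_sets w = (\<lambda>(p, b). choice_set w p b) ` {(p, b). item w p}"

abbreviation exempt :: "sym list \<Rightarrow> nat set" where
  "exempt w \<equiv> {z. z < 3 * length w \<and> \<not> required w z}"

text \<open>The residues modulo 3 keep the elements for occurrences, links and clauses
  apart.\<close>

lemma member_simps:
  "member w p b (3 * r) \<longleftrightarrow> r = p"
  "member w p b (3 * r + 1) \<longleftrightarrow> b \<and> r = p \<or> \<not> b \<and> consecutive w p r"
  "member w p b (3 * r + 2) \<longleftrightarrow> r = cnum w p \<and> (clause_length w (cnum w p) = 1 \<longleftrightarrow> (b \<longleftrightarrow> \<not> negative w p))"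
proof -
  have [simp]: "3 * x \<noteq> 3 * y + 1" "3 * x \<noteq> 3 * y + 2" "3 * x + 1 \<noteq> 3 * y" "3 * x + 2 \<noteq> 3 * y"
    "3 * x + 1 \<noteq> 3 * y + 2" "3 * x + 2 \<noteq> 3 * y + 1" for x y :: nat
    by presburger+
  show "member w p b (3 * r) \<longleftrightarrow> r = p"
    "member w p b (3 * r + 2) \<longleftrightarrow> r = cnum w p \<and> (clause_length w (cnum w p) = 1 \<longleftrightarrow> (b \<longleftrightarrow> \<not> negative w p))"
    by (auto simp: member_def simp del: One_nat_def add_2_eq_Suc' Suc_eq_plus1[symmetric])
  have "consecutive w p r \<Longrightarrow> r < length w" by (auto simp: consecutive_def dest: sym_at_less)
  then show "member w p b (3 * r + 1) \<longleftrightarrow> b \<and> r = p \<or> \<not> b \<and> consecutive w p r"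
    by (auto simp: member_def simp del: One_nat_def add_2_eq_Suc')
qed

lemma mod_3_cases: obtains r where "z = 3 * r" | r where "z = 3 * r + 1" | r where "z = 3 * r + (2::nat)"
proof -
  have "z = 3 * (z div 3) \<or> z = 3 * (z div 3) + 1 \<or> z = 3 * (z div 3) + 2" by presburger
  then show thesis using that by blast
qed

lemma consecutive_right_unique: "consecutive w p q \<Longrightarrow> consecutive w p r \<Longrightarrow> q = r"
  unfolding consecutive_def by (metis linorder_neqE_nat)

lemma consecutive_left_unique: "consecutive w p q \<Longrightarrow> consecutive w r q \<Longrightarrow> p = r"
  unfolding consecutive_def same_name_def by (metis linorder_neqE_nat)

text \<open>Keeps the elements for clauses below \<open>3 * length w\<close>.\<close>

lemma cnum_le: "cnum w p \<le> p"
  unfolding cnum_def by (rule order.trans[OF sum_mono[where g = "\<lambda>_. 1"]]) auto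

locale sat =
  fixes w :: "sym list"
  assumes valid: "valid_sat w"
begin

lemma cnum_less: "item w p \<Longrightarrow> cnum w p < clauses w"
  using valid cnum_item_less by (auto simp: valid_sat_def)

lemma clause_length_le: "k < clauses w \<Longrightarrow> clause_length w k \<le> 2"
  using valid by (simp add: valid_sat_def)

lemma clause_length_pos: "item w p \<Longrightarrow> 0 < clause_length w (cnum w p)"
  unfolding clause_length_card using finite_items by (auto simp: card_gt_0_iff)

lemma clause_pair:
  assumes "item w p" "item w q" "cnum w q = cnum w p" "p \<noteq> q" "item w r" "cnum w r = cnum w p"
  shows "r = p \<or> r = q"
proof (rule ccontr)
  assume "\<not> (r = p \<or> r = q)"
  then have "card {p, q, r} = 3" using assms(4) by auto
  moreover have "card {p, q, r} \<le> clause_length w (cnum w p)"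
    unfolding clause_length_card using assms finite_items by (intro card_mono) auto
  ultimately show False using clause_length_le[OF cnum_less[OF assms(1)]] by simp
qed

lemma clause_single:
  assumes "item w p" "clause_length w (cnum w p) \<le> 1" "item w q" "cnum w q = cnum w p"
  shows "q = p"
proof -
  have "card {q. item w q \<and> cnum w q = cnum w p} \<le> Suc 0"
    using assms(2) by (simp add: clause_length_card)
  from iffD1[OF card_le_Suc0_iff_eq[OF finite_items] this] show ?thesis using assms by simp
qed

lemma in_choice_set:
  assumes "item w p"
  shows "z \<in> choice_set w p b \<longleftrightarrow> member w p b z"
proof -
  have p: "p < length w" using assms by (rule sym_at_less)
  then have "cnum w p < length w" using cnum_le[of w p] by simp
  then have "z < 3 * length w" if "member w p b z" using that p by (auto simp: member_def)
  then show ?thesis by (auto simp: choice_set_def)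
qed

text \<open>The element \<open>3 * p\<close> reveals p, and the element of the clause of p lies in
  exactly one of the two sets of p, which reveals b. Thus no two choices collapse into one
  set.\<close>

lemma choice_set_inject:
  assumes "item w p" "item w q" "choice_set w p b = choice_set w q c"
  shows "p = q \<and> b = c"
proof -
  have eq: "member w p b z \<longleftrightarrow> member w q c z" for z
    using assms in_choice_set by blast
  have "p = q" using eq[of "3 * p"] by (simp add: member_simps)
  moreover have "b = c" using eq[of "3 * cnum w p + 2"] \<open>p = q\<close> unfolding member_simps by blast
  ultimately show ?thesis ..
qed

lemma choice_sets_iff: "A \<in> choice_sets w \<longleftrightarrow> (\<exists>p b. item w p \<and> A = choice_set w p b)"
  by (auto simp: choice_sets_def)

lemma choice_sets_image: "choice_sets w = (\<lambda>(p, b). choice_set w p b) ` ({p. item w p} \<times> UNIV)"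
  unfolding choice_sets_def by (intro arg_cong2[where f = image]) auto

lemma finite_item_set: "finite {p. item w p}"
  using finite_items[of w "\<lambda>_. True"] by simp

lemma finite_choice_sets: "finite (choice_sets w)"
  unfolding choice_sets_image using finite_item_set by (intro finite_imageI finite_SigmaI) simp_all

lemma card_one_iff: "card {A \<in> D. z \<in> A} = 1 \<longleftrightarrow> (\<exists>!A. A \<in> D \<and> z \<in> A)"
proof
  assume "card {A \<in> D. z \<in> A} = 1"
  then obtain B where B: "{A \<in> D. z \<in> A} = {B}" by (rule card_1_singletonE)
  show "\<exists>!A. A \<in> D \<and> z \<in> A" by (rule ex1I[of _ B]) (use B in blast)+
next
  assume "\<exists>!A. A \<in> D \<and> z \<in> A"
  then obtain B where "{A \<in> D. z \<in> A} = {B}" by blast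
  then show "card {A \<in> D. z \<in> A} = 1" by simp
qed

lemma card_le_one_iff:
  assumes "D \<subseteq> choice_sets w"
  shows "card {A \<in> D. z \<in> A} \<le> 1 \<longleftrightarrow> (\<forall>A\<in>D. \<forall>B\<in>D. z \<in> A \<and> z \<in> B \<longrightarrow> A = B)"
  using card_le_Suc0_iff_eq[of "{A \<in> D. z \<in> A}"] finite_subset[OF assms finite_choice_sets] by auto

text \<open>Both ends of a link carry the same variable, so exactly one of the two sets sharing the
  link is taken. The element of a unit clause lies in the satisfying set alone; that of a clause
  with two literals lies in the two falsifying sets, which are not both taken.\<close>

lemma sat_imp_cover:
  assumes sat: "sat_at w \<alpha>"
  shows "\<exists>D\<subseteq>choice_sets w. exact_cover_exempt {..<3 * length w} (exempt w) D"
proof -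
  let ?T = "\<lambda>p. choice_set w p (\<alpha> (name_at w p))"
  define D where "D = ?T ` {p. item w p}"
  have D: "D \<subseteq> choice_sets w" unfolding D_def choice_sets_def by auto
  have in_D: "A \<in> D \<and> z \<in> A \<longleftrightarrow> (\<exists>p. item w p \<and> A = ?T p \<and> member w p (\<alpha> (name_at w p)) z)" for A z
    unfolding D_def using in_choice_set by auto
  have true: "\<exists>p. item w p \<and> cnum w p = k \<and> (\<alpha> (name_at w p) \<longleftrightarrow> \<not> negative w p)" if "k < clauses w" for k
    using sat that by (simp add: sat_at_def)
  have unique: "\<exists>!A. A \<in> D \<and> z \<in> A"
    if p: "item w p" "member w p (\<alpha> (name_at w p)) z"
      and only: "\<And>q. item w q \<Longrightarrow> member w q (\<alpha> (name_at w q)) z \<Longrightarrow> q = p" for p z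
    unfolding in_D using that by blast
  have req: "\<exists>!A. A \<in> D \<and> z \<in> A" if z: "required w z" for z
  proof -
    consider p where "item w p" "z = 3 * p" | p q where "consecutive w p q" "z = 3 * q + 1"
      | k where "k < clauses w" "clause_length w k \<le> 1" "z = 3 * k + 2"
      using z unfolding required_def by blast
    then show ?thesis
    proof cases
      case 1
      then show ?thesis by (intro unique[of p]) (simp_all add: member_simps)
    next
      case 2
      then have same: "item w p" "item w q" "name_at w p = name_at w q"
        by (auto simp: consecutive_def same_name_def)
      show ?thesis
      proof (cases "\<alpha> (name_at w q)")
        case True
        show ?thesis
        proof (rule unique[of q])
          fix r assume r: "item w r" "member w r (\<alpha> (name_at w r)) z"
          then have "r = q \<or> \<not> \<alpha> (name_at w r) \<and> consecutive w r q"
            unfolding 2(2) member_simps by blast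
          then show "r = q" using True consecutive_left_unique[OF 2(1)] same(3) by auto
        qed (use same True in \<open>simp_all only: 2(2) member_simps\<close>, simp)
      next
        case False
        show ?thesis
        proof (rule unique[of p])
          fix r assume r: "item w r" "member w r (\<alpha> (name_at w r)) z"
          then have "\<alpha> (name_at w r) \<and> r = q \<or> consecutive w r q"
            unfolding 2(2) member_simps by blast
          then show "r = p" using False consecutive_left_unique[OF 2(1)] by auto
        qed (use same False 2(1) in \<open>simp_all only: 2(2) member_simps\<close>, simp)
      qed
    next
      case 3
      obtain p where p: "item w p" "cnum w p = k" "\<alpha> (name_at w p) \<longleftrightarrow> \<not> negative w p"
        using true[OF 3(1)] by blast
      have "clause_length w k = 1" using clause_length_pos[OF p(1)] p(2) 3(2) by simp
      with p have "member w p (\<alpha> (name_at w p)) z" unfolding 3(3) member_simps by simp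
      then show ?thesis
      proof (rule unique[OF p(1)])
        fix q assume "item w q" "member w q (\<alpha> (name_at w q)) z"
        moreover from this(2) have "cnum w q = cnum w p" unfolding 3(3) member_simps p(2) by simp
        ultimately show "q = p" using clause_single[OF p(1)] p(2) 3(2) by simp
      qed
    qed
  qed
  have opt: "\<forall>A\<in>D. \<forall>B\<in>D. z \<in> A \<and> z \<in> B \<longrightarrow> A = B" if "\<not> required w z" for z
  proof (intro ballI impI)
    fix A B assume "A \<in> D" "B \<in> D" "z \<in> A \<and> z \<in> B"
    then obtain p q where p: "item w p" "A = ?T p" "member w p (\<alpha> (name_at w p)) z"
      and q: "item w q" "B = ?T q" "member w q (\<alpha> (name_at w q)) z" using in_D by meson
    have "p = q"
    proof (cases z rule: mod_3_cases)
      case (1 r)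
      then show ?thesis using p(3) q(3) by (simp add: member_simps)
    next
      case (2 r)
      \<comment> \<open>No previous occurrence is linked to r, so the element can only lie in the
        set of r and True.\<close>
      have "\<not> consecutive w s r" for s
      proof
        assume c: "consecutive w s r"
        then have "s < r" "r < length w" by (auto simp: consecutive_def dest: sym_at_less)
        with c that 2 show False unfolding required_def by blast
      qed
      then show ?thesis using p(3) q(3) unfolding 2 member_simps by blast
    next
      case (3 k)
      have cn: "cnum w p = k" "cnum w q = k" using p(3) q(3) unfolding 3 member_simps by auto
      then have k: "k < clauses w" using cnum_less[OF p(1)] by simp
      with that have "\<not> clause_length w k \<le> 1" unfolding required_def 3 by blast
      then have "clause_length w k \<noteq> 1" by simp
      then have neg: "\<alpha> (name_at w p) \<longleftrightarrow> negative w p" "\<alpha> (name_at w q) \<longleftrightarrow> negative w q"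
        using p(3)[unfolded 3 member_simps cn] q(3)[unfolded 3 member_simps cn] by blast+
      \<comment> \<open>r is a true literal of the clause. If p and q differ, they are its only
        literals, so r is one of them, although both are false.\<close>
      obtain r where r: "item w r" "cnum w r = k" "\<alpha> (name_at w r) \<longleftrightarrow> \<not> negative w r" using true[OF k] by blast
      show ?thesis
      proof (rule ccontr)
        assume "p \<noteq> q"
        then have "r = p \<or> r = q" using clause_pair[of p q r] p q r cn by simp
        then show False using neg r(3) by blast
      qed
    qed
    then show "A = B" using p q by simp
  qed
  have "exact_cover_exempt {..<3 * length w} (exempt w) D"
    unfolding exact_cover_exempt_def card_one_iff card_le_one_iff[OF D] using req opt by auto
  then show ?thesis using D by blast
qed

lemma consecutive_predecessor:
  assumes "item w p" "item w q" "p < q" "same_name w p q"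
  shows "\<exists>r. consecutive w r q \<and> p \<le> r"
proof -
  let ?S = "{r. item w r \<and> r < q \<and> same_name w r q}"
  define r where "r = Max ?S"
  have "finite ?S" by (rule finite_items)
  moreover have "p \<in> ?S" using assms by simp
  ultimately have "r \<in> ?S" and le: "\<And>s. s \<in> ?S \<Longrightarrow> s \<le> r"
    unfolding r_def using Max_in[of ?S] Max_ge[of ?S] by blast+
  then have r: "item w r" "r < q" "same_name w r q" "p \<le> r" using \<open>p \<in> ?S\<close> by auto
  moreover have "\<not> (\<exists>s<q. r < s \<and> item w s \<and> same_name w r s)"
  proof
    assume "\<exists>s<q. r < s \<and> item w s \<and> same_name w r s"
    then obtain s where "s < q" "r < s" "item w s" "same_name w r s" by blast
    then show False using le[of s] r(3) by (simp add: same_name_def)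
  qed
  ultimately show ?thesis using assms(2) unfolding consecutive_def by blast
qed

lemma cover_imp_sat:
  assumes D: "D \<subseteq> choice_sets w" and cover: "exact_cover_exempt {..<3 * length w} (exempt w) D"
  shows "\<exists>\<alpha>. sat_at w \<alpha>"
proof -
  have bound: "z < 3 * length w" if "required w z" for z
    using that cnum_le[of w "length w"] unfolding required_def by auto
  have req: "\<exists>!A. A \<in> D \<and> z \<in> A" if "required w z" for z
    using that bound[OF that] cover unfolding exact_cover_exempt_def card_one_iff by blast
  have opt: "A = B" if "\<not> required w z" "z < 3 * length w" "A \<in> D" "B \<in> D" "z \<in> A" "z \<in> B" for z A B
    using that cover unfolding exact_cover_exempt_def card_le_one_iff[OF D] by blast
  \<comment> \<open>The value read off at the occurrence p; the links will show that it depends on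
    the variable only.\<close>
  define \<beta> where "\<beta> = (\<lambda>p. choice_set w p True \<in> D)"
  \<comment> \<open>The compulsory element \<open>3 * p\<close> lies in the two sets of p and in no
    other, so exactly one of them is chosen.\<close>
  have chosen: "choice_set w p b \<in> D \<longleftrightarrow> (b \<longleftrightarrow> \<beta> p)" if "item w p" for p b
  proof -
    have "required w (3 * p)" using that unfolding required_def by (blast dest: sym_at_less)
    then obtain A where A: "A \<in> D" "3 * p \<in> A" and unique: "\<And>B. B \<in> D \<Longrightarrow> 3 * p \<in> B \<Longrightarrow> B = A"
      using req by metis
    obtain q b' where q: "item w q" "A = choice_set w q b'" using A(1) D choice_sets_iff by blast
    then have "q = p" using A(2) by (simp add: in_choice_set member_simps)
    have "choice_set w p b \<in> D \<longleftrightarrow> b = b'" for b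
    proof
      assume "choice_set w p b \<in> D"
      moreover have "3 * p \<in> choice_set w p b" unfolding in_choice_set[OF that] member_simps ..
      ultimately have "choice_set w p b = choice_set w p b'" using unique q(2) \<open>q = p\<close> by blast
      then show "b = b'" using choice_set_inject[OF that that] by blast
    qed (use A(1) q(2) \<open>q = p\<close> in simp)
    then show ?thesis unfolding \<beta>_def by (cases b) auto
  qed
  \<comment> \<open>The compulsory element \<open>3 * q + 1\<close> lies only in the set of q and
    True and in that of p and False. As exactly one of them is chosen, both directions follow at
    once.\<close>
  have step: "\<beta> q \<longleftrightarrow> \<beta> p" if c: "consecutive w p q" for p q
  proof -
    have pq: "item w p" "item w q" "p < q" "q < length w" using c by (auto simp: consecutive_def dest: sym_at_less)
    with c have "required w (3 * q + 1)" unfolding required_def by blast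
    from req[OF this] have ex: "\<exists>A\<in>D. 3 * q + 1 \<in> A"
      and un: "\<And>A B. A \<in> D \<Longrightarrow> 3 * q + 1 \<in> A \<Longrightarrow> B \<in> D \<Longrightarrow> 3 * q + 1 \<in> B \<Longrightarrow> A = B" by blast+
    have 1: "3 * q + 1 \<in> choice_set w q True" "3 * q + 1 \<in> choice_set w p False"
      unfolding in_choice_set[OF pq(1)] in_choice_set[OF pq(2)] member_simps using c by auto
    have "\<not> (choice_set w q True \<in> D \<and> choice_set w p False \<in> D)"
      using un[OF _ 1(1) _ 1(2)] choice_set_inject[OF pq(2,1)] by blast
    moreover have "choice_set w q True \<in> D \<or> choice_set w p False \<in> D"
    proof -
      obtain A where A: "A \<in> D" "3 * q + 1 \<in> A" using ex by blast
      then obtain r b where r: "item w r" "A = choice_set w r b" using D choice_sets_iff by blast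
      then have "b \<and> q = r \<or> \<not> b \<and> consecutive w r q" using A(2) in_choice_set[OF r(1)] member_simps(2) by blast
      then show ?thesis using A(1) r consecutive_left_unique[OF c] by auto
    qed
    ultimately show ?thesis using chosen[OF pq(1), of False] chosen[OF pq(2), of True] by blast
  qed
  have same: "\<beta> p \<longleftrightarrow> \<beta> q" if "item w p" "item w q" "p \<le> q" "name_at w p = name_at w q" for p q
    using that
  proof (induction q rule: less_induct)
    case (less q)
    show ?case
    proof (cases "p = q")
      case False
      then obtain r where r: "consecutive w r q" "p \<le> r"
        using consecutive_predecessor[of p q] less.prems by (auto simp: same_name_def)
      then have "r < q" "item w r" "name_at w p = name_at w r" using less.prems
        by (auto simp: consecutive_def same_name_def)
      with less.IH[OF this(1) less.prems(1) this(2) r(2) this(3)] step[OF r(1)] show ?thesis by blast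
    qed simp
  qed
  define \<alpha> where "\<alpha> = (\<lambda>v. \<exists>p. item w p \<and> name_at w p = v \<and> \<beta> p)"
  have \<alpha>: "\<alpha> (name_at w p) \<longleftrightarrow> \<beta> p" if "item w p" for p
  proof
    assume "\<alpha> (name_at w p)"
    then obtain q where "item w q" "name_at w q = name_at w p" "\<beta> q" unfolding \<alpha>_def by blast
    then show "\<beta> p" using same[of p q] same[of q p] that by (cases "p \<le> q") auto
  qed (use that in \<open>auto simp: \<alpha>_def\<close>)
  have "\<exists>p. item w p \<and> cnum w p = k \<and> (\<alpha> (name_at w p) \<longleftrightarrow> \<not> negative w p)" if k: "k < clauses w" for k
  proof (cases "clause_length w k \<le> 1")
    case True
    then have "required w (3 * k + 2)" using k unfolding required_def by blast
    from req[OF this] obtain A where A: "A \<in> D" "3 * k + 2 \<in> A" by blast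
    then obtain p b where p: "item w p" "A = choice_set w p b" using D choice_sets_iff by blast
    then have "member w p b (3 * k + 2)" using A(2) in_choice_set[OF p(1)] by simp
    then have m: "k = cnum w p" "clause_length w (cnum w p) = 1 \<longleftrightarrow> (b \<longleftrightarrow> \<not> negative w p)"
      unfolding member_simps by blast+
    have "clause_length w (cnum w p) = 1" using clause_length_pos[OF p(1)] True m(1) by simp
    with m(2) have b: "b \<longleftrightarrow> \<not> negative w p" by blast
    have "b \<longleftrightarrow> \<beta> p" using chosen[OF p(1)] A(1) p(2) by blast
    with b \<alpha>[OF p(1)] have "\<alpha> (name_at w p) \<longleftrightarrow> \<not> negative w p" by blast
    then show ?thesis using p(1) m(1) by blast
  next
    case False
    then have card: "\<not> card {p. item w p \<and> cnum w p = k} \<le> Suc 0" by (simp add: clause_length_card)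
    then obtain p q where pq: "item w p" "cnum w p = k" "item w q" "cnum w q = k" "p \<noteq> q"
      unfolding card_le_Suc0_iff_eq[OF finite_items] by blast
    have "3 * k + 2 \<noteq> 3 * x" "3 * k + 2 \<noteq> 3 * x + 1" for x by presburger+
    then have z: "\<not> required w (3 * k + 2)" using False unfolding required_def by auto
    have "k < length w" using k cnum_le[of w "length w"] by simp
    then have z': "3 * k + 2 < 3 * length w" by simp
    show ?thesis
    \<comment> \<open>If the literals at p and q were both false, both falsifying sets would be
      chosen, yet they share an element that may be covered only once.\<close>
    proof (rule ccontr)
      assume "\<not> ?thesis"
      then have "\<beta> p \<longleftrightarrow> negative w p" "\<beta> q \<longleftrightarrow> negative w q" using pq \<alpha> by blast+
      then have "choice_set w p (negative w p) \<in> D" "choice_set w q (negative w q) \<in> D"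
        using chosen pq by blast+
      moreover have "3 * k + 2 \<in> choice_set w p (negative w p)" "3 * k + 2 \<in> choice_set w q (negative w q)"
        unfolding in_choice_set[OF pq(1)] in_choice_set[OF pq(3)] member_simps using pq False by auto
      ultimately have "choice_set w p (negative w p) = choice_set w q (negative w q)"
        using opt[OF z z'] by blast
      then show False using choice_set_inject[OF pq(1,3)] pq(5) by blast
    qed
  qed
  then have "sat_at w \<alpha>" unfolding sat_at_def by blast
  then show ?thesis by blast
qed

text \<open>One element for the occurrence, at most one for a link and one for the clause: for True
  the link goes to the previous occurrence, for False to the next one.\<close>

lemma card_choice_set:
  assumes "item w p"
  shows "card (choice_set w p b) \<le> 3"
proof -
  have sub: "choice_set w p b \<subseteq> {3 * p, u, 3 * cnum w p + 2}"
    if "\<And>r. member w p b (3 * r + 1) \<Longrightarrow> 3 * r + 1 = u" for u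
  proof
    fix z assume "z \<in> choice_set w p b"
    then have z: "member w p b z" using in_choice_set[OF assms] by blast
    show "z \<in> {3 * p, u, 3 * cnum w p + 2}"
    proof (cases z rule: mod_3_cases)
      case (1 r)
      then show ?thesis using z by (simp add: member_simps)
    next
      case (2 r)
      then show ?thesis using z that by blast
    next
      case (3 r)
      then show ?thesis using z unfolding 3 member_simps by simp
    qed
  qed
  have "\<exists>u. \<forall>r. member w p b (3 * r + 1) \<longrightarrow> 3 * r + 1 = u"
    unfolding member_simps using consecutive_right_unique by (cases b) blast+
  then obtain u where "choice_set w p b \<subseteq> {3 * p, u, 3 * cnum w p + 2}" using sub by blast
  then have "card (choice_set w p b) \<le> card {3 * p, u, 3 * cnum w p + 2}" by (intro card_mono) auto
  also have "\<dots> \<le> 3" by (simp add: card_insert_if)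
  finally show ?thesis .
qed

text \<open>Two values of an occurrence, two ends of a link, at most two literals of a
  clause.\<close>

lemma choice_sets_overlap: "overlapping_cost (choice_sets w) z \<le> 2"
proof -
  have "\<exists>S. finite S \<and> card S \<le> 2 \<and> {A \<in> choice_sets w. z \<in> A} \<subseteq> (\<lambda>(p, b). choice_set w p b) ` S"
  proof (cases z rule: mod_3_cases)
    case (1 r)
    have "{A \<in> choice_sets w. z \<in> A} \<subseteq> (\<lambda>(p, b). choice_set w p b) ` {(r, True), (r, False)}"
    proof
      fix A assume "A \<in> {A \<in> choice_sets w. z \<in> A}"
      then obtain p b where "item w p" "A = choice_set w p b" "z \<in> A" using choice_sets_iff by blast
      then have "A = choice_set w r b" using in_choice_set 1 by (simp add: member_simps)
      then show "A \<in> (\<lambda>(p, b). choice_set w p b) ` {(r, True), (r, False)}" by (cases b) simp_all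
    qed
    then show ?thesis by (intro exI[of _ "{(r, True), (r, False)}"]) auto
  next
    case (2 r)
    show ?thesis
    proof (cases "\<exists>p. consecutive w p r")
      case True
      then obtain p where "consecutive w p r" by blast
      have "{A \<in> choice_sets w. z \<in> A} \<subseteq> (\<lambda>(p, b). choice_set w p b) ` {(r, True), (p, False)}"
      proof
        fix A assume "A \<in> {A \<in> choice_sets w. z \<in> A}"
        then obtain q b where q: "item w q" "A = choice_set w q b" "z \<in> A" using choice_sets_iff by blast
        then have "b \<and> r = q \<or> \<not> b \<and> consecutive w q r" using in_choice_set 2 member_simps(2) by blast
        then have "A = choice_set w r True \<or> A = choice_set w p False"
          using consecutive_left_unique[OF \<open>consecutive w p r\<close>] q(2) by (cases b) auto
        then show "A \<in> (\<lambda>(p, b). choice_set w p b) ` {(r, True), (p, False)}" by auto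
      qed
      then show ?thesis by (intro exI[of _ "{(r, True), (p, False)}"]) auto
    next
      case False
      have "{A \<in> choice_sets w. z \<in> A} \<subseteq> (\<lambda>(p, b). choice_set w p b) ` {(r, True)}"
      proof
        fix A assume "A \<in> {A \<in> choice_sets w. z \<in> A}"
        then obtain q b where q: "item w q" "A = choice_set w q b" "z \<in> A" using choice_sets_iff by blast
        then have "b \<and> r = q \<or> \<not> b \<and> consecutive w q r" using in_choice_set 2 member_simps(2) by blast
        then show "A \<in> (\<lambda>(p, b). choice_set w p b) ` {(r, True)}" using False q(2) by auto
      qed
      then show ?thesis by (intro exI[of _ "{(r, True)}"]) auto
    qed
  next
    case (3 k)
    \<comment> \<open>For each occurrence only one value puts the element of its clause into its
      set, so there is one pair per literal of clause k.\<close>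
    let ?S = "(\<lambda>p. (p, clause_length w (cnum w p) = 1 \<longleftrightarrow> \<not> negative w p)) ` {p. item w p \<and> cnum w p = k}"
    have "{A \<in> choice_sets w. z \<in> A} \<subseteq> (\<lambda>(p, b). choice_set w p b) ` ?S"
    proof
      fix A assume "A \<in> {A \<in> choice_sets w. z \<in> A}"
      then obtain p b where p: "item w p" "A = choice_set w p b" "z \<in> A" using choice_sets_iff by blast
      then have "k = cnum w p" "clause_length w (cnum w p) = 1 \<longleftrightarrow> (b \<longleftrightarrow> \<not> negative w p)"
        using in_choice_set[OF p(1)] member_simps(3) 3 by blast+
      moreover from this have "b \<longleftrightarrow> (clause_length w (cnum w p) = 1 \<longleftrightarrow> \<not> negative w p)" by blast
      ultimately show "A \<in> (\<lambda>(p, b). choice_set w p b) ` ?S" using p by force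
    qed
    moreover have "card ?S \<le> 2"
    proof (cases "\<exists>p. item w p \<and> cnum w p = k")
      case True
      then have "clause_length w k \<le> 2" using clause_length_le cnum_less by blast
      then show ?thesis
        using card_image_le[OF finite_items[of w "\<lambda>p. cnum w p = k"]] unfolding clause_length_card
        by (rule order.trans[rotated])
    next
      case False
      then have "{p. item w p \<and> cnum w p = k} = {}" by blast
      then show ?thesis by (simp only: image_empty card.empty)
    qed
    ultimately show ?thesis using finite_items by (intro exI[of _ ?S]) auto
  qed
  then obtain S where S: "finite S" "card S \<le> 2" "{A \<in> choice_sets w. z \<in> A} \<subseteq> (\<lambda>(p, b). choice_set w p b) ` S"
    by blast
  then have "card {A \<in> choice_sets w. z \<in> A} \<le> card S" by (meson card_image_le card_mono finite_imageI order.trans)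
  then show ?thesis using S(2) by (simp add: overlapping_cost_def)
qed

text \<open>Two values for each of at most three occurrences of a variable.\<close>

lemma card_choice_sets: "card (choice_sets w) \<le> 6 * m_vbl w"
proof -
  let ?I = "{p. item w p}"
  note fin = finite_item_set
  have "card (choice_sets w) \<le> card (?I \<times> (UNIV :: bool set))"
    unfolding choice_sets_image using fin by (intro card_image_le finite_SigmaI) simp_all
  then have 1: "card (choice_sets w) \<le> 2 * card ?I" by (simp add: card_cartesian_product)
  have "?I = (\<Union>v\<in>name_at w ` ?I. {p. item w p \<and> name_at w p = v})" by auto
  then have "card ?I \<le> (\<Sum>v\<in>name_at w ` ?I. card {p. item w p \<and> name_at w p = v})"
    using card_UN_le[of "name_at w ` ?I" "\<lambda>v. {p. item w p \<and> name_at w p = v}"] fin by simp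
  also have "\<dots> \<le> (\<Sum>v\<in>name_at w ` ?I. 3)"
  proof (rule sum_mono)
    fix v assume "v \<in> name_at w ` ?I"
    then obtain p where p: "item w p" "v = name_at w p" by blast
    have "{q. item w q \<and> name_at w q = v} = {q. q < length w \<and> item w q \<and> same_name w p q}"
      using p by (auto simp: same_name_def dest: sym_at_less)
    moreover have "(\<Sum>q<length w. of_bool (item w q \<and> same_name w p q)) \<le> (3::nat)"
      using valid p(1) sym_at_less[OF p(1)] unfolding valid_sat_def by blast
    ultimately show "card {q. item w q \<and> name_at w q = v} \<le> 3" unfolding sum_of_bool_card by simp
  qed
  also have "\<dots> = 3 * m_vbl w" using valid m_vbl_well_formed by (simp add: valid_sat_def)
  finally show ?thesis using 1 by simp
qed

end


section \<open>Binary names for the elements of the universe\<close>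

definition binary_name :: "nat \<Rightarrow> nat \<Rightarrow> name" where
  "binary_name M z = map (halving z) (filter is_power2 [0..<M])"

text \<open>Unlike variables, elements must have names of logarithmic length. The digits of weight
  below M determine a number below M, as all its other digits are 0.\<close>

lemma inj_on_binary_name: "inj_on (binary_name M) {..<M}"
proof (rule inj_onI)
  fix y z assume yz: "y \<in> {..<M}" "z \<in> {..<M}" "binary_name M y = binary_name M z"
  show "y = z"
  proof (rule bit_eqI)
    fix i
    show "bit y i \<longleftrightarrow> bit z i"
    proof (cases "2 ^ i < M")
      case True
      then have "2 ^ i \<in> set (filter is_power2 [0..<M])" by (auto simp: is_power2_def)
      then have "halving y (2 ^ i) \<longleftrightarrow> halving z (2 ^ i)" using yz(3) by (simp add: binary_name_def)
      then show ?thesis by (simp add: halving_def bit_iff_odd)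
    next
      case False
      then show ?thesis using yz by (simp add: bit_iff_odd)
    qed
  qed
qed

lemma length_binary_name: "length (binary_name M z) \<le> floorlog 2 M"
proof -
  have "length (binary_name M z) = card (set (filter is_power2 [0..<M]))"
    unfolding binary_name_def by (subst distinct_card) simp_all
  also have "\<dots> \<le> card {v. v < Suc M \<and> is_power2 v}" by (intro card_mono) auto
  finally show ?thesis unfolding floorlog_eq_sum sum_of_bool_card .
qed

lemma card_image_members:
  assumes inj: "inj_on f X" and D: "D \<subseteq> Pow X" and u: "u \<in> X"
  shows "card {A \<in> (`) f ` D. f u \<in> A} = card {A \<in> D. u \<in> A}"
proof -
  have "{A \<in> (`) f ` D. f u \<in> A} = (`) f ` {A \<in> D. u \<in> A}"
  proof -
    have "f u \<in> f ` A \<longleftrightarrow> u \<in> A" if "A \<in> D" for A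
      using inj_on_image_mem_iff[OF inj u] D that by blast
    then show ?thesis by blast
  qed
  moreover have "inj_on ((`) f) {A \<in> D. u \<in> A}"
    using inj_on_image_Pow[OF inj] by (rule inj_on_subset) (use D in auto)
  ultimately show ?thesis by (simp add: card_image)
qed

text \<open>The gadgets are verified on numbers, and an injective naming carries exact covers over
  unchanged.\<close>

lemma exact_cover_exempt_image:
  assumes inj: "inj_on f X" and R: "R \<subseteq> X" and D: "D \<subseteq> Pow X"
  shows "exact_cover_exempt (f ` X) (f ` R) ((`) f ` D) \<longleftrightarrow> exact_cover_exempt X R D"
proof -
  have "f ` X - f ` R = f ` (X - R)" using inj R by (auto simp: inj_on_def)
  then show ?thesis
    unfolding exact_cover_exempt_def using R by (auto simp: card_image_members[OF inj D] subset_iff)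
qed

definition choice_list :: "sym list \<Rightarrow> nat \<Rightarrow> bool \<Rightarrow> name list" where
  "choice_list w p b = map (binary_name (3 * length w)) (filter (member w p b) [0..<3 * length w])"

text \<open>
  The universe is padded with exempt elements in no set, so that the names are not too long for
  its size. This is harmless as only the collection counts for the size of the instance.
\<close>

definition cover_instance :: "sym list \<Rightarrow> sym list" where
  "cover_instance w =
    enc_names (map (binary_name (3 * length w)) [0..<3 * length w]) @
    enc_names (map (binary_name (3 * length w)) (filter (\<lambda>z. \<not> required w z) [0..<3 * length w])) @
    concat (map (\<lambda>p. if item w p then enc_names (choice_list w p True) @ enc_names (choice_list w p False) else [])
      [0..<length w])"

context sat
begin

abbreviation nm :: "nat \<Rightarrow> name" where
  "nm \<equiv> binary_name (3 * length w)"

abbreviation universe :: "nat set" where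
  "universe \<equiv> {..<3 * length w}"

lemma inj_nm: "inj_on nm universe"
  by (rule inj_on_binary_name)

lemma set_choice_list: "set (choice_list w p b) = nm ` choice_set w p b"
  by (auto simp: choice_list_def choice_set_def)

lemma choice_sets_Pow: "choice_sets w \<subseteq> Pow universe"
  by (auto simp: choice_sets_def choice_set_def)

lemma encodes_cover_instance:
  "encodes_instance (cover_instance w) (nm ` universe) (nm ` exempt w) ((`) nm ` choice_sets w)"
  unfolding encodes_instance_def
proof (intro exI conjI ballI)
  let ?xs = "map nm [0..<3 * length w]" and ?rs = "map nm (filter (\<lambda>z. \<not> required w z) [0..<3 * length w])"
  \<comment> \<open>Occurrence by occurrence, True before False: the order in which
    \<open>cover_instance\<close> prints the sets.\<close>
  let ?ps = "List.product (items w) [True, False]"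
  let ?cs = "map (\<lambda>(p, b). choice_list w p b) ?ps"
  have dist: "distinct (map nm (filter P [0..<3 * length w]))" for P
    unfolding distinct_map using inj_nm by (auto intro: inj_on_subset)
  from dist[of "\<lambda>_. True"] show "distinct ?xs" by simp
  show "distinct ?rs" by (rule dist)
  show "distinct as" if "as \<in> set ?cs" for as
    using that dist by (auto simp: choice_list_def)
  have "inj_on (\<lambda>(p, b). nm ` choice_set w p b) (set ?ps)"
  proof (rule inj_onI, clarify)
    fix p b q c assume pq: "(p, b) \<in> set ?ps" "(q, c) \<in> set ?ps" and eq: "nm ` choice_set w p b = nm ` choice_set w q c"
    have "choice_set w p b \<subseteq> universe" "choice_set w q c \<subseteq> universe" by (auto simp: choice_set_def)
    then have "choice_set w p b = choice_set w q c" using eq inj_on_image_eq_iff[OF inj_nm] by blast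
    then show "p = q \<and> b = c" using choice_set_inject pq by (auto simp: set_items)
  qed
  moreover have "distinct ?ps" using distinct_items by (simp add: distinct_product)
  moreover have "map set ?cs = map (\<lambda>(p, b). nm ` choice_set w p b) ?ps"
    by (auto simp: set_choice_list)
  ultimately show "distinct (map set ?cs)" by (simp only: distinct_map simp_thms)
  show "nm ` universe = set ?xs" by (simp add: atLeast0LessThan)
  show "nm ` exempt w = set ?rs" by auto
  have "set ?ps = {p. item w p} \<times> UNIV" by (auto simp: set_items)
  then show "(`) nm ` choice_sets w = set ` set ?cs"
    unfolding choice_sets_image set_map image_image by (simp add: case_prod_unfold set_choice_list)
  have "concat (map enc_names (map (\<lambda>(p, b). g p b) (List.product (filter P xs) [True, False]))) =
      concat (map (\<lambda>p. if P p then enc_names (g p True) @ enc_names (g p False) else []) xs)"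
    for g P and xs :: "nat list" by (induction xs) auto
  then show "cover_instance w = enc_names ?xs @ enc_names ?rs @ concat (map enc_names ?cs)"
    unfolding cover_instance_def items_def by simp
qed

lemma cover_instance_iff:
  assumes "0 < c"
  shows "cover_instance w \<in> XCE3_2 c \<longleftrightarrow> w \<in> SAT2_3"
proof -
  have card: "card (nm ` universe) = 3 * length w" using card_image[OF inj_nm] by simp
  have "\<forall>u\<in>nm ` universe. length u \<le> c * floorlog 2 (card (nm ` universe))"
  proof
    fix u assume "u \<in> nm ` universe"
    \<comment> \<open>The names are short enough for the constant 1, hence for every positive
      c.\<close>
    then have "length u \<le> 1 * floorlog 2 (3 * length w)" using length_binary_name by auto
    also have "\<dots> \<le> c * floorlog 2 (3 * length w)" using assms by (intro mult_le_mono1) simp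
    finally show "length u \<le> c * floorlog 2 (card (nm ` universe))" unfolding card .
  qed
  moreover have "nm ` exempt w \<subseteq> nm ` universe \<and> (\<forall>A\<in>(`) nm ` choice_sets w. A \<subseteq> nm ` universe)"
    using choice_sets_Pow by blast
  moreover have "\<forall>A\<in>(`) nm ` choice_sets w. card A \<le> 3"
  proof
    fix A assume "A \<in> (`) nm ` choice_sets w"
    then obtain B where "A = nm ` B" "B \<in> choice_sets w" by (rule imageE)
    then obtain p b where p: "item w p" "A = nm ` choice_set w p b" unfolding choice_sets_iff by auto
    have "finite (choice_set w p b)" by (simp add: choice_set_def)
    then show "card A \<le> 3"
      unfolding p(2) by (rule order.trans[OF card_image_le card_choice_set[OF p(1)]])
  qed
  moreover have "\<forall>u\<in>nm ` universe. overlapping_cost ((`) nm ` choice_sets w) u \<le> 2"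
  proof
    fix u assume "u \<in> nm ` universe"
    then obtain z where z: "z \<in> universe" "u = nm z" by blast
    have "overlapping_cost ((`) nm ` choice_sets w) u = overlapping_cost (choice_sets w) z"
      unfolding overlapping_cost_def z(2) by (rule card_image_members[OF inj_nm choice_sets_Pow z(1)])
    then show "overlapping_cost ((`) nm ` choice_sets w) u \<le> 2" using choice_sets_overlap by simp
  qed
  moreover have "(\<exists>D\<subseteq>(`) nm ` choice_sets w. exact_cover_exempt (nm ` universe) (nm ` exempt w) D) \<longleftrightarrow>
      (\<exists>D\<subseteq>choice_sets w. exact_cover_exempt universe (exempt w) D)"
  proof -
    have "exact_cover_exempt (nm ` universe) (nm ` exempt w) ((`) nm ` D) \<longleftrightarrow>
        exact_cover_exempt universe (exempt w) D" if "D \<subseteq> choice_sets w" for D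
      using that choice_sets_Pow by (intro exact_cover_exempt_image[OF inj_nm]) auto
    then show ?thesis by (auto simp: subset_image_iff)
  qed
  moreover have "(\<exists>D\<subseteq>choice_sets w. exact_cover_exempt universe (exempt w) D) \<longleftrightarrow> w \<in> SAT2_3"
    using sat_imp_cover cover_imp_sat valid SAT2_3_iff by blast
  ultimately show ?thesis unfolding XCE3_2_encodes[OF encodes_cover_instance, of c] by argo
qed

lemma cover_instance_size: "m_set (cover_instance w) \<le> 6 * m_vbl w"
proof -
  have "m_set (cover_instance w) = card ((`) nm ` choice_sets w)"
    by (rule m_set_eq[OF encodes_cover_instance])
  also have "\<dots> \<le> card (choice_sets w)" by (rule card_image_le[OF finite_choice_sets])
  finally show ?thesis using card_choice_sets by simp
qed

end

section \<open>Printing the cover instance in logarithmic space\<close>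

lemma ls_consecutive [ls_intros]:
  "ls_fun a \<Longrightarrow> ls_fun b \<Longrightarrow> ls_pred (\<lambda>w \<rho>. consecutive w (a w \<rho>) (b w \<rho>))"
  by (rule ls_pred_app2[where P = consecutive]) (unfold consecutive_def, (rule ls_intros | assumption)+)

lemma ls_member [ls_intros]:
  "ls_fun a \<Longrightarrow> ls_fun b \<Longrightarrow> ls_pred (\<lambda>w \<rho>. member w (a w \<rho>) x (b w \<rho>))"
  by (rule ls_pred_app2[where P = "\<lambda>w a b. member w a x b"]) (unfold member_def, (rule ls_intros | assumption)+)

lemma ls_required [ls_intros]: "ls_fun a \<Longrightarrow> ls_pred (\<lambda>w \<rho>. required w (a w \<rho>))"
  by (rule ls_pred_app1[where P = required]) (unfold required_def, (rule ls_intros | assumption)+)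

lemma ls_valid_sat [ls_intros]: "ls_pred (\<lambda>w \<rho>. valid_sat w)"
  unfolding valid_sat_def by (rule ls_intros)+

text \<open>Names are never stored: each is printed digit by digit, by a loop over all weights that
  prints nothing at those which are not powers of two.\<close>

lemma ls_out_binary_names:
  fixes P :: "sym list \<Rightarrow> nat list \<Rightarrow> nat \<Rightarrow> bool"
  assumes P: "ls_pred (\<lambda>w \<rho>. P w (tl \<rho>) (hd \<rho>))" and a: "ls_fun a"
  shows "ls_out (\<lambda>w \<rho>. enc_names (map (binary_name (a w \<rho>)) (filter (P w \<rho>) [0..<a w \<rho>])))"
proof -
  have name: "map SBit (binary_name M z) = concat (map (\<lambda>v. if is_power2 v
      then (if halving z v then [SBit True] else [SBit False]) else []) [0..<M])" for M z
    unfolding binary_name_def by (induction M) simp_all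
  have inner: "ls_out (\<lambda>w \<rho>. concat (map (\<lambda>v. if is_power2 v
      then (if halving (hd \<rho>) v then [SBit True] else [SBit False]) else []) [0..<a w (tl \<rho>)]))"
    by (rule ls_out_loop[where f = "\<lambda>w \<rho> v. if is_power2 v
        then (if halving (hd \<rho>) v then [SBit True] else [SBit False]) else []"])
      (rule ls_out_if ls_out_single ls_out_Nil ls_intros ls_fun_tl a)+
  have "ls_out (\<lambda>w \<rho>. concat (map (\<lambda>z. if P w \<rho> z then SItem # map SBit (binary_name (a w \<rho>) z) else [])
      [0..<a w \<rho>]) @ [SEnd])"
    by (rule ls_out_append ls_out_single
      ls_out_loop[where f = "\<lambda>w \<rho> z. if P w \<rho> z then SItem # map SBit (binary_name (a w \<rho>) z) else []"]
      a ls_out_if P ls_out_Cons ls_out_Nil | (unfold name, rule inner))+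
  moreover have "enc_names (map (binary_name M) (filter Q [0..<n])) =
      concat (map (\<lambda>z. if Q z then SItem # map SBit (binary_name M z) else []) [0..<n]) @ [SEnd]" for M n Q
    unfolding enc_names_def by (induction n) simp_all
  ultimately show ?thesis by simp
qed

lemma ls_cover_instance: "ls_out (\<lambda>w \<rho>. cover_instance w)"
proof -
  have choice: "ls_out (\<lambda>w \<rho>. enc_names (choice_list w (hd \<rho>) b))" for b
    unfolding choice_list_def
    by (rule ls_out_binary_names[where P = "\<lambda>w \<rho>. member w (hd \<rho>) b"]) (rule ls_intros)+
  have loop: "ls_out (\<lambda>w \<rho>. concat (map (\<lambda>p. if item w p
      then enc_names (choice_list w p True) @ enc_names (choice_list w p False) else []) [0..<length w]))"
    by (rule ls_out_loop[where f = "\<lambda>w \<rho> p. if item w p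
      then enc_names (choice_list w p True) @ enc_names (choice_list w p False) else []"])
      (rule ls_out_if ls_out_append ls_out_Nil choice ls_intros)+
  have all: "ls_out (\<lambda>w \<rho>. enc_names (map (binary_name (3 * length w)) [0..<3 * length w]))"
    using ls_out_binary_names[where P = "\<lambda>w \<rho> z. True" and a = "\<lambda>w \<rho>. 3 * length w"]
    by (simp add: ls_pred_const ls_fun_mult ls_fun_const ls_fun_length)
  show ?thesis
    unfolding cover_instance_def
    by (rule ls_out_append loop all
      ls_out_binary_names[where P = "\<lambda>w \<rho> z. \<not> required w z" and a = "\<lambda>w \<rho>. 3 * length w"] ls_intros)+
qed

lemma not_encodes_Nil: "\<not> encodes_instance [] X R C"
  by (simp add: encodes_instance_def enc_names_def)

lemma SAT2_3_reducible:
  assumes "0 < c"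
  shows "(SAT2_3, m_vbl) \<le>sL_m (XCE3_2 c, m_set)"
proof -
  \<comment> \<open>The empty string encodes no instance, since even empty lists have end marks. It
    is therefore a no-instance of size 0.\<close>
  let ?F = "\<lambda>w. if valid_sat w then cover_instance w else []"
  have "ls_out (\<lambda>w \<rho>. ?F w)"
    by (rule ls_out_if ls_intros ls_cover_instance ls_out_Nil)+
  then have "poly_time_log_space_computable ?F" by (rule ls_out_computable)
  moreover have "w \<in> SAT2_3 \<longleftrightarrow> ?F w \<in> XCE3_2 c" for w
  proof (cases "valid_sat w")
    case True
    then interpret sat w by unfold_locales
    show ?thesis using True cover_instance_iff[OF assms] by simp
  next
    case False
    then show ?thesis using SAT2_3_iff[of w] not_encodes_Nil by (simp add: XCE3_2_def)
  qed
  moreover have "real (m_set (?F w)) \<le> 6 * real (m_vbl w) + 1" for w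
  proof (cases "valid_sat w")
    case True
    then interpret sat w by unfold_locales
    have "real (m_set (cover_instance w)) \<le> real (6 * m_vbl w)"
      using cover_instance_size by (simp only: of_nat_le_iff)
    then show ?thesis using True by simp
  next
    case False
    then show ?thesis using not_encodes_Nil by (simp add: m_set_def)
  qed
  ultimately show ?thesis unfolding sL_m_reducible_def fst_conv snd_conv
    by (intro exI[of _ ?F] exI[of _ 6] exI[of _ 1]) auto
qed


theorem theorem4p1:
  fixes c :: nat
  assumes "c > 0"
  shows "(XCE3_2 c, m_set) \<equiv>sL_m (SAT2_3, m_vbl)"
  using XCE3_2_reducible SAT2_3_reducible[OF assms] by (simp add: sL_m_equivalent_def)

end
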